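(* Let $(Q,I)$ be a gentle presentation (with $Q$ finite, connected and having at least one arrow), and suppose that either the quiver $Q$ is not one with one vertex and one arrow whose square is in $I$, or the characteristic of $\Bbbk$ is not $2$. Let $A=\Bbbk Q/I$ and let $T$ be a spanning tree of $Q$. With respect to the cup product, the algebra $\mathrm{HH}^*(A)$ is the quotient of the free graded-commutative algebra generated by the set $\mathscr G$ (each element placed in its cohomological degree) by the ideal generated by the following elements: (1) $u\smile v$, one for each choice of $u$ and $v$ in $\mathscr G$ except those in which - $u=v=\langle\langle C\rangle\rangle$ for some $C\in\overline{\mathscr C}^{\mathsf{basic}}(\Gamma)$; - $u=v=\langle\langle\alpha\rangle\rangle$ for some $\alpha\in\overline{\mathscr C}^{\mathsf{basic}}(\mathcal B)$; - $u$ and $v$ are, in some order, $\langle\langle C\rangle\rangle$ and $(c,c)$ with $C\in\overline{\mathscr C}^{\mathsf{basic}}(\Gamma)$ and $c\in Q_1\setminus T$ an arrow through which $C$ passes; - $u$ and $v$ are, in some order, $\langle\langle\alpha\rangle\rangle$ and $(c,c)$ with $\alpha\in\overline{\mathscr C}^{\mathsf{basic}}(\mathcal B)$ and $c\in Q_1\setminus T$ an arrow through which $\alpha$ passes; (2) $(c,c)\smile\langle\langle C\rangle\rangle-(d,d)\smile\langle\langle C\rangle\rangle$, one for each choice of two distinct arrows $c,d\in Q_1\setminus T$ and of a complete cycle $C\in\overline{\mathscr C}^{\mathsf{basic}}(\Gamma)$ that passes both through $c$ and through $d$; (3) $(c,c)\smile\langle\langle\alpha\rangle\rangle-(d,d)\smile\langle\langle\alpha\rangle\rangle$,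 one for each choice of two distinct arrows $c,d\in Q_1\setminus T$ and of a cocomplete cycle $\alpha\in\overline{\mathscr C}^{\mathsf{basic}}(\mathcal B)$ that passes both through $c$ and through $d$.
   Context: $\Bbbk$ is a field. Paths in $Q=(Q_0,Q_1,s,t)$ are written from right to left ($c_m\cdots c_1$ has first arrow $c_1$, last arrow $c_m$); vertices are the paths of length $0$. $(Q,I)$ is a gentle presentation: $I$ is an ideal of $\Bbbk Q$ generated by paths of length $2$; every vertex is the source of at most two and the target of at most two arrows; for every arrow $a$ there is at most one arrow $b$ with $t(b)=s(a)$ and $ab\notin I$, at most one arrow $c$ with $t(a)=s(c)$ and $ca\notin I$, at most one arrow $b$ with $t(b)=s(a)$ and $ab\in I$, and at most one arrow $c$ with $t(a)=s(c)$ and $ca\in I$. $R$ is the set of paths of length $2$ in $I$; $\mathcal B$ the set of paths with no subpath in $R$; $\Gamma$ the set of paths all of whose subpaths of length $2$ are in $R$; $\Gamma_m$ its subset of paths of length $m$. A path is $\mathcal B$-maximal (resp. $\Gamma$-maximal) if it is in $\mathcal B$ (resp. $\Gamma$) and is not a proper subpath of another element of that set. A spanning tree is the set of arrows of a connected subquiver, acyclic as an undirected graph, containing all vertices. $\Gamma_m\parallel\mathcal B$ is the set of pairs $(\gamma,\alpha)\in\Gamma_m\times\mathcal B$ of paths with the same source and the same target. The spaces $\Bbbk(\Gamma_m\parallel\mathcal B)$ form a cochain complex with $d^m(\gamma,\alpha)=\sum_b(b\gamma,b\alpha)-(-1)^m\sum_a(\gamma a,\alpha a)$, sums over arrows for which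 the displayed pair is in $\Gamma_{m+1}\parallel\mathcal B$; via the Bardzell resolution its cohomology is identified with $\mathrm{HH}^*(A)$. The cup product is induced by $(\gamma,\alpha)\smile(\gamma',\alpha')=(\gamma\gamma',\alpha\alpha')$ if $\gamma\gamma'\in\Gamma$ and $\alpha\alpha'\in\mathcal B$, and $0$ otherwise. A cycle is a path of positive length with equal source and target; $\mathrm{rot}(c_m\cdots c_1)=c_{m-1}\cdots c_1c_m$; circuits are classes of cycles under rotation; the period of a cycle $C$ is the least $i\ge1$ with $\mathrm{rot}^i(C)=C$; a cycle is primitive if it is not a proper power of another cycle. A cycle $C$ is complete if $C^2\in\Gamma$ and cocomplete if $C^2\in\mathcal B$. $\overline{\mathscr C}^{\mathsf{basic}}(\mathcal B)$ is a set of representatives of the primitive cocomplete circuits. $\overline{\mathscr C}^{\mathsf{basic}}(\Gamma)$ is obtained from a set of representatives $D$ of the primitive complete circuits: it consists of these $D$ if $\mathrm{char}\,\Bbbk=2$, and otherwise of the $D$ of even length and the squares $D^2$ of those of odd length. For $\alpha$ cocomplete of period $r$, $\langle\langle\alpha\rangle\rangle=\sum_{i=0}^{r-1}(s(\mathrm{rot}^i\alpha),\mathrm{rot}^i\alpha)$ (degree $0$); for $C\in\overline{\mathscr C}^{\mathsf{basic}}(\Gamma)$ of length $m$ and period $r$, $\langle\langle C\rangle\rangle=\sum_{i=0}^{r-1}(\mathrm{rot}^iC,s(\mathrm{rot}^iC))$ (degree $m$). $\mathscr G\subset\mathrm{HH}^*(A)$ is the set of cohomology classes of: the pairs $(s(\alpha),\alpha)$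 with $\alpha$ a $\mathcal B$-maximal cycle; the $\langle\langle\alpha\rangle\rangle$ with $\alpha\in\overline{\mathscr C}^{\mathsf{basic}}(\mathcal B)$; the pairs $(c,c)$ with $c\in Q_1\setminus T$; the pairs $(\gamma,\alpha)\in\Gamma\parallel\mathcal B$ with $\gamma$ $\Gamma$-maximal and $\gamma,\alpha$ neither beginning nor ending with the same arrow; and the $\langle\langle C\rangle\rangle$ with $C\in\overline{\mathscr C}^{\mathsf{basic}}(\Gamma)$. In the free graded-commutative algebra, generators of odd degree square to zero if $\mathrm{char}\,\Bbbk\neq2$; if $\mathrm{char}\,\Bbbk=2$ it is the commutative polynomial algebra.
   Formalization: The case where Q has one vertex e and one arrow x with x² not in I (so A = k[x]) is also excluded: there the product of (x,e) and ⟨⟨x⟩⟩ = (e,x) is (x,x) ≠ 0, although relation (1) would make it zero. *)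

theory Defs
  imports "Graph_Theory.Graph_Theory" "HOL-Algebra.QuotRing" "HOL-Library.Poly_Mapping"
    "HOL-Computational_Algebra.Computational_Algebra"
begin

section \<open>Vector spaces with a basis\<close>

text \<open>
  The \<open>k\<close>-vector space with basis a set \<open>X\<close> is the set \<open>kspace X\<close> of the finitely supported functions
  (type \<open>\<Rightarrow>\<^sub>0\<close>) whose support is contained in \<open>X\<close>; the basis vector of \<open>x\<close> is \<open>single x 1\<close>.
\<close>

definition kspace :: "'x set \<Rightarrow> ('x \<Rightarrow>\<^sub>0 'k::field) set" where
  "kspace X = {f. Poly_Mapping.keys f \<subseteq> X}"

definition scale :: "'k::field \<Rightarrow> ('x \<Rightarrow>\<^sub>0 'k) \<Rightarrow> ('x \<Rightarrow>\<^sub>0 'k)" where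
  "scale c f = Poly_Mapping.map ((*) c) f"

definition basis :: "'x \<Rightarrow> ('x \<Rightarrow>\<^sub>0 'k::field)" where
  "basis x = Poly_Mapping.single x 1"

definition linear_ext :: "('x \<Rightarrow> ('y \<Rightarrow>\<^sub>0 'k::field)) \<Rightarrow> ('x \<Rightarrow>\<^sub>0 'k) \<Rightarrow> ('y \<Rightarrow>\<^sub>0 'k)" where
  "linear_ext b f = (\<Sum>x\<in>Poly_Mapping.keys f. scale (Poly_Mapping.lookup f x) (b x))"

definition bilinear_ext ::
  "('x \<Rightarrow> 'y \<Rightarrow> ('z \<Rightarrow>\<^sub>0 'k::field)) \<Rightarrow> ('x \<Rightarrow>\<^sub>0 'k) \<Rightarrow> ('y \<Rightarrow>\<^sub>0 'k) \<Rightarrow> ('z \<Rightarrow>\<^sub>0 'k)" where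
  "bilinear_ext b f g = linear_ext (\<lambda>x. linear_ext (b x) g) f"

section \<open>Quivers and paths\<close>

text \<open>
  A quiver is a directed multigraph; \<open>s\<close> and \<open>t\<close> are \<^const>\<open>tail\<close> and \<^const>\<open>head\<close>.
  The path written \<open>c\<^sub>m \<cdots> c\<^sub>1\<close> is the pair of its source and the list \<open>[c\<^sub>1, \<dots>, c\<^sub>m]\<close> of its arrows
  in the order in which they are traversed; the path of length \<open>0\<close> at \<open>v\<close> is \<open>(v, [])\<close>.
\<close>

type_synonym ('v, 'a) path = "'v \<times> 'a list"

definition paths :: "('v, 'a) pre_digraph \<Rightarrow> ('v, 'a) path set" where
  "paths Q = {(u, p). \<exists>v. pre_digraph.awalk Q u p v}"

definition plen :: "('v, 'a) path \<Rightarrow> nat" where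
  "plen \<pi> = length (snd \<pi>)"

definition psrc :: "('v, 'a) path \<Rightarrow> 'v" where
  "psrc \<pi> = fst \<pi>"

definition ptgt :: "('v, 'a) pre_digraph \<Rightarrow> ('v, 'a) path \<Rightarrow> 'v" where
  "ptgt Q \<pi> = last (pre_digraph.awalk_verts Q (fst \<pi>) (snd \<pi>))"

definition vertex_path :: "'v \<Rightarrow> ('v, 'a) path" where
  "vertex_path v = (v, [])"

definition arrow_path :: "('v, 'a) pre_digraph \<Rightarrow> 'a \<Rightarrow> ('v, 'a) path" where
  "arrow_path Q a = (tail Q a, [a])"

text \<open>\<open>pcomp \<beta> \<alpha>\<close> is the path \<open>\<beta>\<alpha>\<close>, first \<open>\<alpha>\<close> and then \<open>\<beta>\<close>; it is used only if \<open>composable Q \<beta> \<alpha>\<close>.\<close>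

definition composable :: "('v, 'a) pre_digraph \<Rightarrow> ('v, 'a) path \<Rightarrow> ('v, 'a) path \<Rightarrow> bool" where
  "composable Q \<beta> \<alpha> \<longleftrightarrow> psrc \<beta> = ptgt Q \<alpha>"

definition pcomp :: "('v, 'a) path \<Rightarrow> ('v, 'a) path \<Rightarrow> ('v, 'a) path" where
  "pcomp \<beta> \<alpha> = (psrc \<alpha>, snd \<alpha> @ snd \<beta>)"

definition subpath :: "('v, 'a) pre_digraph \<Rightarrow> ('v, 'a) path \<Rightarrow> ('v, 'a) path \<Rightarrow> bool" where
  "subpath Q \<alpha> \<beta> \<longleftrightarrow> (\<exists>\<gamma>\<in>paths Q. \<exists>\<delta>\<in>paths Q.
     composable Q \<gamma> \<alpha> \<and> composable Q \<alpha> \<delta> \<and> \<beta> = pcomp \<gamma> (pcomp \<alpha> \<delta>))"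

text \<open>
  The undirected graph underlying a quiver, with both orientations of every arrow. An undirected
  cycle is a cycle of it which does not use an arrow twice. (The notions \<open>forest\<close> and
  \<open>spanning_tree\<close> of \<open>Graph_Theory\<close> only exclude directed cycles.)
\<close>

definition double_quiver :: "('v, 'a) pre_digraph \<Rightarrow> ('v, 'a \<times> bool) pre_digraph" where
  "double_quiver H = \<lparr>verts = verts H, arcs = arcs H \<times> UNIV,
     tail = (\<lambda>(a, forward). if forward then tail H a else head H a),
     head = (\<lambda>(a, forward). if forward then head H a else tail H a)\<rparr>"

definition undirected_acyclic :: "('v, 'a) pre_digraph \<Rightarrow> bool" where
  "undirected_acyclic H \<longleftrightarrow>
     \<not> (\<exists>p. pre_digraph.cycle (double_quiver H) p \<and> distinct (map fst p))"

definition quiver_spanning_tree :: "('v, 'a) pre_digraph \<Rightarrow> 'a set \<Rightarrow> bool" where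
  "quiver_spanning_tree Q T \<longleftrightarrow> (\<exists>H. spanning H Q \<and> Digraph_Component.connected H \<and>
     undirected_acyclic H \<and> T = arcs H)"

section \<open>Gentle presentations\<close>

definition path_algebra :: "('v, 'a) pre_digraph \<Rightarrow> (('v, 'a) path \<Rightarrow>\<^sub>0 'k::field) ring" where
  "path_algebra Q = \<lparr>carrier = kspace (paths Q),
     mult = bilinear_ext (\<lambda>\<beta> \<alpha>. if composable Q \<beta> \<alpha> then basis (pcomp \<beta> \<alpha>) else 0),
     one = (\<Sum>v\<in>verts Q. basis (vertex_path v)), zero = 0, add = (+)\<rparr>"

text \<open>The element \<open>ba\<close> of the path algebra, for arrows \<open>a\<close> and \<open>b\<close> with \<open>t(a) = s(b)\<close>.\<close>

definition arrow_prod :: "('v, 'a) pre_digraph \<Rightarrow> 'a \<Rightarrow> 'a \<Rightarrow> (('v, 'a) path \<Rightarrow>\<^sub>0 'k::field)" where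
  "arrow_prod Q b a = basis (pcomp (arrow_path Q b) (arrow_path Q a))"

definition gentle_presentation ::
  "('v, 'a) pre_digraph \<Rightarrow> (('v, 'a) path \<Rightarrow>\<^sub>0 'k::field) set \<Rightarrow> bool" where
  "gentle_presentation Q I \<longleftrightarrow> fin_digraph Q \<and>
     (\<exists>S \<subseteq> {\<pi> \<in> paths Q. plen \<pi> = 2}. I = Idl\<^bsub>path_algebra Q\<^esub> (basis ` S)) \<and>
     (\<forall>v\<in>verts Q. card {a \<in> arcs Q. tail Q a = v} \<le> 2 \<and> card {a \<in> arcs Q. head Q a = v} \<le> 2) \<and>
     (\<forall>a\<in>arcs Q.
        (\<exists>\<^sub>\<le>\<^sub>1 b. b \<in> arcs Q \<and> head Q b = tail Q a \<and> arrow_prod Q a b \<notin> I) \<and>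
        (\<exists>\<^sub>\<le>\<^sub>1 c. c \<in> arcs Q \<and> head Q a = tail Q c \<and> arrow_prod Q c a \<notin> I) \<and>
        (\<exists>\<^sub>\<le>\<^sub>1 b. b \<in> arcs Q \<and> head Q b = tail Q a \<and> arrow_prod Q a b \<in> I) \<and>
        (\<exists>\<^sub>\<le>\<^sub>1 c. c \<in> arcs Q \<and> head Q a = tail Q c \<and> arrow_prod Q c a \<in> I))"

definition quadratic_relations ::
  "('v, 'a) pre_digraph \<Rightarrow> (('v, 'a) path \<Rightarrow>\<^sub>0 'k::field) set \<Rightarrow> ('v, 'a) path set" where
  "quadratic_relations Q I = {\<pi> \<in> paths Q. plen \<pi> = 2 \<and> basis \<pi> \<in> I}"

definition B_paths ::
  "('v, 'a) pre_digraph \<Rightarrow> (('v, 'a) path \<Rightarrow>\<^sub>0 'k::field) set \<Rightarrow> ('v, 'a) path set" where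
  "B_paths Q I = {\<alpha> \<in> paths Q. \<not> (\<exists>\<rho> \<in> quadratic_relations Q I. subpath Q \<rho> \<alpha>)}"

definition Gamma_paths ::
  "('v, 'a) pre_digraph \<Rightarrow> (('v, 'a) path \<Rightarrow>\<^sub>0 'k::field) set \<Rightarrow> ('v, 'a) path set" where
  "Gamma_paths Q I = {\<gamma> \<in> paths Q. \<forall>\<rho> \<in> paths Q.
     plen \<rho> = 2 \<and> subpath Q \<rho> \<gamma> \<longrightarrow> \<rho> \<in> quadratic_relations Q I}"

definition maximal_path ::
  "('v, 'a) pre_digraph \<Rightarrow> ('v, 'a) path set \<Rightarrow> ('v, 'a) path \<Rightarrow> bool" where
  "maximal_path Q X \<pi> \<longleftrightarrow> \<pi> \<in> X \<and> \<not> (\<exists>\<pi>' \<in> X. \<pi>' \<noteq> \<pi> \<and> subpath Q \<pi> \<pi>')"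

section \<open>Hochschild cohomology\<close>

definition parallel ::
  "('v, 'a) pre_digraph \<Rightarrow> ('v, 'a) path set \<Rightarrow> ('v, 'a) path set \<Rightarrow>
     (('v, 'a) path \<times> ('v, 'a) path) set" where
  "parallel Q X Y = {(\<gamma>, \<alpha>) \<in> X \<times> Y. psrc \<gamma> = psrc \<alpha> \<and> ptgt Q \<gamma> = ptgt Q \<alpha>}"

definition Gamma_B ::
  "('v, 'a) pre_digraph \<Rightarrow> (('v, 'a) path \<Rightarrow>\<^sub>0 'k::field) set \<Rightarrow>
     (('v, 'a) path \<times> ('v, 'a) path) set" where
  "Gamma_B Q I = parallel Q (Gamma_paths Q I) (B_paths Q I)"

definition Gamma_B_deg ::
  "('v, 'a) pre_digraph \<Rightarrow> (('v, 'a) path \<Rightarrow>\<^sub>0 'k::field) set \<Rightarrow> nat \<Rightarrow>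
     (('v, 'a) path \<times> ('v, 'a) path) set" where
  "Gamma_B_deg Q I m = parallel Q {\<gamma> \<in> Gamma_paths Q I. plen \<gamma> = m} (B_paths Q I)"

type_synonym ('v, 'a, 'k) cochain = "('v, 'a) path \<times> ('v, 'a) path \<Rightarrow>\<^sub>0 'k"

text \<open>
  The cochain complex computing \<open>HH\<^sup>*(A)\<close>, for \<open>A = kQ/I\<close>, obtained from the Bardzell resolution of
  \<open>A\<close>. We work with the direct sum of all its components, so that the differential is one linear map
  on \<open>kspace (Gamma_B Q I)\<close>.
\<close>

definition bardzell_d_basis ::
  "('v, 'a) pre_digraph \<Rightarrow> (('v, 'a) path \<Rightarrow>\<^sub>0 'k::field) set \<Rightarrow>
     ('v, 'a) path \<times> ('v, 'a) path \<Rightarrow> ('v, 'a, 'k) cochain" where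
  "bardzell_d_basis Q I = (\<lambda>(\<gamma>, \<alpha>).
     (\<Sum>b | b \<in> arcs Q \<and> composable Q (arrow_path Q b) \<gamma> \<and>
            (pcomp (arrow_path Q b) \<gamma>, pcomp (arrow_path Q b) \<alpha>) \<in> Gamma_B_deg Q I (Suc (plen \<gamma>)).
        basis (pcomp (arrow_path Q b) \<gamma>, pcomp (arrow_path Q b) \<alpha>))
     - scale ((- 1) ^ plen \<gamma>)
        (\<Sum>a | a \<in> arcs Q \<and> composable Q \<gamma> (arrow_path Q a) \<and>
            (pcomp \<gamma> (arrow_path Q a), pcomp \<alpha> (arrow_path Q a)) \<in> Gamma_B_deg Q I (Suc (plen \<gamma>)).
          basis (pcomp \<gamma> (arrow_path Q a), pcomp \<alpha> (arrow_path Q a))))"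

definition bardzell_d ::
  "('v, 'a) pre_digraph \<Rightarrow> (('v, 'a) path \<Rightarrow>\<^sub>0 'k::field) set \<Rightarrow>
     ('v, 'a, 'k) cochain \<Rightarrow> ('v, 'a, 'k) cochain" where
  "bardzell_d Q I = linear_ext (bardzell_d_basis Q I)"

definition cup_basis ::
  "('v, 'a) pre_digraph \<Rightarrow> (('v, 'a) path \<Rightarrow>\<^sub>0 'k::field) set \<Rightarrow>
     ('v, 'a) path \<times> ('v, 'a) path \<Rightarrow> ('v, 'a) path \<times> ('v, 'a) path \<Rightarrow> ('v, 'a, 'k) cochain" where
  "cup_basis Q I = (\<lambda>(\<gamma>, \<alpha>) (\<gamma>', \<alpha>').
     if composable Q \<gamma> \<gamma>' \<and> composable Q \<alpha> \<alpha>' \<and>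
        pcomp \<gamma> \<gamma>' \<in> Gamma_paths Q I \<and> pcomp \<alpha> \<alpha>' \<in> B_paths Q I
     then basis (pcomp \<gamma> \<gamma>', pcomp \<alpha> \<alpha>') else 0)"

definition cocycle_ring ::
  "('v, 'a) pre_digraph \<Rightarrow> (('v, 'a) path \<Rightarrow>\<^sub>0 'k::field) set \<Rightarrow> ('v, 'a, 'k) cochain ring" where
  "cocycle_ring Q I = \<lparr>carrier = {f \<in> kspace (Gamma_B Q I). bardzell_d Q I f = 0},
     mult = bilinear_ext (cup_basis Q I),
     one = (\<Sum>v\<in>verts Q. basis (vertex_path v, vertex_path v)), zero = 0, add = (+)\<rparr>"

definition coboundaries ::
  "('v, 'a) pre_digraph \<Rightarrow> (('v, 'a) path \<Rightarrow>\<^sub>0 'k::field) set \<Rightarrow> ('v, 'a, 'k) cochain set" where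
  "coboundaries Q I = bardzell_d Q I ` kspace (Gamma_B Q I)"

text \<open>The algebra \<open>HH\<^sup>*(A)\<close> with the cup product: cocycles modulo coboundaries.\<close>

definition HH ::
  "('v, 'a) pre_digraph \<Rightarrow> (('v, 'a) path \<Rightarrow>\<^sub>0 'k::field) set \<Rightarrow> ('v, 'a, 'k) cochain set ring" where
  "HH Q I = cocycle_ring Q I Quot coboundaries Q I"

definition cohomology_class ::
  "('v, 'a) pre_digraph \<Rightarrow> (('v, 'a) path \<Rightarrow>\<^sub>0 'k::field) set \<Rightarrow>
     ('v, 'a, 'k) cochain \<Rightarrow> ('v, 'a, 'k) cochain set" where
  "cohomology_class Q I f = coboundaries Q I +>\<^bsub>cocycle_ring Q I\<^esub> f"

definition HH_deg ::
  "('v, 'a) pre_digraph \<Rightarrow> (('v, 'a) path \<Rightarrow>\<^sub>0 'k::field) set \<Rightarrow> nat \<Rightarrow>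
     ('v, 'a, 'k) cochain set set" where
  "HH_deg Q I m =
     cohomology_class Q I ` (carrier (cocycle_ring Q I) \<inter> kspace (Gamma_B_deg Q I m))"

definition HH_scalar ::
  "('v, 'a) pre_digraph \<Rightarrow> (('v, 'a) path \<Rightarrow>\<^sub>0 'k::field) set \<Rightarrow> 'k \<Rightarrow>
     ('v, 'a, 'k) cochain set" where
  "HH_scalar Q I c = cohomology_class Q I (scale c \<one>\<^bsub>cocycle_ring Q I\<^esub>)"

section \<open>Cycles and circuits\<close>

definition is_cycle :: "('v, 'a) pre_digraph \<Rightarrow> ('v, 'a) path \<Rightarrow> bool" where
  "is_cycle Q C \<longleftrightarrow> C \<in> paths Q \<and> plen C > 0 \<and> psrc C = ptgt Q C"

definition ppower :: "('v, 'a) path \<Rightarrow> nat \<Rightarrow> ('v, 'a) path" where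
  "ppower C n = (psrc C, concat (replicate n (snd C)))"

text \<open>\<open>rot (c\<^sub>m \<cdots> c\<^sub>1) = c\<^sub>m\<^sub>-\<^sub>1 \<cdots> c\<^sub>1 c\<^sub>m\<close>: the last arrow traversed becomes the first one.\<close>

definition rot :: "('v, 'a) pre_digraph \<Rightarrow> ('v, 'a) path \<Rightarrow> ('v, 'a) path" where
  "rot Q C = (tail Q (last (snd C)), last (snd C) # butlast (snd C))"

definition period :: "('v, 'a) pre_digraph \<Rightarrow> ('v, 'a) path \<Rightarrow> nat" where
  "period Q C = (LEAST i. i \<ge> 1 \<and> (rot Q ^^ i) C = C)"

definition primitive_cycle :: "('v, 'a) pre_digraph \<Rightarrow> ('v, 'a) path \<Rightarrow> bool" where
  "primitive_cycle Q C \<longleftrightarrow> is_cycle Q C \<and> \<not> (\<exists>D n. is_cycle Q D \<and> n \<ge> 2 \<and> C = ppower D n)"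

definition complete_cycle ::
  "('v, 'a) pre_digraph \<Rightarrow> (('v, 'a) path \<Rightarrow>\<^sub>0 'k::field) set \<Rightarrow> ('v, 'a) path \<Rightarrow> bool" where
  "complete_cycle Q I C \<longleftrightarrow> is_cycle Q C \<and> ppower C 2 \<in> Gamma_paths Q I"

definition cocomplete_cycle ::
  "('v, 'a) pre_digraph \<Rightarrow> (('v, 'a) path \<Rightarrow>\<^sub>0 'k::field) set \<Rightarrow> ('v, 'a) path \<Rightarrow> bool" where
  "cocomplete_cycle Q I C \<longleftrightarrow> is_cycle Q C \<and> ppower C 2 \<in> B_paths Q I"

text \<open>\<open>S\<close> contains exactly one element of each rotation class of elements of \<open>X\<close>.\<close>

definition circuit_representatives ::
  "('v, 'a) pre_digraph \<Rightarrow> ('v, 'a) path set \<Rightarrow> ('v, 'a) path set \<Rightarrow> bool" where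
  "circuit_representatives Q X S \<longleftrightarrow>
     S \<subseteq> X \<and> (\<forall>C\<in>X. \<exists>!D. D \<in> S \<and> (\<exists>i. (rot Q ^^ i) C = D))"

text \<open>
  The set obtained from representatives \<open>D\<close> of the primitive complete circuits, where \<open>p\<close> is the
  characteristic of the field.
\<close>

definition basic_complete :: "nat \<Rightarrow> ('v, 'a) path set \<Rightarrow> ('v, 'a) path set" where
  "basic_complete p D = (if p = 2 then D
     else {C \<in> D. even (plen C)} \<union> {ppower C 2 | C. C \<in> D \<and> odd (plen C)})"

definition B_sum :: "('v, 'a) pre_digraph \<Rightarrow> ('v, 'a) path \<Rightarrow> ('v, 'a, 'k::field) cochain" where
  "B_sum Q \<alpha> = (\<Sum>i<period Q \<alpha>. basis (vertex_path (psrc ((rot Q ^^ i) \<alpha>)), (rot Q ^^ i) \<alpha>))"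

definition Gamma_sum :: "('v, 'a) pre_digraph \<Rightarrow> ('v, 'a) path \<Rightarrow> ('v, 'a, 'k::field) cochain" where
  "Gamma_sum Q C = (\<Sum>i<period Q C. basis ((rot Q ^^ i) C, vertex_path (psrc ((rot Q ^^ i) C))))"

section \<open>Generators\<close>

definition share_first_arrow :: "('v, 'a) path \<Rightarrow> ('v, 'a) path \<Rightarrow> bool" where
  "share_first_arrow \<gamma> \<alpha> \<longleftrightarrow> snd \<gamma> \<noteq> [] \<and> snd \<alpha> \<noteq> [] \<and> hd (snd \<gamma>) = hd (snd \<alpha>)"

definition share_last_arrow :: "('v, 'a) path \<Rightarrow> ('v, 'a) path \<Rightarrow> bool" where
  "share_last_arrow \<gamma> \<alpha> \<longleftrightarrow> snd \<gamma> \<noteq> [] \<and> snd \<alpha> \<noteq> [] \<and> last (snd \<gamma>) = last (snd \<alpha>)"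

definition arrow_class ::
  "('v, 'a) pre_digraph \<Rightarrow> (('v, 'a) path \<Rightarrow>\<^sub>0 'k::field) set \<Rightarrow> 'a \<Rightarrow> ('v, 'a, 'k) cochain set" where
  "arrow_class Q I c = cohomology_class Q I (basis (arrow_path Q c, arrow_path Q c))"

definition B_class ::
  "('v, 'a) pre_digraph \<Rightarrow> (('v, 'a) path \<Rightarrow>\<^sub>0 'k::field) set \<Rightarrow> ('v, 'a) path \<Rightarrow>
     ('v, 'a, 'k) cochain set" where
  "B_class Q I \<alpha> = cohomology_class Q I (B_sum Q \<alpha>)"

definition Gamma_class ::
  "('v, 'a) pre_digraph \<Rightarrow> (('v, 'a) path \<Rightarrow>\<^sub>0 'k::field) set \<Rightarrow> ('v, 'a) path \<Rightarrow>
     ('v, 'a, 'k) cochain set" where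
  "Gamma_class Q I C = cohomology_class Q I (Gamma_sum Q C)"

text \<open>
  In what follows \<open>T\<close> is a spanning tree, and \<open>CB\<close> and \<open>CG\<close> are the sets of basic cocomplete cycles
  and of basic complete cycles.
\<close>

definition HH_generators ::
  "('v, 'a) pre_digraph \<Rightarrow> (('v, 'a) path \<Rightarrow>\<^sub>0 'k::field) set \<Rightarrow> 'a set \<Rightarrow>
     ('v, 'a) path set \<Rightarrow> ('v, 'a) path set \<Rightarrow> ('v, 'a, 'k) cochain set set" where
  "HH_generators Q I T CB CG =
     {cohomology_class Q I (basis (vertex_path (psrc \<alpha>), \<alpha>)) | \<alpha>.
        is_cycle Q \<alpha> \<and> maximal_path Q (B_paths Q I) \<alpha>} \<union>
     B_class Q I ` CB \<union>
     arrow_class Q I ` (arcs Q - T) \<union>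
     {cohomology_class Q I (basis (\<gamma>, \<alpha>)) | \<gamma> \<alpha>.
        (\<gamma>, \<alpha>) \<in> Gamma_B Q I \<and> maximal_path Q (Gamma_paths Q I) \<gamma> \<and>
        \<not> share_first_arrow \<gamma> \<alpha> \<and> \<not> share_last_arrow \<gamma> \<alpha>} \<union>
     Gamma_class Q I ` CG"

section \<open>Free graded-commutative algebras\<close>

definition free_algebra :: "'g set \<Rightarrow> ('g list \<Rightarrow>\<^sub>0 'k::field) ring" where
  "free_algebra G = \<lparr>carrier = kspace (lists G), mult = bilinear_ext (\<lambda>u v. basis (u @ v)),
     one = basis [], zero = 0, add = (+)\<rparr>"

text \<open>
  The free graded-commutative algebra on a set \<open>G\<close> of generators, those in \<open>H m\<close> having degree \<open>m\<close>,
  is the free associative algebra modulo the graded commutators \<open>uv - (-1)\<^sup>m\<^sup>n vu\<close>. For \<open>u = v\<close> of odd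
  degree this is \<open>2u\<^sup>2\<close>, so that \<open>u\<^sup>2\<close> vanishes if the characteristic is not \<open>2\<close>; in characteristic
  \<open>2\<close> the result is the polynomial algebra.
\<close>

definition graded_commutators :: "(nat \<Rightarrow> 'g set) \<Rightarrow> 'g set \<Rightarrow> ('g list \<Rightarrow>\<^sub>0 'k::field) set" where
  "graded_commutators H G = {basis [u, v] - scale ((- 1) ^ (m * n)) (basis [v, u]) | u v m n.
     u \<in> G \<inter> H m \<and> v \<in> G \<inter> H n}"

definition commutator_ideal :: "(nat \<Rightarrow> 'g set) \<Rightarrow> 'g set \<Rightarrow> ('g list \<Rightarrow>\<^sub>0 'k::field) set" where
  "commutator_ideal H G = Idl\<^bsub>free_algebra G\<^esub> (graded_commutators H G)"

definition free_gca :: "(nat \<Rightarrow> 'g set) \<Rightarrow> 'g set \<Rightarrow> ('g list \<Rightarrow>\<^sub>0 'k::field) set ring" where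
  "free_gca H G = free_algebra G Quot commutator_ideal H G"

definition gca_gen :: "(nat \<Rightarrow> 'g set) \<Rightarrow> 'g set \<Rightarrow> 'g \<Rightarrow> ('g list \<Rightarrow>\<^sub>0 'k::field) set" where
  "gca_gen H G g = commutator_ideal H G +>\<^bsub>free_algebra G\<^esub> basis [g]"

definition gca_scalar :: "(nat \<Rightarrow> 'g set) \<Rightarrow> 'g set \<Rightarrow> 'k::field \<Rightarrow> ('g list \<Rightarrow>\<^sub>0 'k) set" where
  "gca_scalar H G c = commutator_ideal H G +>\<^bsub>free_algebra G\<^esub> scale c (basis [])"

section \<open>Relations\<close>

definition exceptional_pair ::
  "('v, 'a) pre_digraph \<Rightarrow> (('v, 'a) path \<Rightarrow>\<^sub>0 'k::field) set \<Rightarrow> 'a set \<Rightarrow>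
     ('v, 'a) path set \<Rightarrow> ('v, 'a) path set \<Rightarrow>
     ('v, 'a, 'k) cochain set \<Rightarrow> ('v, 'a, 'k) cochain set \<Rightarrow> bool" where
  "exceptional_pair Q I T CB CG u v \<longleftrightarrow>
     (\<exists>C\<in>CG. u = Gamma_class Q I C \<and> v = Gamma_class Q I C) \<or>
     (\<exists>\<alpha>\<in>CB. u = B_class Q I \<alpha> \<and> v = B_class Q I \<alpha>) \<or>
     (\<exists>C\<in>CG. \<exists>c\<in>arcs Q - T. c \<in> set (snd C) \<and>
        {u, v} = {Gamma_class Q I C, arrow_class Q I c}) \<or>
     (\<exists>\<alpha>\<in>CB. \<exists>c\<in>arcs Q - T. c \<in> set (snd \<alpha>) \<and>
        {u, v} = {B_class Q I \<alpha>, arrow_class Q I c})"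

text \<open>
  The following are elements of the algebra \<open>F\<close>, which is meant to be the free graded-commutative
  algebra on the set \<open>G\<close> of generators, and \<open>\<iota>\<close> is the inclusion of \<open>G\<close> in it.
\<close>

definition HH_relations ::
  "('v, 'a) pre_digraph \<Rightarrow> (('v, 'a) path \<Rightarrow>\<^sub>0 'k::field) set \<Rightarrow> 'a set \<Rightarrow>
     ('v, 'a) path set \<Rightarrow> ('v, 'a) path set \<Rightarrow>
     'f ring \<Rightarrow> (('v, 'a, 'k) cochain set \<Rightarrow> 'f) \<Rightarrow> 'f set" where
  "HH_relations Q I T CB CG F \<iota> =
     {\<iota> u \<otimes>\<^bsub>F\<^esub> \<iota> v | u v. u \<in> HH_generators Q I T CB CG \<and> v \<in> HH_generators Q I T CB CG \<and>
        \<not> exceptional_pair Q I T CB CG u v} \<union>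
     {\<iota> (arrow_class Q I c) \<otimes>\<^bsub>F\<^esub> \<iota> (Gamma_class Q I C)
        \<ominus>\<^bsub>F\<^esub> \<iota> (arrow_class Q I d) \<otimes>\<^bsub>F\<^esub> \<iota> (Gamma_class Q I C) | c d C.
        c \<in> arcs Q - T \<and> d \<in> arcs Q - T \<and> c \<noteq> d \<and> C \<in> CG \<and> {c, d} \<subseteq> set (snd C)} \<union>
     {\<iota> (arrow_class Q I c) \<otimes>\<^bsub>F\<^esub> \<iota> (B_class Q I \<alpha>)
        \<ominus>\<^bsub>F\<^esub> \<iota> (arrow_class Q I d) \<otimes>\<^bsub>F\<^esub> \<iota> (B_class Q I \<alpha>) | c d \<alpha>.
        c \<in> arcs Q - T \<and> d \<in> arcs Q - T \<and> c \<noteq> d \<and> \<alpha> \<in> CB \<and> {c, d} \<subseteq> set (snd \<alpha>)}"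

section \<open>One-loop quivers\<close>

definition one_loop_quiver :: "('v, 'a) pre_digraph \<Rightarrow> 'a \<Rightarrow> bool" where
  "one_loop_quiver Q a \<longleftrightarrow> arcs Q = {a} \<and> (\<exists>v. verts Q = {v})"

text \<open>
  If \<open>Q\<close> is the quiver with one vertex \<open>e\<close> and one loop \<open>x\<close>, and \<open>x\<^sup>2\<close> is not in \<open>I\<close>, then \<open>A\<close> is the
  polynomial algebra \<open>k[x]\<close>, the generators are the classes of \<open>(e, x)\<close>, \<open>(x, x)\<close> and \<open>(x, e)\<close>, and
  \<open>(x, e) \<smile> (e, x) = (x, x)\<close> is not zero in cohomology although the pair \<open>(x, e)\<close>, \<open>(e, x)\<close> is not
  an exceptional one. That case therefore has to be excluded explicitly.
\<close>

definition polynomial_case ::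
  "('v, 'a) pre_digraph \<Rightarrow> (('v, 'a) path \<Rightarrow>\<^sub>0 'k::field) set \<Rightarrow> bool" where
  "polynomial_case Q I \<longleftrightarrow> (\<exists>x. one_loop_quiver Q x \<and> arrow_prod Q x x \<notin> I)"

end

theory Submission imports Defs begin

text \<open>
  The Bardzell differential is the graded commutator with \<open>\<Sum>(b, b)\<close>, so the cochains form a differential
  graded algebra. On basis pairs its two halves prolong a pair at the left or at the right end by an
  arrow, and away from a few special pairs they link the pairs into squares, edges and isolated points;
  squares and edges cancel. The special pairs contribute the graph complex of the quiver, whose first
  cohomology is spanned by the arrows outside the spanning tree, and one circulant complex for every
  power of a complete or cocomplete circuit, which is acyclic if an odd complete circuit is traversed an
  odd number of times in characteristic other than two and has cohomology of dimension two otherwise.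
  This yields an explicit basis of the cohomology. A word in the generators reduces modulo the relations to a scalar multiple
  of a normal form (the empty word, a generator, a power of a circuit, or such a power times one chosen
  arrow), and the normal forms are mapped bijectively onto that basis.
\<close>

section \<open>Linear and bilinear maps on spaces with a basis\<close>

text \<open>Most products of generators that have to vanish do so already as cochains. Two kinds
  vanish only up to a coboundary, and they shape the argument. A nonzero term of an isolated pair
  times a circuit is, up to sign, the boundary of the pair with a common end arrow removed, unless
  the isolated cycle is a single loop, which is then the whole quiver: here the excluded one-loop
  quivers enter. Circuits of opposite kinds meet in a sum over their common arrows, and each such
  arrow contributes a coboundary. The doubling of odd complete circuits comes from the sign
  \<open>(-1)^m\<close> of one rotation step of a cycle of degree \<open>m\<close>: a full turn of
  an odd cycle changes the sign, so the class dies unless 2 = 0. Every circuit leaves the spanning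
  tree, so there is always a generator \<open>(c, c)\<close> with which to multiply it. Confluence
  of the reduction of words is never checked: independence of the normal forms is inherited from
  that of the cohomology classes they represent.\<close>

definition klinear :: "(('x \<Rightarrow>\<^sub>0 'k::field) \<Rightarrow> ('y \<Rightarrow>\<^sub>0 'k)) \<Rightarrow> bool" where
  "klinear h \<longleftrightarrow> (\<forall>f g. h (f + g) = h f + h g) \<and> (\<forall>c f. h (scale c f) = scale c (h f))"

definition ksubspace :: "('x \<Rightarrow>\<^sub>0 'k::field) set \<Rightarrow> bool" where
  "ksubspace V \<longleftrightarrow> 0 \<in> V \<and> (\<forall>f\<in>V. \<forall>g\<in>V. f + g \<in> V) \<and> (\<forall>c. \<forall>f\<in>V. scale c f \<in> V)"

lemma lookup_scale [simp]: "Poly_Mapping.lookup (scale c f) x = c * Poly_Mapping.lookup f x"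
  unfolding scale_def by transfer (auto simp: when_def)

lemma scale_simps [simp]:
  "scale 0 f = 0" "scale c 0 = 0" "scale 1 f = f" "scale a (scale b f) = scale (a * b) f"
  "scale c (- f) = - scale c f" "scale (- c) f = - scale c f"
  by (auto intro!: poly_mapping_eqI simp: algebra_simps)

lemma scale_distribs:
  "scale c (f + g) = scale c f + scale c g" "scale c (f - g) = scale c f - scale c g"
  "scale (a + b) f = scale a f + scale b f" "scale (a - b) f = scale a f - scale b f"
  by (auto intro!: poly_mapping_eqI simp: lookup_add lookup_minus algebra_simps)

lemma scale_sum: "scale c (sum f S) = (\<Sum>x\<in>S. scale c (f x))"
  by (auto intro!: poly_mapping_eqI simp: lookup_sum sum_distrib_left)

lemma scale_eq_0_iff [simp]: "scale c f = 0 \<longleftrightarrow> c = 0 \<or> f = 0"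
proof
  assume h: "scale c f = 0"
  have "c * Poly_Mapping.lookup f x = 0" for x
    using h by (metis lookup_scale lookup_zero)
  then show "c = 0 \<or> f = 0"
    by (auto intro!: poly_mapping_eqI)
qed auto

lemma keys_scale_subset: "Poly_Mapping.keys (scale c f) \<subseteq> Poly_Mapping.keys f"
  by (auto simp: in_keys_iff)

lemma lookup_basis: "Poly_Mapping.lookup (basis x) y = (if x = y then 1 else 0)"
  by (simp add: basis_def lookup_single when_def)

lemma keys_basis [simp]: "Poly_Mapping.keys (basis x :: 'x \<Rightarrow>\<^sub>0 'k::field) = {x}"
  by (simp add: basis_def)

lemma basis_nonzero [simp]: "basis x \<noteq> (0 :: 'x \<Rightarrow>\<^sub>0 'k::field)"
  by (metis keys_basis keys_zero insert_not_empty)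

lemma basis_eq_iff [simp]: "basis x = (basis y :: 'x \<Rightarrow>\<^sub>0 'k::field) \<longleftrightarrow> x = y"
  by (metis keys_basis singleton_inject)

lemma kspace_lookup: "f \<in> kspace X \<Longrightarrow> x \<notin> X \<Longrightarrow> Poly_Mapping.lookup f x = 0"
  by (auto simp: kspace_def in_keys_iff)

lemma basis_in_kspace [simp]: "basis x \<in> kspace X \<longleftrightarrow> x \<in> X"
  by (simp add: kspace_def)

lemma kspace_mono: "X \<subseteq> Y \<Longrightarrow> f \<in> kspace X \<Longrightarrow> f \<in> kspace Y"
  by (auto simp: kspace_def)

lemma ksubspaceD:
  assumes "ksubspace V"
  shows "0 \<in> V" "f \<in> V \<Longrightarrow> g \<in> V \<Longrightarrow> f + g \<in> V" "f \<in> V \<Longrightarrow> scale c f \<in> V"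
    "f \<in> V \<Longrightarrow> - f \<in> V" "f \<in> V \<Longrightarrow> g \<in> V \<Longrightarrow> f - g \<in> V"
proof -
  show *: "0 \<in> V" "\<And>f g. f \<in> V \<Longrightarrow> g \<in> V \<Longrightarrow> f + g \<in> V" "\<And>c f. f \<in> V \<Longrightarrow> scale c f \<in> V"
    using assms by (auto simp: ksubspace_def)
  have m: "- f \<in> V" if "f \<in> V" for f
    using *(3)[of f "-1"] that by simp
  then show "f \<in> V \<Longrightarrow> - f \<in> V" .
  show "f \<in> V \<Longrightarrow> g \<in> V \<Longrightarrow> f - g \<in> V"
    using *(2)[of f "- g"] m by simp
qed

lemma ksubspace_sum: "ksubspace V \<Longrightarrow> (\<And>i. i \<in> S \<Longrightarrow> f i \<in> V) \<Longrightarrow> sum f S \<in> V"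
  by (induction S rule: infinite_finite_induct) (auto simp: ksubspaceD)

lemma ksubspace_kspace: "ksubspace (kspace X)"
proof -
  have "0 \<in> kspace X" "\<And>c f. f \<in> kspace X \<Longrightarrow> scale c f \<in> kspace X"
    using keys_scale_subset by (force simp: kspace_def)+
  moreover have "f + g \<in> kspace X" if "f \<in> kspace X" "g \<in> kspace X" for f g :: "'a \<Rightarrow>\<^sub>0 'b"
    using that Poly_Mapping.keys_add[of f g] by (auto simp: kspace_def)
  ultimately show ?thesis
    by (auto simp: ksubspace_def)
qed

lemmas kspace_intros = ksubspaceD[OF ksubspace_kspace] ksubspace_sum[OF ksubspace_kspace]

lemma poly_mapping_expand: "f = (\<Sum>x\<in>Poly_Mapping.keys f. scale (Poly_Mapping.lookup f x) (basis x))"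
  by (rule poly_mapping_eqI)
    (simp add: lookup_sum lookup_basis in_keys_iff if_distrib[of "(*) _"] cong: if_cong)

lemma klinearD:
  assumes "klinear h"
  shows "h (f + g) = h f + h g" "h (scale c f) = scale c (h f)" "h 0 = 0" "h (- f) = - h f"
    "h (f - g) = h f - h g" "h (sum F S) = (\<Sum>i\<in>S. h (F i))"
proof -
  show a: "\<And>f g. h (f + g) = h f + h g" and s: "\<And>c f. h (scale c f) = scale c (h f)"
    using assms by (auto simp: klinear_def)
  show z: "h 0 = 0" using s[of 0 0] by simp
  show m: "h (- f) = - h f" for f using s[of "-1" f] by simp
  show "h (f - g) = h f - h g" using a[of f "- g"] m by simp
  show "h (sum F S) = (\<Sum>i\<in>S. h (F i))"
    by (induction S rule: infinite_finite_induct) (auto simp: z a)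
qed

lemma klinear_expand:
  assumes "klinear h" shows "h f = linear_ext (\<lambda>x. h (basis x)) f"
  by (subst poly_mapping_expand[of f]) (simp add: klinearD[OF assms] linear_ext_def)

lemma linear_ext_superset:
  assumes "finite S" "Poly_Mapping.keys f \<subseteq> S"
  shows "linear_ext b f = (\<Sum>x\<in>S. scale (Poly_Mapping.lookup f x) (b x))"
  unfolding linear_ext_def
  by (rule sum.mono_neutral_left) (use assms in \<open>auto simp: in_keys_iff\<close>)

lemma klinear_linear_ext [simp]: "klinear (linear_ext b)"
proof -
  have "linear_ext b (f + g) = linear_ext b f + linear_ext b g" for f g
  proof -
    define S where "S = Poly_Mapping.keys f \<union> Poly_Mapping.keys g"
    have "finite S" "Poly_Mapping.keys (f + g) \<subseteq> S" "Poly_Mapping.keys f \<subseteq> S" "Poly_Mapping.keys g \<subseteq> S"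
      using Poly_Mapping.keys_add[of f g] by (auto simp: S_def)
    then show ?thesis
      by (simp add: linear_ext_superset[of S] lookup_add scale_distribs sum.distrib)
  qed
  moreover have "linear_ext b (scale c f) = scale c (linear_ext b f)" for c f
    using keys_scale_subset[of c f]
    by (simp add: linear_ext_superset[of "Poly_Mapping.keys f"] scale_sum)
  ultimately show ?thesis by (simp add: klinear_def)
qed

lemma linear_ext_basis [simp]: "linear_ext b (basis x) = b x"
  by (simp add: linear_ext_def lookup_basis)

lemma lookup_linear_ext:
  "Poly_Mapping.lookup (linear_ext b f) y
   = (\<Sum>x\<in>Poly_Mapping.keys f. Poly_Mapping.lookup f x * Poly_Mapping.lookup (b x) y)"
  by (simp add: linear_ext_def lookup_sum)

lemma linear_ext_cong:
  "f \<in> kspace X \<Longrightarrow> (\<And>x. x \<in> X \<Longrightarrow> b x = b' x) \<Longrightarrow> linear_ext b f = linear_ext b' f"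
  unfolding linear_ext_def by (rule sum.cong) (auto simp: kspace_def)

lemma klinear_eqI:
  assumes "klinear h" "klinear h'" "f \<in> kspace X" "\<And>x. x \<in> X \<Longrightarrow> h (basis x) = h' (basis x)"
  shows "h f = h' f"
  using klinear_expand[OF assms(1), of f] klinear_expand[OF assms(2), of f]
    linear_ext_cong[OF assms(3), OF assms(4)] by simp

lemma klinear_memI:
  assumes "klinear h" "ksubspace V" "f \<in> kspace X" "\<And>x. x \<in> X \<Longrightarrow> h (basis x) \<in> V"
  shows "h f \<in> V"
  by (subst klinear_expand[OF assms(1)], unfold linear_ext_def, rule ksubspace_sum[OF assms(2)])
    (use assms(3,4) in \<open>auto simp: kspace_def intro!: ksubspaceD(3)[OF assms(2)]\<close>)

lemma klinear_id: "klinear (\<lambda>f. f)"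
  by (simp add: klinear_def)

lemma klinear_comp: "klinear h \<Longrightarrow> klinear h' \<Longrightarrow> klinear (\<lambda>f. h (h' f))"
  by (simp add: klinear_def)

lemma klinear_add: "klinear h \<Longrightarrow> klinear h' \<Longrightarrow> klinear (\<lambda>f. h f + h' f)"
  by (simp add: klinear_def scale_distribs)

lemma klinear_diff: "klinear h \<Longrightarrow> klinear h' \<Longrightarrow> klinear (\<lambda>f. h f - h' f)"
  by (simp add: klinear_def scale_distribs)

lemma ksubspace_image:
  assumes h: "klinear h" and V: "ksubspace V"
  shows "ksubspace (h ` V)"
  unfolding ksubspace_def
proof (intro conjI ballI allI)
  show "0 \<in> h ` V"
    using klinearD(3)[OF h] ksubspaceD(1)[OF V] by (metis imageI)
  show "f + g \<in> h ` V" if "f \<in> h ` V" "g \<in> h ` V" for f g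
    using that by (auto simp: klinearD(1)[OF h, symmetric] intro!: imageI ksubspaceD(2)[OF V])
  show "scale c f \<in> h ` V" if "f \<in> h ` V" for c f
    using that by (auto simp: klinearD(2)[OF h, symmetric] intro!: imageI ksubspaceD(3)[OF V])
qed

text \<open>With \<open>r\<close> listing candidate normal forms and \<open>V\<close> what is
  factored out, this set consists of the elements that reduce to normal forms. It serves twice: for
  cocycles modulo coboundaries and for words modulo relations.\<close>

lemma ksubspace_mod_span:
  assumes V: "ksubspace V"
  shows "ksubspace {f. \<exists>l\<in>kspace Y. f - linear_ext r l \<in> V}"
  unfolding ksubspace_def
proof (intro conjI ballI allI)
  note lin = klinearD[OF klinear_linear_ext[of r]]
  let ?W = "{f. \<exists>l\<in>kspace Y. f - linear_ext r l \<in> V}"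
  show "0 \<in> ?W"
    using ksubspaceD(1)[OF V] kspace_intros(1) by (auto simp: lin intro!: bexI[of _ 0])
  fix f g c assume f: "f \<in> ?W"
  then obtain l where l: "l \<in> kspace Y" "f - linear_ext r l \<in> V" by auto
  show "scale c f \<in> ?W"
    using l ksubspaceD(3)[OF V l(2), of c] kspace_intros(3)[OF l(1)]
    by (auto simp: lin scale_distribs intro!: bexI[of _ "scale c l"])
  assume "g \<in> ?W"
  then obtain l' where l': "l' \<in> kspace Y" "g - linear_ext r l' \<in> V" by auto
  show "f + g \<in> ?W"
    using ksubspaceD(2)[OF V l(2) l'(2)] kspace_intros(2)[OF l(1) l'(1)]
    by (auto simp: lin algebra_simps intro!: bexI[of _ "l + l'"])
qed

lemma ksubspace_kernel: "klinear h \<Longrightarrow> ksubspace V \<Longrightarrow> ksubspace {f \<in> V. h f = 0}"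
  by (auto simp: ksubspace_def klinearD)

lemma klinear_bilinear_left: "klinear (\<lambda>f. bilinear_ext m f g)"
  by (simp add: bilinear_ext_def)

lemma klinear_bilinear_right: "klinear (\<lambda>g. bilinear_ext m f g)"
  unfolding bilinear_ext_def linear_ext_def[of _ f]
  by (auto simp: klinear_def klinearD[OF klinear_linear_ext] scale_distribs sum.distrib scale_sum mult.commute)

lemma bilinear_ext_basis [simp]: "bilinear_ext m (basis x) (basis y) = m x y"
  by (simp add: bilinear_ext_def)

lemmas bilinear_simps = klinearD[OF klinear_bilinear_left] klinearD[OF klinear_bilinear_right]

lemma bilinear_closed:
  assumes "f \<in> kspace X" "g \<in> kspace Y" "ksubspace V" "\<And>x y. x \<in> X \<Longrightarrow> y \<in> Y \<Longrightarrow> m x y \<in> V"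
  shows "bilinear_ext m f g \<in> V"
  by (rule klinear_memI[OF klinear_bilinear_left assms(3) assms(1)],
      rule klinear_memI[OF klinear_bilinear_right assms(3) assms(2)]) (simp add: assms(4))

lemma bilinear_assoc:
  assumes "f \<in> kspace X" "g \<in> kspace X" "h \<in> kspace X"
    and "\<And>x y z. x \<in> X \<Longrightarrow> y \<in> X \<Longrightarrow> z \<in> X \<Longrightarrow>
           bilinear_ext m (m x y) (basis z) = bilinear_ext m (basis x) (m y z)"
  shows "bilinear_ext m (bilinear_ext m f g) h = bilinear_ext m f (bilinear_ext m g h)"
proof -
  note l = klinear_bilinear_left and r = klinear_bilinear_right
  show ?thesis
  proof (rule klinear_eqI[OF _ _ assms(1)])
    fix x assume x: "x \<in> X"
    show "bilinear_ext m (bilinear_ext m (basis x) g) h = bilinear_ext m (basis x) (bilinear_ext m g h)"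
    proof (rule klinear_eqI[OF _ _ assms(2)])
      fix y assume y: "y \<in> X"
      show "bilinear_ext m (bilinear_ext m (basis x) (basis y)) h
          = bilinear_ext m (basis x) (bilinear_ext m (basis y) h)"
        by (rule klinear_eqI[OF _ _ assms(3)]) (auto simp: assms(4) x y intro: klinear_comp[OF r r] r)
    qed (rule klinear_comp[OF l r] klinear_comp[OF r l])+
  qed (rule klinear_comp[OF l l] l)+
qed

section \<open>Cochains of a gentle presentation\<close>

locale gentle =
  fixes Q :: "('v, 'a) pre_digraph" and I :: "(('v, 'a) path \<Rightarrow>\<^sub>0 'k::field) set"
  assumes gentle: "gentle_presentation Q I"

sublocale gentle \<subseteq> fin_digraph Q
  using gentle by (simp add: gentle_presentation_def)

context gentle
begin

text \<open>
  The definition of a gentle presentation is invariant under exchanging the relations with the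
  remaining composable pairs of arrows, that is \<open>\<Gamma>\<close> with \<open>\<B>\<close>. The Boolean parameter \<open>s\<close> selects one of
  the two: \<^const>\<open>True\<close> stands for \<open>\<Gamma>\<close> and \<^const>\<open>False\<close> for \<open>\<B>\<close>.
\<close>

definition st :: "bool \<Rightarrow> 'a \<Rightarrow> 'a \<Rightarrow> bool" where
  "st s a b \<longleftrightarrow> a \<in> arcs Q \<and> b \<in> arcs Q \<and> head Q a = tail Q b \<and> (arrow_prod Q b a \<in> I) = s"

definition walk :: "bool \<Rightarrow> 'v \<Rightarrow> 'a list \<Rightarrow> 'v \<Rightarrow> bool" where
  "walk s u p v \<longleftrightarrow> awalk u p v \<and> successively (st s) p"

text \<open>The path \<open>p\<close> is put on the side selected by \<open>s\<close> and
  \<open>q\<close> on the other one, so a statement about \<open>pr s u p q\<close> with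
  \<open>p\<close> an \<open>s\<close>-walk covers both sides at once. The source \<open>u\<close>
  is common because the two paths are parallel.\<close>

definition pr :: "bool \<Rightarrow> 'v \<Rightarrow> 'a list \<Rightarrow> 'a list \<Rightarrow> ('v, 'a) path \<times> ('v, 'a) path" where
  "pr s u p q = (if s then ((u, p), (u, q)) else ((u, q), (u, p)))"

abbreviation "X \<equiv> Gamma_B Q I"

lemma st_arcs: "st s a b \<Longrightarrow> a \<in> arcs Q \<and> b \<in> arcs Q \<and> head Q a = tail Q b"
  by (simp add: st_def)

lemma st_cases: "a \<in> arcs Q \<Longrightarrow> b \<in> arcs Q \<Longrightarrow> head Q a = tail Q b \<Longrightarrow> \<not> st s a b \<Longrightarrow> st (\<not> s) a b"
  by (auto simp: st_def)

lemma st_excl: "st s a b \<Longrightarrow> st s' a b \<Longrightarrow> s' = s"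
  by (auto simp: st_def)

lemma st_succ_unique: "st s a b \<Longrightarrow> st s a c \<Longrightarrow> b = c"
  and st_pred_unique: "st s b a \<Longrightarrow> st s c a \<Longrightarrow> b = c"
proof -
  have "\<forall>a\<in>arcs Q.
        (\<exists>\<^sub>\<le>\<^sub>1 b. b \<in> arcs Q \<and> head Q b = tail Q a \<and> arrow_prod Q a b \<notin> I) \<and>
        (\<exists>\<^sub>\<le>\<^sub>1 c. c \<in> arcs Q \<and> head Q a = tail Q c \<and> arrow_prod Q c a \<notin> I) \<and>
        (\<exists>\<^sub>\<le>\<^sub>1 b. b \<in> arcs Q \<and> head Q b = tail Q a \<and> arrow_prod Q a b \<in> I) \<and>
        (\<exists>\<^sub>\<le>\<^sub>1 c. c \<in> arcs Q \<and> head Q a = tail Q c \<and> arrow_prod Q c a \<in> I)"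
    using gentle unfolding gentle_presentation_def by blast
  then have *: "\<And>a b c. a \<in> arcs Q \<Longrightarrow> b \<in> arcs Q \<Longrightarrow> c \<in> arcs Q \<Longrightarrow> head Q b = tail Q a \<Longrightarrow>
      head Q c = tail Q a \<Longrightarrow> (arrow_prod Q a b \<in> I) = (arrow_prod Q a c \<in> I) \<Longrightarrow> b = c"
    and **: "\<And>a b c. a \<in> arcs Q \<Longrightarrow> b \<in> arcs Q \<Longrightarrow> c \<in> arcs Q \<Longrightarrow> head Q a = tail Q b \<Longrightarrow>
      head Q a = tail Q c \<Longrightarrow> (arrow_prod Q b a \<in> I) = (arrow_prod Q c a \<in> I) \<Longrightarrow> b = c"
    unfolding Uniq_def by metis+
  show "st s a b \<Longrightarrow> st s a c \<Longrightarrow> b = c" "st s b a \<Longrightarrow> st s c a \<Longrightarrow> b = c"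
    using *[of a b c] **[of a b c] by (simp_all add: st_def)
qed

lemma walk_Nil [simp]: "walk s u [] v \<longleftrightarrow> u = v \<and> u \<in> verts Q"
  by (simp add: walk_def awalk_Nil_iff)

lemma walk_Cons: "walk s u (a # p) v \<longleftrightarrow>
    a \<in> arcs Q \<and> u = tail Q a \<and> walk s (head Q a) p v \<and> (p \<noteq> [] \<longrightarrow> st s a (hd p))"
  by (cases p) (auto simp: walk_def awalk_Cons_iff)

lemma walk_single [simp]: "walk s u [a] v \<longleftrightarrow> a \<in> arcs Q \<and> u = tail Q a \<and> v = head Q a"
  by (auto simp: walk_Cons)

lemma walk_append: "walk s u (p @ q) v \<longleftrightarrow>
    (\<exists>w. walk s u p w \<and> walk s w q v \<and> (p \<noteq> [] \<longrightarrow> q \<noteq> [] \<longrightarrow> st s (last p) (hd q)))"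
  by (auto simp: walk_def successively_append_iff) 

lemma walk_snoc: "walk s u (p @ [b]) v \<longleftrightarrow>
    b \<in> arcs Q \<and> v = head Q b \<and> walk s u p (tail Q b) \<and> (p \<noteq> [] \<longrightarrow> st s (last p) b)"
  by (auto simp: walk_append)

lemma walk_target_unique: "walk s u p v \<Longrightarrow> walk s' u p v' \<Longrightarrow> v = v'"
  by (induction p arbitrary: u) (auto simp: walk_Cons)

lemma walk_source: "walk s u p v \<Longrightarrow> p \<noteq> [] \<Longrightarrow> u = tail Q (hd p)"
  by (cases p) (auto simp: walk_Cons)

lemma walk_target: "walk s u p v \<Longrightarrow> p \<noteq> [] \<Longrightarrow> v = head Q (last p)"
  by (cases p rule: rev_cases) (auto simp: walk_snoc)

lemma walk_verts: "walk s u p v \<Longrightarrow> u \<in> verts Q \<and> v \<in> verts Q"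
  by (auto simp: walk_def awalk_hd_in_verts awalk_last_in_verts)

lemma walk_arcs: "walk s u p v \<Longrightarrow> set p \<subseteq> arcs Q"
  by (auto simp: walk_def)

lemma walk_awalk: "walk s u p v \<Longrightarrow> awalk u p v"
  by (simp add: walk_def)

lemma paths_iff: "(u, p) \<in> paths Q \<longleftrightarrow> (\<exists>v. awalk u p v)"
  by (simp add: paths_def)

lemma ptgt_awalk: "awalk u p v \<Longrightarrow> ptgt Q (u, p) = v"
  by (auto simp: ptgt_def)

lemma ptgt_walk: "walk s u p v \<Longrightarrow> ptgt Q (u, p) = v"
  by (simp add: ptgt_awalk walk_awalk)

lemma ptgt_cases: "ptgt Q (u, p) = (if p = [] then u else head Q (last p))"
  by (simp add: ptgt_def awalk_verts_conv)

text \<open>A path of length 0 is determined by its vertex, which the lists of arrows do not show;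
  hence the clause on the source of the inner piece.\<close>

lemma subpath_iff:
  assumes "(u, p) \<in> paths Q" "(w, q) \<in> paths Q"
  shows "subpath Q (w, q) (u, p) \<longleftrightarrow> (\<exists>x y. p = x @ q @ y \<and> w = ptgt Q (u, x))"
proof
  assume "subpath Q (w, q) (u, p)"
  then show "\<exists>x y. p = x @ q @ y \<and> w = ptgt Q (u, x)"
    by (auto simp: subpath_def composable_def pcomp_def psrc_def)
next
  assume "\<exists>x y. p = x @ q @ y \<and> w = ptgt Q (u, x)"
  then obtain x y where p: "p = x @ q @ y" "w = ptgt Q (u, x)" by blast
  obtain v where "awalk u p v"
    using assms by (auto simp: paths_iff)
  then obtain w' z where w: "awalk u x w'" "awalk w' q z" "awalk z y v"
    using p(1) by auto
  then show "subpath Q (w, q) (u, p)"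
    unfolding subpath_def
    using p by (intro bexI[of _ "(z, y)"] bexI[of _ "(u, x)"])
      (auto simp: composable_def pcomp_def psrc_def ptgt_awalk paths_iff)
qed

lemma quadratic_relations_iff:
  "(w, r) \<in> quadratic_relations Q I \<longleftrightarrow> (\<exists>a b. r = [a, b] \<and> w = tail Q a \<and> st True a b)"
  by (auto simp: quadratic_relations_def paths_iff plen_def st_def length_Suc_conv awalk_Cons_iff
      awalk_Nil_iff arrow_prod_def pcomp_def arrow_path_def psrc_def numeral_2_eq_2)

lemma successively_iff_infix: "successively P p \<longleftrightarrow> (\<forall>x a b y. p = x @ [a, b] @ y \<longrightarrow> P a b)"
proof
  show "successively P p \<Longrightarrow> \<forall>x a b y. p = x @ [a, b] @ y \<longrightarrow> P a b"
    by (auto simp: successively_append_iff)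
  show "\<forall>x a b y. p = x @ [a, b] @ y \<longrightarrow> P a b \<Longrightarrow> successively P p"
  proof (induction p)
    case (Cons c p)
    have "\<forall>x a b y. p = x @ [a, b] @ y \<longrightarrow> P a b"
      using Cons.prems by (metis append_Cons)
    moreover have "P c (hd p)" if "p \<noteq> []"
      using Cons.prems[rule_format, of "[]" c "hd p" "tl p"] that by simp
    ultimately show ?case
      using Cons.IH by (cases p) auto
  qed simp
qed

lemma infix_arcs:
  assumes "awalk u (x @ [a, b] @ y) v"
  shows "a \<in> arcs Q" "b \<in> arcs Q" "head Q a = tail Q b" "ptgt Q (u, x) = tail Q a"
    "(tail Q a, [a, b]) \<in> paths Q"
  using assms by (auto simp: ptgt_awalk awalk_Cons_iff paths_iff awalk_Nil_iff)

text \<open>Subpaths of length 2 are the pairs of consecutive arrows, and such a pair is a quadratic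
  relation exactly if \<open>st True\<close> holds. This turns a condition on all subpaths into a
  recursive one on lists.\<close>

lemma walk_iff_True:
  assumes "awalk u p v"
  shows "(u, p) \<in> Gamma_paths Q I \<longleftrightarrow> walk True u p v"
proof -
  have "successively (st True) p" if h: "(u, p) \<in> Gamma_paths Q I"
    unfolding successively_iff_infix
  proof (intro allI impI)
    fix x a b y assume p: "p = x @ [a, b] @ y"
    note i = infix_arcs[OF assms[unfolded p]]
    have "subpath Q (tail Q a, [a, b]) (u, p)"
      using p i assms by (subst subpath_iff) (auto simp: paths_iff)
    then have "(tail Q a, [a, b]) \<in> quadratic_relations Q I"
      using h i(5) unfolding Gamma_paths_def by (auto simp: plen_def)
    then show "st True a b"
      by (simp add: quadratic_relations_iff)
  qed
  moreover have "(u, p) \<in> Gamma_paths Q I" if h: "successively (st True) p"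
  proof -
    have "\<rho> \<in> quadratic_relations Q I" if r: "\<rho> \<in> paths Q" "plen \<rho> = 2" "subpath Q \<rho> (u, p)" for \<rho>
    proof -
      obtain w a b where \<rho>: "\<rho> = (w, [a, b])"
        using r(2) by (cases \<rho>) (auto simp: plen_def length_Suc_conv numeral_2_eq_2)
      have "(u, p) \<in> paths Q" using assms by (auto simp: paths_iff)
      then obtain x y where p: "p = x @ [a, b] @ y"
        using subpath_iff[of u p w "[a, b]"] r \<rho> by auto
      have "st True a b"
        using h p by (auto simp: successively_iff_infix)
      then show ?thesis
        using r(1) \<rho> by (auto simp: quadratic_relations_iff paths_iff awalk_Cons_iff)
    qed
    then show ?thesis
      using assms by (auto simp: Gamma_paths_def paths_iff)
  qed
  ultimately show ?thesis
    using assms by (auto simp: walk_def)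
qed

lemma walk_iff_False:
  assumes "awalk u p v"
  shows "(u, p) \<in> B_paths Q I \<longleftrightarrow> walk False u p v"
proof -
  have P: "(u, p) \<in> paths Q" using assms by (auto simp: paths_iff)
  have "successively (st False) p" if h: "(u, p) \<in> B_paths Q I"
    unfolding successively_iff_infix
  proof (intro allI impI)
    fix x a b y assume p: "p = x @ [a, b] @ y"
    note i = infix_arcs[OF assms[unfolded p]]
    have "subpath Q (tail Q a, [a, b]) (u, p)"
      using p i P by (subst subpath_iff) auto
    then have "(tail Q a, [a, b]) \<notin> quadratic_relations Q I"
      using h unfolding B_paths_def by auto
    then show "st False a b"
      using i by (auto simp: quadratic_relations_iff st_def)
  qed
  moreover have "(u, p) \<in> B_paths Q I" if h: "successively (st False) p"
  proof -
    have False if r: "\<rho> \<in> quadratic_relations Q I" "subpath Q \<rho> (u, p)" for \<rho>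
    proof -
      obtain w a b where \<rho>: "\<rho> = (w, [a, b])" "st True a b"
        using r(1) by (cases \<rho>) (auto simp: quadratic_relations_iff)
      have "\<rho> \<in> paths Q" using r(1) by (simp add: quadratic_relations_def)
      then obtain x y where p: "p = x @ [a, b] @ y"
        using subpath_iff[OF P, of w "[a, b]"] r \<rho> by auto
      have "st False a b"
        using h p by (auto simp: successively_iff_infix)
      then show False
        using \<rho>(2) st_excl by blast
    qed
    then show ?thesis
      using P by (auto simp: B_paths_def)
  qed
  ultimately show ?thesis
    using assms by (auto simp: walk_def)
qed

lemma Gamma_paths_iff: "(u, p) \<in> Gamma_paths Q I \<longleftrightarrow> (\<exists>v. walk True u p v)"
proof -
  have "(u, p) \<in> Gamma_paths Q I \<Longrightarrow> \<exists>v. awalk u p v"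
    by (auto simp: Gamma_paths_def paths_iff)
  then show ?thesis
    using walk_iff_True walk_awalk by blast
qed

lemma B_paths_iff: "(u, p) \<in> B_paths Q I \<longleftrightarrow> (\<exists>v. walk False u p v)"
proof -
  have "(u, p) \<in> B_paths Q I \<Longrightarrow> \<exists>v. awalk u p v"
    by (auto simp: B_paths_def paths_iff)
  then show ?thesis
    using walk_iff_False walk_awalk by blast
qed

lemma pr_eq_iff: "pr s u p q = pr s u' p' q' \<longleftrightarrow> u = u' \<and> p = p' \<and> q = q'"
  by (auto simp: pr_def)

lemma pr_swap: "pr (\<not> s) u q p = pr s u p q"
  by (simp add: pr_def)

lemma in_X: "pr s u p q \<in> X \<longleftrightarrow> (\<exists>v. walk s u p v \<and> walk (\<not> s) u q v)"
proof -
  have "((u, p), (u, q)) \<in> X \<longleftrightarrow> (\<exists>v. walk True u p v \<and> walk False u q v)" for p q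
    by (auto simp: Gamma_B_def parallel_def Gamma_paths_iff B_paths_iff psrc_def) (metis ptgt_walk)+
  then show ?thesis
    by (cases s) (auto simp: pr_def)
qed

lemma X_cases:
  assumes "x \<in> X"
  obtains u p q v where "x = pr s u p q" "walk s u p v" "walk (\<not> s) u q v"
proof -
  obtain u p u' q where x: "x = ((u, p), (u', q))" by (metis surj_pair)
  have "u' = u" using assms by (simp add: x Gamma_B_def parallel_def psrc_def)
  then have "x = pr s u (if s then p else q) (if s then q else p)" by (simp add: x pr_def)
  then show thesis using that assms in_X by metis
qed

definition deg :: "('v, 'a) path \<times> ('v, 'a) path \<Rightarrow> nat" where
  "deg x = length (snd (fst x))"

lemma deg_pr: "deg (pr s u p q) = length (if s then p else q)"
  by (simp add: deg_def pr_def)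

lemma Gamma_B_deg_eq: "Gamma_B_deg Q I m = {x \<in> X. deg x = m}"
  by (auto simp: Gamma_B_deg_def Gamma_B_def parallel_def deg_def plen_def)

definition tgt :: "('v, 'a) path \<times> ('v, 'a) path \<Rightarrow> 'v" where
  "tgt x = ptgt Q (fst x)"

lemma tgt_pr: "walk s u p v \<Longrightarrow> walk (\<not> s) u q v \<Longrightarrow> tgt (pr s u p q) = v"
  by (auto simp: tgt_def pr_def ptgt_walk)

text \<open>The two admissibility conditions of the cup product amount to one membership in
  \<open>X\<close>, since concatenations of parallel paths are again parallel. In this form the
  product is symmetric in the two sides.\<close>

lemma cup_basis_pr:
  assumes "walk s u p v" "walk (\<not> s) u q v" "walk s u' p' v'" "walk (\<not> s) u' q' v'"
  shows "cup_basis Q I (pr s u p q) (pr s u' p' q') =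
    (if v' = u \<and> pr s u' (p' @ p) (q' @ q) \<in> X then basis (pr s u' (p' @ p) (q' @ q)) else 0)"
proof (cases "v' = u")
  case True
  have w: "awalk u' (p' @ p) v" "awalk u' (q' @ q) v"
    using assms True walk_awalk awalk_appendI by blast+
  have X: "((u', a), (u', b)) \<in> X \<longleftrightarrow> (u', a) \<in> Gamma_paths Q I \<and> (u', b) \<in> B_paths Q I"
    if "awalk u' a v" "awalk u' b v" for a b
    using that by (auto simp: Gamma_B_def parallel_def psrc_def ptgt_awalk)
  show ?thesis
    using assms True X[OF w] X[OF w(2,1)] by (cases s)
      (auto simp: cup_basis_def composable_def pcomp_def pr_def psrc_def ptgt_walk)
next
  case False
  then show ?thesis
    using assms by (cases s)
      (auto simp: cup_basis_def composable_def pr_def psrc_def ptgt_walk)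
qed

end

section \<open>Cup product, parity and the differential graded algebra of cochains\<close>

context gentle
begin

abbreviation cup (infixl "\<star>" 70) where
  "cup \<equiv> bilinear_ext (cup_basis Q I)"

abbreviation "d \<equiv> bardzell_d Q I"

definition sign :: "('v, 'a) path \<times> ('v, 'a) path \<Rightarrow> 'k" where
  "sign x = (- 1) ^ deg x"

text \<open>The parity automorphism of the graded algebra. It carries the Koszul signs, so that the
  Leibniz rule can be stated for inhomogeneous cochains.\<close>

definition eps :: "('v, 'a, 'k) cochain \<Rightarrow> ('v, 'a, 'k) cochain" where
  "eps = linear_ext (\<lambda>x. scale (sign x) (basis x))"

definition arrows_sum :: "('v, 'a, 'k) cochain" where
  "arrows_sum = (\<Sum>b\<in>arcs Q. basis (pr True (tail Q b) [b] [b]))"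

definition unit_cochain :: "('v, 'a, 'k) cochain" where
  "unit_cochain = (\<Sum>v\<in>verts Q. basis (pr True v [] []))"

lemma sign_sq [simp]: "sign x * sign x = 1"
  by (simp add: sign_def flip: power_mult_distrib)

lemma sign_nonzero [simp]: "sign x \<noteq> 0"
  by (simp add: sign_def)

lemmas cup_basis_True = cup_basis_pr[of True, simplified]

lemma cup_in_X: "f \<in> kspace X \<Longrightarrow> g \<in> kspace X \<Longrightarrow> f \<star> g \<in> kspace X"
proof (erule bilinear_closed[OF _ _ ksubspace_kspace])
  fix x y assume "x \<in> X" "y \<in> X"
  then show "cup_basis Q I x y \<in> kspace X"
    by (elim X_cases[of _ True]) (auto simp: cup_basis_pr kspace_intros)
qed

lemma walk_append_target:
  assumes "walk s u p w"
  shows "walk s u (p @ q) v \<longleftrightarrow> walk s w q v \<and> (p \<noteq> [] \<longrightarrow> q \<noteq> [] \<longrightarrow> st s (last p) (hd q))"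
  unfolding walk_append using assms by (metis walk_target_unique)

text \<open>Both bracketings give the concatenation \<open>?r\<close> of the three pairs. If that
  triple concatenation is admissible, then so is each inner one, because pieces of admissible paths
  are admissible; thus no bracketing loses a term.\<close>

lemma cup_assoc:
  assumes "f \<in> kspace X" "g \<in> kspace X" "h \<in> kspace X"
  shows "(f \<star> g) \<star> h = f \<star> (g \<star> h)"
proof (rule bilinear_assoc[OF assms])
  fix x y z assume x: "x \<in> X" and y: "y \<in> X" and z: "z \<in> X"
  obtain u p q v where x: "x = pr True u p q" "walk True u p v" "walk False u q v"
    by (rule X_cases[OF x, of True]) simp
  obtain u' p' q' v' where y: "y = pr True u' p' q'" "walk True u' p' v'" "walk False u' q' v'"
    by (rule X_cases[OF y, of True]) simp
  obtain u'' p'' q'' v'' where z: "z = pr True u'' p'' q''" "walk True u'' p'' v''" "walk False u'' q'' v''"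
    by (rule X_cases[OF z, of True]) simp
  let ?P = "v' = u \<and> v'' = u' \<and> pr True u'' (p'' @ p' @ p) (q'' @ q' @ q) \<in> X"
  let ?r = "if ?P then basis (pr True u'' (p'' @ p' @ p) (q'' @ q' @ q)) else 0"
  have xy: "cup_basis Q I x y = (if v' = u \<and> pr True u' (p' @ p) (q' @ q) \<in> X
      then basis (pr True u' (p' @ p) (q' @ q)) else 0)"
    unfolding x(1) y(1) by (rule cup_basis_True[OF x(2,3) y(2,3)])
  have yz: "cup_basis Q I y z = (if v'' = u' \<and> pr True u'' (p'' @ p') (q'' @ q') \<in> X
      then basis (pr True u'' (p'' @ p') (q'' @ q')) else 0)"
    unfolding y(1) z(1) by (rule cup_basis_True[OF y(2,3) z(2,3)])
  have 1: "?P \<Longrightarrow> v' = u \<and> pr True u' (p' @ p) (q' @ q) \<in> X"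
    by (auto simp: in_X walk_append_target[OF z(2)] walk_append_target[OF z(3)])
  have 2: "?P \<Longrightarrow> v'' = u' \<and> pr True u'' (p'' @ p') (q'' @ q') \<in> X"
    using y(2,3) by (auto simp: in_X walk_append_target[OF z(2)] walk_append_target[OF z(3)] walk_append_target[OF y(2)] walk_append_target[OF y(3)])
  have "cup_basis Q I x y \<star> basis z = ?r"
  proof (cases "v' = u \<and> pr True u' (p' @ p) (q' @ q) \<in> X")
    case True
    then obtain w where w: "walk True u' (p' @ p) w" "walk False u' (q' @ q) w"
      by (auto simp: in_X)
    have "cup_basis Q I x y \<star> basis z = cup_basis Q I (pr True u' (p' @ p) (q' @ q)) z"
      unfolding xy by (simp only: True simp_thms if_True bilinear_ext_basis)
    also have "\<dots> = ?r"
      unfolding z(1) cup_basis_True[OF w z(2,3)] by (simp only: True simp_thms append_assoc)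
    finally show ?thesis .
  next
    case False
    then show ?thesis
      unfolding xy using 1 by (simp only: if_False bilinear_simps) argo
  qed
  moreover have "basis x \<star> cup_basis Q I y z = ?r"
  proof (cases "v'' = u' \<and> pr True u'' (p'' @ p') (q'' @ q') \<in> X")
    case True
    then obtain w where w: "walk True u'' (p'' @ p') w" "walk False u'' (q'' @ q') w"
      by (auto simp: in_X)
    have [simp]: "w = v'"
      using w(1) True walk_target_unique[OF y(2), of True w]
      by (simp add: walk_append_target[OF z(2)])
    have "basis x \<star> cup_basis Q I y z = cup_basis Q I x (pr True u'' (p'' @ p') (q'' @ q'))"
      unfolding yz by (simp only: True simp_thms if_True bilinear_ext_basis)
    also have "\<dots> = ?r"
      unfolding x(1) cup_basis_True[OF x(2,3) w] by (simp only: True \<open>w = v'\<close> simp_thms append_assoc)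
    finally show ?thesis .
  next
    case False
    then show ?thesis
      unfolding yz using 2 by (simp only: if_False bilinear_simps) argo
  qed
  ultimately show "cup_basis Q I x y \<star> basis z = basis x \<star> cup_basis Q I y z"
    by (rule trans[OF _ sym])
qed

lemma unit_in_X: "unit_cochain \<in> kspace X"
  unfolding unit_cochain_def by (rule ksubspace_sum[OF ksubspace_kspace]) (auto simp: in_X)

lemma arrows_sum_in_X: "arrows_sum \<in> kspace X"
  unfolding arrows_sum_def by (rule ksubspace_sum[OF ksubspace_kspace]) (auto simp: in_X)

lemma unit_cup: assumes "f \<in> kspace X" shows "unit_cochain \<star> f = f" "f \<star> unit_cochain = f"
proof -
  have "unit_cochain \<star> basis x = basis x \<and> basis x \<star> unit_cochain = basis x" if xX: "x \<in> X" for x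
  proof -
    obtain u p q v where x: "x = pr True u p q" "walk True u p v" "walk False u q v"
      by (rule X_cases[OF xX, of True]) simp
    have uv: "u \<in> verts Q" "v \<in> verts Q" using walk_verts[OF x(2)] by auto
    have "unit_cochain \<star> basis x = (\<Sum>w\<in>verts Q. if w = v then basis x else 0)"
      unfolding unit_cochain_def bilinear_simps
    proof (rule sum.cong)
      fix w assume "w \<in> verts Q"
      then show "basis (pr True w [] []) \<star> basis x = (if w = v then basis x else 0)"
        using cup_basis_True[of w "[]" w "[]", OF _ _ x(2,3)] xX x(1) by simp
    qed simp
    moreover have "basis x \<star> unit_cochain = (\<Sum>w\<in>verts Q. if w = u then basis x else 0)"
      unfolding unit_cochain_def bilinear_simps
    proof (rule sum.cong)
      fix w assume "w \<in> verts Q"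
      then show "basis x \<star> basis (pr True w [] []) = (if w = u then basis x else 0)"
        using cup_basis_True[OF x(2,3), of w "[]" w "[]"] xX x(1) by simp
    qed simp
    ultimately show ?thesis
      using uv by simp
  qed
  note * = this
  show "unit_cochain \<star> f = f"
    by (rule klinear_eqI[OF klinear_bilinear_right klinear_id assms]) (simp add: *)
  show "f \<star> unit_cochain = f"
    by (rule klinear_eqI[OF klinear_bilinear_left klinear_id assms]) (simp add: *)
qed

lemma klinear_eps [simp]: "klinear eps"
  by (simp add: eps_def)

lemma klinear_d [simp]: "klinear d"
  by (simp add: bardzell_d_def)

lemma eps_basis [simp]: "eps (basis x) = scale (sign x) (basis x)"
  by (simp add: eps_def)

lemma eps_in_X: "f \<in> kspace X \<Longrightarrow> eps f \<in> kspace X"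
  by (rule klinear_memI[OF klinear_eps ksubspace_kspace]) (auto intro: kspace_intros)

lemma eps_eps [simp]: "eps (eps f) = f"
  by (rule klinear_eqI[OF klinear_comp[OF klinear_eps klinear_eps] klinear_id, of _ UNIV])
    (auto simp: kspace_def klinearD[OF klinear_eps])

lemma eps_cup:
  assumes "f \<in> kspace X" "g \<in> kspace X"
  shows "eps (f \<star> g) = eps f \<star> eps g"
proof (rule klinear_eqI[OF _ _ assms(1)])
  fix x assume x: "x \<in> X"
  show "eps (basis x \<star> g) = eps (basis x) \<star> eps g"
  proof (rule klinear_eqI[OF _ _ assms(2)])
    fix y assume y: "y \<in> X"
    show "eps (basis x \<star> basis y) = eps (basis x) \<star> eps (basis y)"
      using x y by (elim X_cases[of _ True])
        (auto simp: cup_basis_pr bilinear_simps klinearD[OF klinear_eps] sign_def deg_pr power_add)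
  qed (rule klinear_comp[OF klinear_eps klinear_bilinear_right] klinear_comp[OF klinear_bilinear_right klinear_eps])+
qed (rule klinear_comp[OF klinear_eps klinear_bilinear_left] klinear_comp[OF klinear_bilinear_left klinear_eps])+

lemma eps_arrows_sum: "eps arrows_sum = - arrows_sum"
  by (simp add: arrows_sum_def klinearD[OF klinear_eps] sign_def deg_pr sum_negf)

lemma eps_unit: "eps unit_cochain = unit_cochain"
  by (simp add: unit_cochain_def klinearD[OF klinear_eps] sign_def deg_pr)

text \<open>
  The Bardzell differential is the graded commutator with the sum of all pairs \<open>(b, b)\<close>; hence it is a
  graded derivation of square zero as soon as the cup product is associative.
\<close>

lemma d_eq_commutator:
  assumes "f \<in> kspace X"
  shows "d f = arrows_sum \<star> f - eps f \<star> arrows_sum"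
proof (rule klinear_eqI[OF klinear_d _ assms])
  show "klinear (\<lambda>f. arrows_sum \<star> f - eps f \<star> arrows_sum)"
    by (intro klinear_diff klinear_bilinear_right klinear_comp[OF klinear_bilinear_left klinear_eps])
  fix x assume "x \<in> X"
  then obtain u p q v where x: "x = pr True u p q" "walk True u p v" "walk False u q v"
    by (rule X_cases[of _ True]) simp
  have t: "ptgt Q (u, p) = v" using x(2) by (rule ptgt_walk)
  have ta: "ptgt Q (tail Q a, [a]) = head Q a" for a by (simp add: ptgt_cases)
  have dg: "((u', p'), (u', q')) \<in> Gamma_B_deg Q I (Suc (length p)) \<longleftrightarrow> pr True u' p' q' \<in> X"
    if "length p' = Suc (length p)" for u' p' q'
    using that by (simp add: Gamma_B_deg_eq deg_def pr_def)
  have "arrows_sum \<star> basis x = (\<Sum>b\<in>arcs Q. if tail Q b = v \<and> pr True u (p @ [b]) (q @ [b]) \<in> X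
      then basis (pr True u (p @ [b]) (q @ [b])) else 0)"
    unfolding arrows_sum_def bilinear_simps
    by (rule sum.cong) (use x in \<open>auto simp: cup_basis_pr\<close>)
  moreover have "eps (basis x) \<star> arrows_sum = scale (sign x)
      (\<Sum>a\<in>arcs Q. if head Q a = u \<and> pr True (tail Q a) (a # p) (a # q) \<in> X
      then basis (pr True (tail Q a) (a # p) (a # q)) else 0)"
  proof -
    have "basis x \<star> arrows_sum = (\<Sum>a\<in>arcs Q. if head Q a = u \<and> pr True (tail Q a) (a # p) (a # q) \<in> X
      then basis (pr True (tail Q a) (a # p) (a # q)) else 0)"
      unfolding arrows_sum_def bilinear_simps
      by (rule sum.cong) (use x in \<open>auto simp: cup_basis_pr\<close>)
    then show ?thesis by (simp add: bilinear_simps)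
  qed
  moreover have "d (basis x) = bardzell_d_basis Q I x"
    by (simp add: bardzell_d_def)
  ultimately show "d (basis x) = arrows_sum \<star> basis x - eps (basis x) \<star> arrows_sum"
    using x(1) by (simp add: bardzell_d_basis_def pr_def sum.inter_filter[symmetric] composable_def
        arrow_path_def pcomp_def psrc_def t plen_def dg sign_def deg_def ta eq_commute[of u]
        cong: conj_cong)
qed

lemma d_in_X: "f \<in> kspace X \<Longrightarrow> d f \<in> kspace X"
  by (simp add: d_eq_commutator kspace_intros cup_in_X eps_in_X arrows_sum_in_X)

text \<open>In a surviving term two consecutive arrows would form a relation in the first component
  and not form one in the second. This is the source of \<open>d_d\<close>.\<close>

lemma arrows_sum_sq: "arrows_sum \<star> arrows_sum = 0"
proof -
  have "cup_basis Q I (pr True (tail Q a) [a] [a]) (pr True (tail Q b) [b] [b]) = 0"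
    if "a \<in> arcs Q" "b \<in> arcs Q" for a b
    using that by (auto simp: cup_basis_pr in_X walk_Cons dest: st_excl)
  then show ?thesis
    by (simp add: arrows_sum_def bilinear_simps)
qed

text \<open>An inner graded derivation: the two inserted terms
  \<open>eps f \<star> arrows_sum \<star> g\<close> cancel.\<close>

lemma d_cup:
  assumes f: "f \<in> kspace X" and g: "g \<in> kspace X"
  shows "d (f \<star> g) = d f \<star> g + eps f \<star> d g"
proof -
  note X = f g arrows_sum_in_X eps_in_X cup_in_X
  show ?thesis
    by (simp add: d_eq_commutator X eps_cup bilinear_simps cup_assoc)
qed

lemma d_eps: assumes f: "f \<in> kspace X" shows "d (eps f) = - eps (d f)"
proof -
  note X = f arrows_sum_in_X eps_in_X cup_in_X
  show ?thesis
    by (simp add: d_eq_commutator X eps_cup bilinear_simps cup_assoc klinearD[OF klinear_eps] eps_arrows_sum)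
qed

lemma d_d: assumes f: "f \<in> kspace X" shows "d (d f) = 0"
proof -
  note X = f arrows_sum_in_X eps_in_X cup_in_X
  have "arrows_sum \<star> (arrows_sum \<star> f) = 0"
    by (simp add: cup_assoc[symmetric] X arrows_sum_sq bilinear_simps)
  moreover have "(f \<star> arrows_sum) \<star> arrows_sum = 0"
    by (simp add: cup_assoc X arrows_sum_sq bilinear_simps)
  ultimately show ?thesis
    by (simp add: d_eq_commutator X kspace_intros eps_cup bilinear_simps
        klinearD[OF klinear_eps] eps_arrows_sum cup_assoc)
qed

lemma d_unit: "d unit_cochain = 0"
  by (simp add: d_eq_commutator unit_in_X eps_unit unit_cup arrows_sum_in_X)

section \<open>The cohomology ring\<close>

abbreviation "Z \<equiv> carrier (cocycle_ring Q I)"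
abbreviation "cls \<equiv> cohomology_class Q I"

lemma Z_iff: "f \<in> Z \<longleftrightarrow> f \<in> kspace X \<and> d f = 0"
  by (simp add: cocycle_ring_def)

lemma cocycle_ring_sel:
  "mult (cocycle_ring Q I) = (\<star>)" "one (cocycle_ring Q I) = unit_cochain"
  "zero (cocycle_ring Q I) = 0" "add (cocycle_ring Q I) = (+)"
  by (auto simp: cocycle_ring_def unit_cochain_def vertex_path_def pr_def)

lemma ksubspace_Z: "ksubspace Z"
  using ksubspace_kernel[OF klinear_d ksubspace_kspace] by (simp add: cocycle_ring_def)

lemma cup_Z: "f \<in> Z \<Longrightarrow> g \<in> Z \<Longrightarrow> f \<star> g \<in> Z"
  by (simp add: Z_iff cup_in_X d_cup bilinear_simps)

lemma unit_Z: "unit_cochain \<in> Z"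
  by (simp add: Z_iff unit_in_X d_unit)

lemma cocycle_ring: "ring (cocycle_ring Q I)"
proof (rule ringI)
  show "abelian_group (cocycle_ring Q I)"
  proof (rule abelian_groupI; simp only: cocycle_ring_sel)
    show "\<exists>y\<in>Z. y + x = 0" if "x \<in> Z" for x
      using that ksubspaceD(4)[OF ksubspace_Z] by (intro bexI[of _ "- x"]) auto
  qed (auto simp: ksubspaceD[OF ksubspace_Z] add_ac)
  show "Group.monoid (cocycle_ring Q I)"
  proof (rule Group.monoidI; simp only: cocycle_ring_sel)
    show "unit_cochain \<in> Z" by (rule unit_Z)
    show "f \<star> g \<in> Z" if "f \<in> Z" "g \<in> Z" for f g
      using that by (rule cup_Z)
  qed (simp_all add: Z_iff cup_assoc unit_cup)
qed (simp_all only: cocycle_ring_sel bilinear_simps)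

abbreviation "Bd \<equiv> coboundaries Q I"

lemma ksubspace_Bd: "ksubspace Bd"
  unfolding coboundaries_def by (rule ksubspace_image[OF klinear_d ksubspace_kspace])

lemma Bd_subset_Z: "Bd \<subseteq> Z"
  by (auto simp: coboundaries_def Z_iff d_in_X d_d)

lemma Bd_I: "f \<in> kspace X \<Longrightarrow> d f \<in> Bd"
  by (simp add: coboundaries_def)

text \<open>Leibniz with one factor a cocycle: \<open>d h \<star> g = d (h \<star> g)\<close> and
  \<open>f \<star> d h = d (eps f \<star> h)\<close>, where the parity twist absorbs the
  sign.\<close>

lemma Bd_cup: "f \<in> Bd \<Longrightarrow> g \<in> Z \<Longrightarrow> f \<star> g \<in> Bd" "f \<in> Z \<Longrightarrow> g \<in> Bd \<Longrightarrow> f \<star> g \<in> Bd"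
proof -
  show "f \<star> g \<in> Bd" if fg: "f \<in> Bd" "g \<in> Z"
  proof -
    obtain h where h: "h \<in> kspace X" "f = d h" using fg by (auto simp: coboundaries_def)
    then have "f \<star> g = d (h \<star> g)" using fg by (simp add: d_cup Z_iff bilinear_simps)
    then show ?thesis using h fg by (auto simp: Z_iff intro!: Bd_I cup_in_X)
  qed
  show "f \<star> g \<in> Bd" if fg: "f \<in> Z" "g \<in> Bd"
  proof -
    obtain h where h: "h \<in> kspace X" "g = d h" using fg by (auto simp: coboundaries_def)
    then have "f \<star> g = d (eps f \<star> h)"
      using fg by (simp add: d_cup d_eps Z_iff bilinear_simps eps_in_X klinearD[OF klinear_eps])
    then show ?thesis using h fg by (auto simp: Z_iff intro!: Bd_I cup_in_X eps_in_X)
  qed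
qed

lemma a_inv_cocycle: "f \<in> Z \<Longrightarrow> a_inv (cocycle_ring Q I) f = - f"
  using abelian_group.minus_equality[of "cocycle_ring Q I" "- f" f] cocycle_ring ksubspaceD(4)[OF ksubspace_Z]
  by (simp add: ring.is_abelian_group cocycle_ring_sel)

lemma ideal_Bd: "ideal Bd (cocycle_ring Q I)"
proof (rule idealI[OF cocycle_ring])
  interpret ring "cocycle_ring Q I" by (rule cocycle_ring)
  show "subgroup Bd (add_monoid (cocycle_ring Q I))"
  proof
    show "inv\<^bsub>add_monoid (cocycle_ring Q I)\<^esub> x \<in> Bd" if "x \<in> Bd" for x
    proof -
      have "inv\<^bsub>add_monoid (cocycle_ring Q I)\<^esub> x = - x"
        using a_inv_cocycle[of x] that Bd_subset_Z by (auto simp: a_inv_def)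
      then show ?thesis using that by (simp add: ksubspaceD[OF ksubspace_Bd])
    qed
  qed (use Bd_subset_Z in \<open>auto simp: cocycle_ring_sel ksubspaceD[OF ksubspace_Bd]\<close>)
qed (auto simp: cocycle_ring_sel Bd_cup)

sublocale HH: ideal Bd "cocycle_ring Q I"
  by (rule ideal_Bd)

lemma ring_HH: "ring (HH Q I)"
  unfolding HH_def by (rule HH.quotient_is_ring)

lemma cls_hom: "cls \<in> ring_hom (cocycle_ring Q I) (HH Q I)"
  using HH.rcos_ring_hom unfolding HH_def cohomology_class_def[abs_def] .

lemma carrier_HH: "carrier (HH Q I) = cls ` Z"
  by (auto simp: HH_def FactRing_def A_RCOSETS_def' cohomology_class_def)

lemma cls_eq_iff: "f \<in> Z \<Longrightarrow> g \<in> Z \<Longrightarrow> cls f = cls g \<longleftrightarrow> f - g \<in> Bd"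
proof -
  assume f: "f \<in> Z" and g: "g \<in> Z"
  have m: "f \<ominus>\<^bsub>cocycle_ring Q I\<^esub> g = f - g"
    using g by (simp add: a_minus_def a_inv_cocycle cocycle_ring_sel)
  show ?thesis
    using HH.quotient_eq_iff_same_a_r_cos[OF HH.ideal_axioms f g] m by (simp add: cohomology_class_def)
qed

lemma cls_simps:
  assumes "f \<in> Z" "g \<in> Z"
  shows "cls f \<otimes>\<^bsub>HH Q I\<^esub> cls g = cls (f \<star> g)" "cls f \<oplus>\<^bsub>HH Q I\<^esub> cls g = cls (f + g)"
  using ring_hom_memE(2,3)[OF cls_hom assms] by (simp_all add: cocycle_ring_sel)

lemma cls_unit: "cls unit_cochain = \<one>\<^bsub>HH Q I\<^esub>"
  using ring_hom_memE(4)[OF cls_hom] by (simp add: cocycle_ring_sel)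

lemma cls_zero: "cls 0 = \<zero>\<^bsub>HH Q I\<^esub>"
  using ring_hom_zero[OF cls_hom cocycle_ring ring_HH] by (simp add: cocycle_ring_sel)

lemma cls_eq_0_iff: "f \<in> Z \<Longrightarrow> cls f = \<zero>\<^bsub>HH Q I\<^esub> \<longleftrightarrow> f \<in> Bd"
  using cls_eq_iff[of f 0] ksubspaceD(1)[OF ksubspace_Z] by (simp add: cls_zero)

end

section \<open>Cancelling squares\<close>

text \<open>
  The basis elements in \<open>Y\<close> are linked by the two components \<open>L\<close> and \<open>R\<close> of the differential \<open>D\<close>. Each
  connected piece is a square, an edge or a point, so that only the points survive in cohomology.
\<close>

locale square_complex =
  fixes Y :: "'x set" and L R :: "'x \<Rightarrow> 'x \<Rightarrow> bool" and sg :: "'x \<Rightarrow> 'k::field"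
    and D :: "('x \<Rightarrow>\<^sub>0 'k) \<Rightarrow> ('x \<Rightarrow>\<^sub>0 'k)"
  assumes klinear_D: "klinear D"
    and L_inj: "L x z \<Longrightarrow> L y z \<Longrightarrow> x = y" and R_inj: "R x z \<Longrightarrow> R y z \<Longrightarrow> x = y"
    and L_fun: "x \<in> Y \<Longrightarrow> L x y \<Longrightarrow> L x z \<Longrightarrow> y = z" and R_fun: "x \<in> Y \<Longrightarrow> R x y \<Longrightarrow> R x z \<Longrightarrow> y = z"
    and L_Y: "L x y \<Longrightarrow> x \<in> Y \<longleftrightarrow> y \<in> Y" and R_Y: "R x y \<Longrightarrow> x \<in> Y \<longleftrightarrow> y \<in> Y"
    and L_L: "L x y \<Longrightarrow> \<not> L y z" and R_R: "R x y \<Longrightarrow> \<not> R y z"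
    and L_R: "x \<in> Y \<Longrightarrow> L x y \<Longrightarrow> R x z \<Longrightarrow> \<exists>w. L z w \<and> R y w"
    and L_then_R: "L y x \<Longrightarrow> R x z \<Longrightarrow> \<exists>w. R y w \<and> L w z"
    and R_from_L: "x \<in> Y \<Longrightarrow> R x z \<Longrightarrow> L w z \<Longrightarrow> \<exists>y. L y x"
    and R_then_L: "x \<in> Y \<Longrightarrow> R x z \<Longrightarrow> L z w \<Longrightarrow> \<exists>y. L x y"
    and sg_L: "L x y \<Longrightarrow> sg y = - sg x" and sg_R: "R x y \<Longrightarrow> sg y = - sg x"
    and sg_sq: "sg x * sg x = 1"
    and D_LR: "x \<in> Y \<Longrightarrow> L x y \<Longrightarrow> R x z \<Longrightarrow> D (basis x) = basis y - scale (sg x) (basis z)"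
    and D_L: "x \<in> Y \<Longrightarrow> L x y \<Longrightarrow> \<nexists>z. R x z \<Longrightarrow> D (basis x) = basis y"
    and D_R: "x \<in> Y \<Longrightarrow> \<nexists>y. L x y \<Longrightarrow> R x z \<Longrightarrow> D (basis x) = - scale (sg x) (basis z)"
    and D_0: "x \<in> Y \<Longrightarrow> \<nexists>y. L x y \<Longrightarrow> \<nexists>z. R x z \<Longrightarrow> D (basis x) = 0"
begin

definition isolated :: "'x set" where
  "isolated = {x \<in> Y. (\<nexists>y. L x y) \<and> (\<nexists>y. R x y) \<and> (\<nexists>y. L y x) \<and> (\<nexists>y. R y x)}"

text \<open>A contracting homotopy away from the isolated points: go back along \<open>L\<close>
  where possible, and along \<open>R\<close> only at points without any \<open>L\<close>-edge, so
  that squares are contracted in one direction only. The factor \<open>sg x\<close> undoes the sign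
  of the \<open>R\<close>-part of \<open>D\<close>.\<close>

definition hb :: "'x \<Rightarrow> ('x \<Rightarrow>\<^sub>0 'k)" where
  "hb x = (if \<exists>y. L y x then basis (THE y. L y x) else if \<exists>y. L x y then 0
     else if \<exists>y. R y x then scale (sg x) (basis (THE y. R y x)) else 0)"

lemma hb_L: "L y x \<Longrightarrow> hb x = basis y"
  unfolding hb_def by (metis L_inj the_equality)

lemma hb_0: "\<nexists>y. L y x \<Longrightarrow> L x y \<Longrightarrow> hb x = 0"
  unfolding hb_def by auto

lemma hb_R: "\<nexists>y. L y x \<Longrightarrow> \<nexists>y. L x y \<Longrightarrow> R y x \<Longrightarrow> hb x = scale (sg x) (basis y)"
proof -
  assume *: "\<nexists>y. L y x" "\<nexists>y. L x y" "R y x"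
  have "(THE y. R y x) = y" using *(3) R_inj by blast
  then show ?thesis using * unfolding hb_def by auto
qed

lemma hb_isolated: "\<nexists>y. L y x \<Longrightarrow> \<nexists>y. L x y \<Longrightarrow> \<nexists>y. R y x \<Longrightarrow> hb x = 0"
  unfolding hb_def by auto

abbreviation "h \<equiv> linear_ext hb"

lemma homotopy_basis:
  assumes x: "x \<in> Y"
  shows "basis x - D (h (basis x)) - h (D (basis x)) = (if x \<in> isolated then basis x else 0)"
proof -
  note lin = klinearD[OF klinear_D] klinearD[OF klinear_linear_ext[of hb]]
  \<comment> \<open>\<open>S\<close> and \<open>E\<close> are target and source of an
    \<open>L\<close>-edge, possibly within a square; \<open>RS\<close> and \<open>RE\<close> are
    target and source of an \<open>R\<close>-edge outside all squares; \<open>N\<close> is an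
    isolated point.\<close>
  consider (S) y where "L y x" | (E) y where "\<nexists>y. L y x" "L x y"
    | (RS) y where "\<nexists>y. L y x" "\<nexists>y. L x y" "R y x"
    | (RE) z where "\<nexists>y. L y x" "\<nexists>y. L x y" "\<nexists>y. R y x" "R x z"
    | (N) "\<nexists>y. L y x" "\<nexists>y. L x y" "\<nexists>y. R y x" "\<nexists>y. R x y"
    by blast
  then show ?thesis
  proof cases
    case S
    have y: "y \<in> Y" using L_Y[OF S] x by simp
    have nL: "\<nexists>z. L x z" using L_L[OF S] by blast
    have iso: "x \<notin> isolated" using S by (auto simp: isolated_def)
    show ?thesis
    proof (cases "\<exists>z. R x z")
      case True
      then obtain z where z: "R x z" by blast
      obtain w where w: "R y w" "L w z" using L_then_R[OF S z] by blast
      have "D (basis x) = - scale (sg x) (basis z)" by (rule D_R[OF x nL z])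
      moreover have "D (basis y) = basis x - scale (sg y) (basis w)" by (rule D_LR[OF y S w(1)])
      ultimately show ?thesis
        using iso sg_L[OF S] by (simp add: lin hb_L[OF S] hb_L[OF w(2)])
    next
      case False
      then have "\<nexists>w. R y w" using L_R[OF y S] by blast
      then show ?thesis
        using iso D_L[OF y S] D_0[OF x nL False] by (simp add: lin hb_L[OF S])
    qed
  next
    case E
    have iso: "x \<notin> isolated" using E by (auto simp: isolated_def)
    show ?thesis
    proof (cases "\<exists>z. R x z")
      case True
      then obtain z where z: "R x z" by blast
      obtain w where w: "L z w" using L_R[OF x E(2) z] by blast
      have "\<nexists>w. L w z" using R_from_L[OF x z] E(1) by blast
      then have "hb z = 0" using hb_0 w by blast
      then show ?thesis
        using iso D_LR[OF x E(2) z] by (simp add: lin hb_L[OF E(2)] hb_0[OF E])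
    next
      case False
      then show ?thesis
        using iso D_L[OF x E(2) False] by (simp add: lin hb_L[OF E(2)] hb_0[OF E])
    qed
  next
    case RS
    have iso: "x \<notin> isolated" using RS by (auto simp: isolated_def)
    have y: "y \<in> Y" using R_Y[OF RS(3)] x by simp
    have "\<nexists>t. L y t" using L_R[OF y _ RS(3)] RS(2) by blast
    then have "D (basis y) = - scale (sg y) (basis x)" by (rule D_R[OF y _ RS(3)])
    moreover have "D (basis x) = 0" using R_R[OF RS(3)] by (intro D_0[OF x RS(2)]) blast
    moreover have "sg x * sg y = - 1" using sg_R[OF RS(3)] sg_sq[of y] by simp
    ultimately show ?thesis
      using iso by (simp add: lin hb_R[OF RS])
  next
    case RE
    have iso: "x \<notin> isolated" using RE by (auto simp: isolated_def)
    have "hb z = scale (sg z) (basis x)"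
      by (rule hb_R) (use R_from_L[OF x RE(4)] R_then_L[OF x RE(4)] RE in blast)+
    moreover have "sg x * sg z = - 1" using sg_R[OF RE(4)] sg_sq[of x] by simp
    ultimately show ?thesis
      using iso D_R[OF x RE(2,4)] hb_isolated[OF RE(1-3)] by (simp add: lin)
  next
    case N
    then have "x \<in> isolated" using x by (auto simp: isolated_def)
    then show ?thesis
      using D_0[OF x N(2,4)] hb_isolated[OF N(1-3)] by (simp add: lin)
  qed
qed

lemma h_in_Y: "f \<in> kspace Y \<Longrightarrow> h f \<in> kspace Y"
proof (erule klinear_memI[OF klinear_linear_ext ksubspace_kspace])
  fix x assume x: "x \<in> Y"
  have "hb x \<in> kspace Y"
  proof (cases "\<exists>y. L y x")
    case True
    then show ?thesis using x L_Y hb_L by fastforce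
  next
    case F: False
    show ?thesis
    proof (cases "(\<exists>y. L x y) \<or> (\<nexists>y. R y x)")
      case True
      then have "hb x = 0" using F hb_0 hb_isolated by blast
      then show ?thesis by (simp add: kspace_intros)
    next
      case False
      then obtain y where "R y x" by blast
      then show ?thesis using x R_Y hb_R[OF F] False by (auto simp: kspace_intros)
    qed
  qed
  then show "h (basis x) \<in> kspace Y" by simp
qed

text \<open>By \<open>homotopy_basis\<close>, \<open>f - D (h f) - h (D f)\<close> is the projection
  to the isolated points, and its last term vanishes on a cocycle.\<close>

lemma cocycle_decomposition:
  assumes f: "f \<in> kspace Y" and D: "D f = 0"
  obtains g e where "g \<in> kspace Y" "e \<in> kspace isolated" "f = D g + e"
proof
  show "h f \<in> kspace Y" using f by (rule h_in_Y)
  let ?p = "linear_ext (\<lambda>x. if x \<in> isolated then basis x else 0)"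
  show "?p f \<in> kspace isolated"
    by (rule klinear_memI[OF klinear_linear_ext ksubspace_kspace f]) (auto simp: kspace_intros)
  have "f - D (h f) - h (D f) = ?p f"
  proof (rule klinear_eqI[OF _ klinear_linear_ext f])
    show "klinear (\<lambda>f. f - D (h f) - h (D f))"
      by (rule klinear_diff[OF klinear_diff[OF klinear_id klinear_comp[OF klinear_D klinear_linear_ext]]
            klinear_comp[OF klinear_linear_ext klinear_D]])
  qed (simp only: homotopy_basis linear_ext_basis[of "\<lambda>x. if x \<in> isolated then basis x else 0"])
  then show "f = D (h f) + ?p f"
    using D klinearD(3)[OF klinear_linear_ext, of hb] by (simp add: algebra_simps)
qed

end

section \<open>The differential on basis elements\<close>

context gentle
begin

fun shareL shareR :: "('v, 'a) path \<times> ('v, 'a) path \<Rightarrow> bool" where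
  "shareL ((u, p), (w, q)) \<longleftrightarrow> p \<noteq> [] \<and> q \<noteq> [] \<and> last p = last q"
| "shareR ((u, p), (w, q)) \<longleftrightarrow> p \<noteq> [] \<and> q \<noteq> [] \<and> hd p = hd q"

fun chopL chopR :: "('v, 'a) path \<times> ('v, 'a) path \<Rightarrow> ('v, 'a) path \<times> ('v, 'a) path" where
  "chopL ((u, p), (w, q)) = ((u, butlast p), (w, butlast q))"
| "chopR ((u, p), (w, q)) = ((head Q (hd p), tl p), (head Q (hd q), tl q))"

text \<open>Left refers to the right-to-left notation of paths: the new arrow is the last one
  traversed and stands at the end of the lists. The link is read from its longer end
  \<open>y\<close>, where chopping leaves no choice, so uniqueness of the shorter end is
  immediate.\<close>

definition linkL :: "('v, 'a) path \<times> ('v, 'a) path \<Rightarrow> ('v, 'a) path \<times> ('v, 'a) path \<Rightarrow> bool" where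
  "linkL x y \<longleftrightarrow> y \<in> X \<and> shareL y \<and> x = chopL y"

definition linkR :: "('v, 'a) path \<times> ('v, 'a) path \<Rightarrow> ('v, 'a) path \<times> ('v, 'a) path \<Rightarrow> bool" where
  "linkR x y \<longleftrightarrow> y \<in> X \<and> shareR y \<and> x = chopR y"

lemma share_pr [simp]:
  "shareL (pr s u p q) \<longleftrightarrow> p \<noteq> [] \<and> q \<noteq> [] \<and> last p = last q"
  "shareR (pr s u p q) \<longleftrightarrow> p \<noteq> [] \<and> q \<noteq> [] \<and> hd p = hd q"
  by (auto simp: pr_def)

lemma chopL_pr [simp]: "chopL (pr s u p q) = pr s u (butlast p) (butlast q)"
  by (simp add: pr_def)

lemma chopR_pr [simp]: "hd p = hd q \<Longrightarrow> chopR (pr s u p q) = pr s (head Q (hd p)) (tl p) (tl q)"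
  by (simp add: pr_def)

lemma linkL_pr:
  "linkL (pr s u p q) y \<longleftrightarrow> (\<exists>b\<in>arcs Q. y = pr s u (p @ [b]) (q @ [b]) \<and> y \<in> X)"
proof
  assume l: "linkL (pr s u p q) y"
  then have y: "y \<in> X" by (simp add: linkL_def)
  obtain u' p' q' v' where y': "y = pr s u' p' q'" "walk s u' p' v'"
    by (rule X_cases[OF y, of s])
  have "p' \<noteq> [] \<Longrightarrow> last p' \<in> arcs Q"
    using walk_arcs[OF y'(2)] last_in_set by blast
  then have "p' = p @ [last p']" "q' = q @ [last p']" "u' = u" "last p' \<in> arcs Q"
    using l y' append_butlast_last_id[of p'] append_butlast_last_id[of q']
    by (auto simp: linkL_def pr_eq_iff)
  then show "\<exists>b\<in>arcs Q. y = pr s u (p @ [b]) (q @ [b]) \<and> y \<in> X"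
    using y y' by metis
qed (auto simp: linkL_def)

lemma linkR_pr:
  "linkR (pr s u p q) y \<longleftrightarrow> (\<exists>a\<in>arcs Q. head Q a = u \<and> y = pr s (tail Q a) (a # p) (a # q) \<and> y \<in> X)"
proof
  assume l: "linkR (pr s u p q) y"
  then have y: "y \<in> X" by (simp add: linkR_def)
  obtain u' p' q' v' where y': "y = pr s u' p' q'" "walk s u' p' v'"
    by (rule X_cases[OF y, of s])
  have "p' \<noteq> [] \<Longrightarrow> hd p' \<in> arcs Q"
    using walk_arcs[OF y'(2)] hd_in_set by blast
  then have "p' = hd p' # p" "q' = hd p' # q" "u' = tail Q (hd p')" "hd p' \<in> arcs Q" "head Q (hd p') = u"
    using l y' walk_source[OF y'(2)] list.collapse[of p'] list.collapse[of q']
    by (auto simp: linkR_def pr_eq_iff)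
  then show "\<exists>a\<in>arcs Q. head Q a = u \<and> y = pr s (tail Q a) (a # p) (a # q) \<and> y \<in> X"
    using y y' by metis
qed (auto simp: linkR_def)

lemma linkL_X: "linkL x y \<Longrightarrow> x \<in> X \<and> y \<in> X"
proof -
  assume l: "linkL x y"
  then have y: "y \<in> X" by (simp add: linkL_def)
  obtain u p q v where y': "y = pr True u p q" "walk True u p v" "walk False u q v"
    by (rule X_cases[OF y, of True]) simp
  then show ?thesis
    using l y by (cases p rule: rev_cases; cases q rule: rev_cases) (auto simp: linkL_def in_X walk_snoc)
qed

lemma linkR_X: "linkR x y \<Longrightarrow> x \<in> X \<and> y \<in> X"
proof -
  assume l: "linkR x y"
  then have y: "y \<in> X" by (simp add: linkR_def)
  obtain u p q v where y': "y = pr True u p q" "walk True u p v" "walk False u q v"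
    by (rule X_cases[OF y, of True]) simp
  then show ?thesis
    using l y by (cases p; cases q) (auto simp: linkR_def in_X walk_Cons)
qed

lemma sign_link: "linkL x y \<Longrightarrow> sign y = - sign x" "linkR x y \<Longrightarrow> sign y = - sign x"
proof -
  have n: "(- 1) ^ n = - ((- 1 :: 'k) ^ (n - Suc 0))" if "n > 0" for n
    using that by (cases n) auto
  show "linkL x y \<Longrightarrow> sign y = - sign x" "linkR x y \<Longrightarrow> sign y = - sign x"
    using n[of "length (snd (fst y))"]
    by (cases y rule: shareL.cases; force simp: linkL_def linkR_def sign_def deg_def)+
qed

lemma finite_link: "x \<in> X \<Longrightarrow> finite {y. linkL x y}" "x \<in> X \<Longrightarrow> finite {y. linkR x y}"
proof -
  assume "x \<in> X"
  then obtain u p q v where x: "x = pr True u p q" by (rule X_cases[of _ True])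
  have "{y. linkL x y} \<subseteq> (\<lambda>b. pr True u (p @ [b]) (q @ [b])) ` arcs Q"
    "{y. linkR x y} \<subseteq> (\<lambda>a. pr True (tail Q a) (a # p) (a # q)) ` arcs Q"
    by (auto simp: x linkL_pr linkR_pr)
  then show "finite {y. linkL x y}" "finite {y. linkR x y}"
    using finite_subset finite_arcs by blast+
qed

lemma d_basis:
  assumes x: "x \<in> X"
  shows "d (basis x) = (\<Sum>y | linkL x y. basis y) - scale (sign x) (\<Sum>y | linkR x y. basis y)"
proof -
  obtain u p q v where x': "x = pr True u p q" "walk True u p v" "walk False u q v"
    by (rule X_cases[OF x, of True]) simp
  have "arrows_sum \<star> basis x = (\<Sum>b\<in>arcs Q. if pr True u (p @ [b]) (q @ [b]) \<in> X
      then basis (pr True u (p @ [b]) (q @ [b])) else 0)"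
    unfolding arrows_sum_def bilinear_simps
  proof (rule sum.cong)
    fix b assume b: "b \<in> arcs Q"
    have "pr True u (p @ [b]) (q @ [b]) \<in> X \<Longrightarrow> tail Q b = v"
      using x'(2) walk_target_unique by (auto simp: in_X walk_snoc)
    then show "basis (pr True (tail Q b) [b] [b]) \<star> basis x = (if pr True u (p @ [b]) (q @ [b]) \<in> X
      then basis (pr True u (p @ [b]) (q @ [b])) else 0)"
      using cup_basis_True[of "tail Q b" "[b]" "head Q b" "[b]", OF _ _ x'(2,3)] b x'(1) by auto
  qed simp
  also have "\<dots> = (\<Sum>b\<in>{b \<in> arcs Q. pr True u (p @ [b]) (q @ [b]) \<in> X}. basis (pr True u (p @ [b]) (q @ [b])))"
    by (simp add: sum.inter_filter)
  also have "\<dots> = (\<Sum>y | linkL x y. basis y)"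
    by (rule sum.reindex_bij_betw) (auto simp: bij_betw_def inj_on_def pr_eq_iff x' linkL_pr)
  finally have 1: "arrows_sum \<star> basis x = (\<Sum>y | linkL x y. basis y)" .
  have "basis x \<star> arrows_sum = (\<Sum>a\<in>arcs Q. if head Q a = u \<and> pr True (tail Q a) (a # p) (a # q) \<in> X
      then basis (pr True (tail Q a) (a # p) (a # q)) else 0)"
    unfolding arrows_sum_def bilinear_simps
  proof (rule sum.cong)
    fix a assume a: "a \<in> arcs Q"
    then show "basis x \<star> basis (pr True (tail Q a) [a] [a]) =
      (if head Q a = u \<and> pr True (tail Q a) (a # p) (a # q) \<in> X
      then basis (pr True (tail Q a) (a # p) (a # q)) else 0)"
      using cup_basis_True[OF x'(2,3), of "tail Q a" "[a]" "head Q a" "[a]"] x'(1) by auto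
  qed simp
  also have "\<dots> = (\<Sum>a\<in>{a \<in> arcs Q. head Q a = u \<and> pr True (tail Q a) (a # p) (a # q) \<in> X}.
      basis (pr True (tail Q a) (a # p) (a # q)))"
    by (simp add: sum.inter_filter)
  also have "\<dots> = (\<Sum>y | linkR x y. basis y)"
    by (rule sum.reindex_bij_betw) (auto simp: bij_betw_def inj_on_def pr_eq_iff x' linkR_pr)
  finally have 2: "basis x \<star> arrows_sum = (\<Sum>y | linkR x y. basis y)" .
  show ?thesis
    using x by (simp add: d_eq_commutator bilinear_simps 1 2)
qed

text \<open>Dual to \<open>d_basis\<close>: a pair receives from at most one shorter pair at each
  end, even where the shorter pair has many prolongations. The plus sign is \<open>- sign x\<close>
  for the chopped pair \<open>x\<close>, whose degree is one lower.\<close>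

lemma lookup_d:
  assumes f: "f \<in> kspace X" and y: "y \<in> X"
  shows "Poly_Mapping.lookup (d f) y =
    (if shareL y then Poly_Mapping.lookup f (chopL y) else 0)
    + sign y * (if shareR y then Poly_Mapping.lookup f (chopR y) else 0)"
proof -
  let ?l = Poly_Mapping.lookup
  have b: "?l (d (basis x)) y = (if linkL x y then 1 else 0) + sign y * (if linkR x y then 1 else 0)"
    if "x \<in> X" for x
    using that sign_link(2)[of x y] finite_link[of x]
    by (simp add: d_basis lookup_minus lookup_sum lookup_basis)
  have "?l (d f) y = (\<Sum>x\<in>Poly_Mapping.keys f. ?l f x * ?l (d (basis x)) y)"
    by (subst klinear_expand[OF klinear_d]) (rule lookup_linear_ext)
  also have "\<dots> = (\<Sum>x\<in>Poly_Mapping.keys f. (if linkL x y then ?l f x else 0)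
      + sign y * (if linkR x y then ?l f x else 0))"
    by (rule sum.cong) (use f b in \<open>auto simp: kspace_def subset_iff algebra_simps\<close>)
  also have "\<dots> = (\<Sum>x\<in>Poly_Mapping.keys f. if linkL x y then ?l f x else 0)
      + sign y * (\<Sum>x\<in>Poly_Mapping.keys f. if linkR x y then ?l f x else 0)"
    by (simp add: sum.distrib sum_distrib_left)
  also have "(\<Sum>x\<in>Poly_Mapping.keys f. if linkL x y then ?l f x else 0)
      = (\<Sum>x\<in>Poly_Mapping.keys f. if chopL y = x then (if shareL y then ?l f x else 0) else 0)"
    by (rule sum.cong) (use y in \<open>auto simp: linkL_def\<close>)
  also have "\<dots> = (if shareL y then ?l f (chopL y) else 0)"
    by (simp add: in_keys_iff)
  also have "(\<Sum>x\<in>Poly_Mapping.keys f. if linkR x y then ?l f x else 0)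
      = (\<Sum>x\<in>Poly_Mapping.keys f. if chopR y = x then (if shareR y then ?l f x else 0) else 0)"
    by (rule sum.cong) (use y in \<open>auto simp: linkR_def\<close>)
  also have "\<dots> = (if shareR y then ?l f (chopR y) else 0)"
    by (simp add: in_keys_iff)
  finally show ?thesis .
qed

text \<open>Neither half of the differential reaches such a pair, so its coefficient is a functional
  on cohomology.\<close>

lemma lookup_Bd_unshared:
  "f \<in> Bd \<Longrightarrow> y \<in> X \<Longrightarrow> \<not> shareL y \<Longrightarrow> \<not> shareR y \<Longrightarrow> Poly_Mapping.lookup f y = 0"
  by (auto simp: coboundaries_def lookup_d)

end

section \<open>Special pairs and the splitting of the cochain complex\<close>

context gentle
begin

lemmas [simp del] = split_paired_All split_paired_Ex

text \<open>
  The pairs on which the two ends of the differential interact: both components trivial, a cycle whose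
  square is again admissible against a vertex, and the images of the latter.
\<close>

definition special :: "('v, 'a) path \<times> ('v, 'a) path \<Rightarrow> bool" where
  "special x \<longleftrightarrow> (\<exists>u p q. x = pr True u p q \<and>
     (q = [] \<and> (p = [] \<or> st True (last p) (hd p)) \<or> p = [] \<and> (q = [] \<or> st False (last q) (hd q)) \<or>
      (\<exists>c. q = [c] \<and> p \<noteq> [] \<and> hd p = c \<and> last p = c) \<or>
      (\<exists>c. p = [c] \<and> q \<noteq> [] \<and> hd q = c \<and> last q = c)))"

lemma special_pr: "special (pr s u p q) \<longleftrightarrow>
    q = [] \<and> (p = [] \<or> st s (last p) (hd p)) \<or> p = [] \<and> (q = [] \<or> st (\<not> s) (last q) (hd q)) \<or>
    (\<exists>c. q = [c] \<and> p \<noteq> [] \<and> hd p = c \<and> last p = c) \<or>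
    (\<exists>c. p = [c] \<and> q \<noteq> [] \<and> hd q = c \<and> last q = c)"
proof (cases s)
  case True
  then show ?thesis by (auto simp: special_def pr_eq_iff)
next
  case False
  have "pr s u p q = pr True u q p" using False by (simp add: pr_def)
  then show ?thesis using False by (auto simp: special_def pr_eq_iff)
qed

text \<open>The prolonging arrow \<open>b\<close> is the unique successor within a nonempty
  component, so that component closes up to a cycle exactly if \<open>b\<close> is its first arrow.
  Together with \<open>special_linkR\<close> this lets \<open>d\<close> respect the splitting into
  special pairs and the others.\<close>

lemma special_linkL:
  assumes "linkL x y" shows "special x \<longleftrightarrow> special y"
proof -
  have x: "x \<in> X" and y: "y \<in> X" using linkL_X[OF assms] by auto
  obtain u p q v where x': "x = pr True u p q" "walk True u p v" "walk False u q v"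
    by (rule X_cases[OF x, of True]) simp
  obtain b where b: "y = pr True u (p @ [b]) (q @ [b])"
    using assms by (auto simp: x' linkL_pr)
  have "p \<noteq> [] \<Longrightarrow> st True (last p) b" "q \<noteq> [] \<Longrightarrow> st False (last q) b"
    using y by (auto simp: b in_X walk_snoc)
  then show ?thesis
    unfolding x' b special_pr
    by (cases "p = []"; cases "q = []") (auto dest: st_succ_unique st_excl)
qed

lemma special_linkR:
  assumes "linkR x y" shows "special x \<longleftrightarrow> special y"
proof -
  have x: "x \<in> X" and y: "y \<in> X" using linkR_X[OF assms] by auto
  obtain u p q v where x': "x = pr True u p q" "walk True u p v" "walk False u q v"
    by (rule X_cases[OF x, of True]) simp
  obtain a where a: "y = pr True (tail Q a) (a # p) (a # q)"
    using assms by (auto simp: x' linkR_pr)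
  have "p \<noteq> [] \<Longrightarrow> st True a (hd p)" "q \<noteq> [] \<Longrightarrow> st False a (hd q)"
    using y by (auto simp: a in_X walk_Cons)
  then show ?thesis
    unfolding x' a special_pr
    by (cases "p = []"; cases "q = []") (auto dest: st_pred_unique st_excl)
qed

abbreviation "Y \<equiv> {x \<in> X. \<not> special x}"

lemma Y_cases:
  assumes "x \<in> Y"
  obtains u p q v where "x = pr True u p q" "walk True u p v" "walk False u q v"
    "p \<noteq> [] \<or> q \<noteq> []" "p = [] \<longrightarrow> \<not> st False (last q) (hd q)" "q = [] \<longrightarrow> \<not> st True (last p) (hd p)"
proof -
  have x: "x \<in> X" and ns: "\<not> special x" using assms by auto
  obtain u p q v where "x = pr True u p q" "walk True u p v" "walk False u q v"
    by (rule X_cases[OF x, of True]) simp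
  then show thesis using that ns by (simp add: special_pr)
qed

text \<open>A pair in \<open>Y\<close> has a nonempty component, whose end arrow determines the
  prolonging one. A pair of two trivial paths is linked to \<open>(b, b)\<close> for every arrow
  \<open>b\<close> at its vertex, so it has to be kept out of \<open>Y\<close>.\<close>

lemma link_functional:
  assumes x: "x \<in> Y"
  shows "linkL x y \<Longrightarrow> linkL x z \<Longrightarrow> y = z" "linkR x y \<Longrightarrow> linkR x z \<Longrightarrow> y = z"
proof -
  obtain u p q v where x': "x = pr True u p q" "p \<noteq> [] \<or> q \<noteq> []"
    by (rule Y_cases[OF x]) blast
  have "st True (last p) b \<Longrightarrow> st True (last p) c \<Longrightarrow> b = c"
    "st False (last q) b \<Longrightarrow> st False (last q) c \<Longrightarrow> b = c"
    "st True b (hd p) \<Longrightarrow> st True c (hd p) \<Longrightarrow> b = c"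
    "st False b (hd q) \<Longrightarrow> st False c (hd q) \<Longrightarrow> b = c" for b c
    using st_succ_unique st_pred_unique by blast+
  note * = this
  show "y = z" if yz: "linkL x y" "linkL x z"
  proof -
    obtain b c where "y = pr True u (p @ [b]) (q @ [b])" "z = pr True u (p @ [c]) (q @ [c])" "y \<in> X" "z \<in> X"
      using yz unfolding x'(1) linkL_pr by blast
    then show ?thesis
      using x'(2) *(1,2)[of b c] by (auto simp: in_X walk_snoc)
  qed
  show "y = z" if yz: "linkR x y" "linkR x z"
  proof -
    obtain b c where "y = pr True (tail Q b) (b # p) (b # q)" "z = pr True (tail Q c) (c # p) (c # q)"
        "y \<in> X" "z \<in> X"
      using yz unfolding x'(1) linkR_pr by blast
    then show ?thesis
      using x'(2) *(3,4)[of b c] by (auto simp: in_X walk_Cons)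
  qed
qed

lemma link_square:
  assumes x: "x \<in> Y" and L: "linkL x y" and R: "linkR x z"
  shows "\<exists>w. linkL z w \<and> linkR y w"
proof -
  obtain u p q v where x': "x = pr True u p q" "walk True u p v" "walk False u q v" "p \<noteq> [] \<or> q \<noteq> []"
    "p = [] \<longrightarrow> \<not> st False (last q) (hd q)" "q = [] \<longrightarrow> \<not> st True (last p) (hd p)"
    by (rule Y_cases[OF x]) blast
  obtain b where b: "b \<in> arcs Q" "y = pr True u (p @ [b]) (q @ [b])" "y \<in> X"
    using L unfolding x'(1) linkL_pr by blast
  obtain a where a: "a \<in> arcs Q" "head Q a = u" "z = pr True (tail Q a) (a # p) (a # q)" "z \<in> X"
    using R unfolding x'(1) linkR_pr by blast
  have lb: "p \<noteq> [] \<Longrightarrow> st True (last p) b" "q \<noteq> [] \<Longrightarrow> st False (last q) b" "tail Q b = v"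
    using b walk_target_unique[OF x'(2), of True "tail Q b"] by (auto simp: in_X walk_snoc)
  have fa: "p \<noteq> [] \<Longrightarrow> st True a (hd p)" "q \<noteq> [] \<Longrightarrow> st False a (hd q)"
    using a by (auto simp: in_X walk_Cons)
  \<comment> \<open>Only at a trivial component do \<open>a\<close> and \<open>b\<close> become
    adjacent. If they did not fit there, they would fit on the other side, so \<open>b\<close> would
    be the first arrow of \<open>q\<close> and \<open>q\<close> would close up to a cycle, making
    the pair special.\<close>
  have ab: "st True a b" if "p = []"
    using that x' lb(2,3) fa(2) a(1,2) b(1) st_cases[of a b True] st_succ_unique[of False a b "hd q"] by auto
  have ba: "st False a b" if "q = []"
    using that x' lb(1,3) fa(1) a(1,2) b(1) st_cases[of a b False] st_succ_unique[of True a b "hd p"] by auto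
  define w where "w = pr True (tail Q a) (a # p @ [b]) (a # q @ [b])"
  have w: "w \<in> X"
    using x'(2,3) a(1,2) b(1) lb fa ab ba
    by (auto simp: w_def in_X walk_Cons walk_snoc hd_append)
  moreover have "linkL z w"
    using w b(1) unfolding a(3) linkL_pr by (auto simp: w_def)
  moreover have "linkR y w"
    using w a(1,2) unfolding b(2) linkR_pr by (auto simp: w_def)
  ultimately show ?thesis by blast
qed

lemma chop_suffix:
  assumes "linkL y x" "linkR x z"
  shows "\<exists>w. linkR y w \<and> linkL w z"
proof -
  have y: "y \<in> X" using linkL_X[OF assms(1)] by simp
  obtain u p q v where y': "y = pr True u p q" "walk True u p v" "walk False u q v"
    by (rule X_cases[OF y, of True]) simp
  obtain b where b: "b \<in> arcs Q" "x = pr True u (p @ [b]) (q @ [b])"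
    using assms(1) unfolding y' linkL_pr by blast
  obtain a where a: "a \<in> arcs Q" "head Q a = u" "z = pr True (tail Q a) (a # p @ [b]) (a # q @ [b])" "z \<in> X"
    using assms(2) unfolding b linkR_pr by auto
  define w where "w = pr True (tail Q a) (a # p) (a # q)"
  have "w \<in> X"
    using a(4) y'(2,3) by (cases p; cases q) (auto simp: a(2,3) w_def in_X walk_Cons walk_snoc)
  then have "linkR y w" "linkL w z"
    using a b by (auto simp: w_def y' linkR_pr linkL_pr)
  then show ?thesis by blast
qed

text \<open>If a component of \<open>x\<close> were trivial, the shared last arrow would be the new
  arrow \<open>a\<close>, and the other component would close up to a cycle. So both are nonempty,
  and the last arrow was shared before \<open>a\<close> was added.\<close>

lemma chop_both:
  assumes x: "x \<in> Y" and R: "linkR x z" and L: "linkL w z"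
  shows "\<exists>y. linkL y x"
proof -
  obtain u p q v where x': "x = pr True u p q" "walk True u p v" "walk False u q v" "p \<noteq> [] \<or> q \<noteq> []"
    "p = [] \<longrightarrow> \<not> st False (last q) (hd q)" "q = [] \<longrightarrow> \<not> st True (last p) (hd p)"
    by (rule Y_cases[OF x]) blast
  obtain a where a: "z = pr True (tail Q a) (a # p) (a # q)" "z \<in> X"
    using R unfolding x'(1) linkR_pr by blast
  have fa: "p \<noteq> [] \<Longrightarrow> st True a (hd p)" "q \<noteq> [] \<Longrightarrow> st False a (hd q)"
    using a by (auto simp: in_X walk_Cons)
  have "last (a # p) = last (a # q)"
    using L by (simp add: linkL_def a)
  then have "p \<noteq> [] \<and> q \<noteq> [] \<and> last p = last q"
    using x'(4,5,6) fa by (auto split: if_splits)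
  then have "linkL (chopL x) x"
    using x by (auto simp: linkL_def x'(1))
  then show ?thesis by blast
qed

lemma link_restrict:
  assumes x: "x \<in> Y" and R: "linkR x z" and L: "linkL z w"
  shows "\<exists>y. linkL x y"
proof -
  obtain u p q v where x': "x = pr True u p q" "walk True u p v" "walk False u q v"
    by (rule Y_cases[OF x]) blast
  obtain a where a: "z = pr True (tail Q a) (a # p) (a # q)" "head Q a = u"
    using R unfolding x'(1) linkR_pr by blast
  obtain b where b: "b \<in> arcs Q" "w = pr True (tail Q a) (a # p @ [b]) (a # q @ [b])" "w \<in> X"
    using L unfolding a linkL_pr by auto
  have "pr True u (p @ [b]) (q @ [b]) \<in> X"
    using b(2,3) a(2) by (auto simp: in_X walk_Cons)
  then show ?thesis
    using b(1) unfolding x'(1) linkL_pr by blast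
qed

text \<open>As in \<open>arrows_sum_sq\<close>, two arrows added at the same end would have to form
  a relation and not form one.\<close>

lemma link_square_zero: "linkL x y \<Longrightarrow> \<not> linkL y z" "linkR x y \<Longrightarrow> \<not> linkR y z"
proof -
  have 1: False if L: "linkL x y" "linkL y z"
  proof -
    obtain u p q where x: "x = pr True u p q"
      using linkL_X[OF L(1)] by (metis X_cases)
    obtain b where b: "y = pr True u (p @ [b]) (q @ [b])"
      using L(1) unfolding x linkL_pr by blast
    obtain c where "pr True u (p @ [b, c]) (q @ [b, c]) \<in> X"
      using L(2) unfolding b linkL_pr by auto
    then show False
      by (auto simp: in_X walk_append walk_Cons dest: st_excl)
  qed
  have 2: False if R: "linkR x y" "linkR y z"
  proof -
    obtain u p q where x: "x = pr True u p q"
      using linkR_X[OF R(1)] by (metis X_cases)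
    obtain b where b: "y = pr True (tail Q b) (b # p) (b # q)"
      using R(1) unfolding x linkR_pr by blast
    obtain c where "pr True (tail Q c) (c # b # p) (c # b # q) \<in> X"
      using R(2) unfolding b linkR_pr by auto
    then show False
      by (auto simp: in_X walk_Cons dest: st_excl)
  qed
  show "linkL x y \<Longrightarrow> \<not> linkL y z" "linkR x y \<Longrightarrow> \<not> linkR y z"
    using 1 2 by blast+
qed

sublocale sq: square_complex Y linkL linkR sign d
proof
  fix x y z w
  show "linkL x z \<Longrightarrow> linkL y z \<Longrightarrow> x = y" "linkR x z \<Longrightarrow> linkR y z \<Longrightarrow> x = y"
    by (auto simp: linkL_def linkR_def)
  show "linkL x y \<Longrightarrow> x \<in> Y \<longleftrightarrow> y \<in> Y" "linkR x y \<Longrightarrow> x \<in> Y \<longleftrightarrow> y \<in> Y"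
    using special_linkL[of x y] special_linkR[of x y] linkL_X[of x y] linkR_X[of x y] by blast+
  have L: "{y. linkL x y} = {y}" if "x \<in> Y" "linkL x y" for x y
    using that link_functional by blast
  have R: "{y. linkR x y} = {y}" if "x \<in> Y" "linkR x y" for x y
    using that link_functional by blast
  show "x \<in> Y \<Longrightarrow> linkL x y \<Longrightarrow> linkR x z \<Longrightarrow> d (basis x) = basis y - scale (sign x) (basis z)"
    using L[of x y] R[of x z] d_basis[of x] by simp
  show "x \<in> Y \<Longrightarrow> linkL x y \<Longrightarrow> \<nexists>z. linkR x z \<Longrightarrow> d (basis x) = basis y"
    using L[of x y] d_basis[of x] by simp
  show "x \<in> Y \<Longrightarrow> \<nexists>y. linkL x y \<Longrightarrow> linkR x z \<Longrightarrow> d (basis x) = - scale (sign x) (basis z)"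
    using R[of x z] d_basis[of x] by simp
  show "x \<in> Y \<Longrightarrow> \<nexists>y. linkL x y \<Longrightarrow> \<nexists>z. linkR x z \<Longrightarrow> d (basis x) = 0"
    using d_basis[of x] by simp
  show "klinear d" by (rule klinear_d)
  show "x \<in> Y \<Longrightarrow> linkL x y \<Longrightarrow> linkL x z \<Longrightarrow> y = z" by (rule link_functional(1))
  show "x \<in> Y \<Longrightarrow> linkR x y \<Longrightarrow> linkR x z \<Longrightarrow> y = z" by (rule link_functional(2))
  show "linkL x y \<Longrightarrow> \<not> linkL y z" by (rule link_square_zero(1))
  show "linkR x y \<Longrightarrow> \<not> linkR y z" by (rule link_square_zero(2))
  show "x \<in> Y \<Longrightarrow> linkL x y \<Longrightarrow> linkR x z \<Longrightarrow> \<exists>w. linkL z w \<and> linkR y w" by (rule link_square)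
  show "linkL y x \<Longrightarrow> linkR x z \<Longrightarrow> \<exists>w. linkR y w \<and> linkL w z" by (rule chop_suffix)
  show "x \<in> Y \<Longrightarrow> linkR x z \<Longrightarrow> linkL w z \<Longrightarrow> \<exists>y. linkL y x" by (rule chop_both)
  show "x \<in> Y \<Longrightarrow> linkR x z \<Longrightarrow> linkL z w \<Longrightarrow> \<exists>y. linkL x y" by (rule link_restrict)
  show "linkL x y \<Longrightarrow> sign y = - sign x" by (rule sign_link(1))
  show "linkR x y \<Longrightarrow> sign y = - sign x" by (rule sign_link(2))
  show "sign x * sign x = 1" by (rule sign_sq)
qed

abbreviation "NN \<equiv> sq.isolated"

lemma NN_X: "x \<in> NN \<Longrightarrow> x \<in> X"
  by (simp add: sq.isolated_def)

lemma NN_not_share: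
  assumes "x \<in> NN" shows "\<not> shareL x" "\<not> shareR x"
  using assms by (auto simp: sq.isolated_def linkL_def linkR_def)

lemma NN_not_special: "x \<in> NN \<Longrightarrow> \<not> special x"
  by (simp add: sq.isolated_def)

text \<open>Let \<open>b\<close> prolong \<open>p\<close>. The other component ends with a different
  arrow, or is trivial, and by uniqueness of predecessors this arrow is not followed by
  \<open>b\<close> on the side of \<open>s\<close>; hence it is on the other side. So
  \<open>b\<close> prolongs both components and the pair has a link. The same holds at the
  beginning.\<close>

lemma NN_no_extension:
  assumes x: "pr s u p q \<in> NN" and p: "p \<noteq> []"
  shows "\<not> st s (last p) b" "\<not> st s a (hd p)"
proof -
  obtain v where w: "walk s u p v" "walk (\<not> s) u q v"
    using NN_X[OF x] by (auto simp: in_X)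
  have ns: "q \<noteq> [] \<Longrightarrow> last p \<noteq> last q" "q \<noteq> [] \<Longrightarrow> hd p \<noteq> hd q"
    using NN_not_share[OF x] p by auto
  have nl: "\<not> linkL (pr s u p q) y" "\<not> linkR (pr s u p q) y" for y
    using x by (auto simp: sq.isolated_def)
  show "\<not> st s (last p) b"
  proof
    assume b: "st s (last p) b"
    have v: "v = tail Q b" using b walk_target[OF w(1) p] by (simp add: st_def)
    have "st (\<not> s) (last q) b" if "q \<noteq> []"
      using st_cases[of "last q" b s] walk_target[OF w(2) that] v b ns(1)[OF that] walk_arcs[OF w(2)]
        last_in_set[OF that] st_pred_unique[of s "last q" b "last p"] by (auto simp: st_def)
    then have "pr s u (p @ [b]) (q @ [b]) \<in> X"
      using w b v by (auto simp: in_X walk_snoc st_def)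
    then show False
      using nl(1)[of "pr s u (p @ [b]) (q @ [b])"] st_arcs[OF b] unfolding linkL_pr by blast
  qed
  show "\<not> st s a (hd p)"
  proof
    assume a: "st s a (hd p)"
    have u: "u = head Q a" using a walk_source[OF w(1) p] by (simp add: st_def)
    have "st (\<not> s) a (hd q)" if "q \<noteq> []"
      using st_cases[of a "hd q" s] walk_source[OF w(2) that] u a ns(2)[OF that] walk_arcs[OF w(2)]
        hd_in_set[OF that] st_succ_unique[of s a "hd q" "hd p"] by (auto simp: st_def)
    then have "pr s (tail Q a) (a # p) (a # q) \<in> X"
      using w a u p by (auto simp: in_X walk_Cons st_def)
    then show False
      using nl(2)[of "pr s (tail Q a) (a # p) (a # q)"] st_arcs[OF a] u unfolding linkR_pr by blast
  qed
qed

lemma NN_I: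
  assumes X: "pr s u p q \<in> X" and p: "p \<noteq> []"
    and ext: "\<And>b. \<not> st s (last p) b" "\<And>a. \<not> st s a (hd p)"
    and ns: "q \<noteq> [] \<Longrightarrow> last p \<noteq> last q" "q \<noteq> [] \<Longrightarrow> hd p \<noteq> hd q"
  shows "pr s u p q \<in> NN"
proof -
  have "\<not> special (pr s u p q)"
    using p ext ns by (auto simp: special_pr)
  moreover have "\<not> linkL (pr s u p q) y" "\<not> linkR (pr s u p q) y" for y
    using p ext by (auto simp: linkL_pr linkR_pr in_X walk_snoc walk_Cons)
  moreover have "\<not> linkL y (pr s u p q)" "\<not> linkR y (pr s u p q)" for y
    using ns by (auto simp: linkL_def linkR_def)
  ultimately show ?thesis
    using X by (simp add: sq.isolated_def)
qed

text \<open>The differentials of the two parts of \<open>f\<close> have disjoint supports, so each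
  part is a cocycle by itself; squares are cancelled in the first one only.\<close>

lemma split_special:
  assumes f: "f \<in> Z"
  obtains g e r where "g \<in> kspace X" "e \<in> kspace NN" "r \<in> kspace {x \<in> X. special x}"
    "f = d g + e + r" "d r = 0"
proof -
  let ?res = "\<lambda>A. linear_ext (\<lambda>x. if x \<in> A then basis x else 0 :: ('v, 'a, 'k) cochain)"
  let ?S = "{x \<in> X. special x}"
  have res: "?res A f \<in> kspace A" for A f
    by (rule klinear_memI[OF klinear_linear_ext ksubspace_kspace, of _ UNIV]) (auto simp: kspace_def)
  define f1 where "f1 = ?res Y f"
  define f2 where "f2 = ?res ?S f"
  have fX: "f \<in> kspace X" using f by (simp add: Z_iff)
  have sum: "f = f1 + f2"
    unfolding f1_def f2_def
    by (rule klinear_eqI[OF klinear_id klinear_add[OF klinear_linear_ext klinear_linear_ext] fX]) auto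
  have dY: "d f1 \<in> kspace Y"
  proof (rule klinear_memI[OF klinear_d ksubspace_kspace])
    fix x assume "x \<in> Y"
    then have *: "\<And>y. linkL x y \<Longrightarrow> y \<in> Y" "\<And>y. linkR x y \<Longrightarrow> y \<in> Y" "x \<in> X"
      using sq.L_Y sq.R_Y by blast+
    show "d (basis x) \<in> kspace Y"
      unfolding d_basis[OF *(3)]
      by (intro kspace_intros(5) kspace_intros(3) ksubspace_sum[OF ksubspace_kspace])
        (simp_all only: mem_Collect_eq[of _ "linkL x"] mem_Collect_eq[of _ "linkR x"] basis_in_kspace *)
  qed (unfold f1_def, rule res)
  have dS: "d f2 \<in> kspace ?S"
  proof (rule klinear_memI[OF klinear_d ksubspace_kspace])
    fix x assume "x \<in> ?S"
    then have *: "\<And>y. linkL x y \<Longrightarrow> y \<in> ?S" "\<And>y. linkR x y \<Longrightarrow> y \<in> ?S" "x \<in> X"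
      using special_linkL special_linkR linkL_X linkR_X by blast+
    show "d (basis x) \<in> kspace ?S"
      unfolding d_basis[OF *(3)]
      by (intro kspace_intros(5) kspace_intros(3) ksubspace_sum[OF ksubspace_kspace])
        (simp_all only: mem_Collect_eq[of _ "linkL x"] mem_Collect_eq[of _ "linkR x"] basis_in_kspace *)
  qed (unfold f2_def, rule res)
  have z: "d f1 + d f2 = 0"
    using f sum klinearD(1)[OF klinear_d] by (simp add: Z_iff)
  have "Poly_Mapping.lookup (d f1) x = 0" for x
  proof (cases "x \<in> Y")
    case True
    then have "Poly_Mapping.lookup (d f2) x = 0" using kspace_lookup[OF dS] by auto
    then show ?thesis using arg_cong[OF z, of "\<lambda>g. Poly_Mapping.lookup g x"] by (simp add: lookup_add)
  qed (use kspace_lookup[OF dY] in auto)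
  then have d1: "d f1 = 0" by (intro poly_mapping_eqI) simp
  obtain g e where g: "g \<in> kspace Y" "e \<in> kspace NN" "f1 = d g + e"
    by (rule sq.cocycle_decomposition[OF _ d1]) (unfold f1_def, rule res)
  show thesis
  proof (rule that)
    show "g \<in> kspace X" using g(1) by (rule kspace_mono[rotated]) blast
    show "e \<in> kspace NN" by (rule g(2))
    show "f2 \<in> kspace ?S" unfolding f2_def by (rule res)
    show "f = d g + e + f2" by (subst sum, subst g(3)) (rule refl)
    show "d f2 = 0" using z d1 by simp
  qed
qed

end

section \<open>Cyclic arrows and their orbits\<close>

context gentle
begin

text \<open>The arrows that lie on a cycle of the relation \<open>st s\<close>. Successors and
  predecessors being unique, \<open>nx s\<close> permutes this set, and its orbits are the primitive
  complete circuits for \<open>True\<close> and the primitive cocomplete ones for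
  \<open>False\<close>. For an arrow without successor the value of \<open>nx\<close> is
  arbitrary.\<close>

definition per :: "bool \<Rightarrow> 'a set" where
  "per s = {a. (a, a) \<in> {(x, y). st s x y}\<^sup>+}"

definition nx :: "bool \<Rightarrow> 'a \<Rightarrow> 'a" where
  "nx s a = (THE b. st s a b)"

definition prd :: "bool \<Rightarrow> 'a \<Rightarrow> nat" where
  "prd s a = (LEAST m. m \<ge> 1 \<and> (nx s ^^ m) a = a)"

definition orb :: "bool \<Rightarrow> 'a \<Rightarrow> 'a set" where
  "orb s a = range (\<lambda>i. (nx s ^^ i) a)"

definition ol :: "bool \<Rightarrow> 'a \<Rightarrow> nat \<Rightarrow> 'a list" where
  "ol s a m = map (\<lambda>i. (nx s ^^ i) a) [0..<m]"

definition closed :: "bool \<Rightarrow> 'a \<Rightarrow> nat \<Rightarrow> bool" where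
  "closed s a m \<longleftrightarrow> a \<in> per s \<and> m > 0 \<and> (nx s ^^ m) a = a"

lemma st_nx: "st s a b \<Longrightarrow> nx s a = b"
  unfolding nx_def using st_succ_unique by blast

lemma per_nx: assumes "a \<in> per s" shows "st s a (nx s a)" "nx s a \<in> per s"
proof -
  obtain b where b: "st s a b" "(b, a) \<in> {(x, y). st s x y}\<^sup>*"
    using assms by (auto simp: per_def dest: tranclD)
  have nb: "nx s a = b" using b(1) by (rule st_nx)
  then show "st s a (nx s a)" using b by simp
  have "(b, b) \<in> {(x, y). st s x y}\<^sup>+"
    using b by (auto intro: rtrancl_into_trancl1)
  then show "nx s a \<in> per s" using nb by (simp add: per_def)
qed

lemma per_arcs: "a \<in> per s \<Longrightarrow> a \<in> arcs Q"
  using per_nx(1) st_arcs by blast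

lemma head_per: "a \<in> per s \<Longrightarrow> head Q a = tail Q (nx s a)"
  using per_nx(1) st_arcs by blast

lemma funpow_nx_per: "a \<in> per s \<Longrightarrow> (nx s ^^ i) a \<in> per s"
  by (induction i) (auto simp: per_nx)

lemma nx_inj: "a \<in> per s \<Longrightarrow> b \<in> per s \<Longrightarrow> nx s a = nx s b \<Longrightarrow> a = b"
  using per_nx(1) st_pred_unique by metis

lemma funpow_nx_inj: "a \<in> per s \<Longrightarrow> b \<in> per s \<Longrightarrow> (nx s ^^ i) a = (nx s ^^ i) b \<Longrightarrow> a = b"
  by (induction i) (auto dest: nx_inj[rotated 2] simp: funpow_nx_per)

lemma trancl_funpow: "(a, b) \<in> {(x, y). st s x y}\<^sup>+ \<Longrightarrow> \<exists>m\<ge>1. (nx s ^^ m) a = b"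
proof (induction rule: trancl_induct)
  case (base y)
  then show ?case using st_nx by (intro exI[of _ 1]) auto
next
  case (step y z)
  then obtain m where "m \<ge> 1" "(nx s ^^ m) a = y" by blast
  then show ?case using step(2) st_nx by (intro exI[of _ "Suc m"]) auto
qed

lemma prd: assumes "a \<in> per s" shows "prd s a \<ge> 1" "(nx s ^^ prd s a) a = a"
proof -
  have "\<exists>m. m \<ge> 1 \<and> (nx s ^^ m) a = a"
    using assms trancl_funpow[of a a s] by (auto simp: per_def)
  then have "prd s a \<ge> 1 \<and> (nx s ^^ prd s a) a = a"
    unfolding prd_def by (rule LeastI_ex)
  then show "prd s a \<ge> 1" "(nx s ^^ prd s a) a = a" by auto
qed

lemma prd_least: "m \<ge> 1 \<Longrightarrow> (nx s ^^ m) a = a \<Longrightarrow> prd s a \<le> m"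
  unfolding prd_def by (rule Least_le) simp

lemma fix_iff_dvd: assumes "a \<in> per s" shows "(nx s ^^ m) a = a \<longleftrightarrow> prd s a dvd m"
proof
  assume "(nx s ^^ m) a = a"
  then have "(nx s ^^ (m mod prd s a)) a = a"
    using funpow_mod_eq[OF prd(2)[OF assms], of m] by simp
  moreover have "m mod prd s a < prd s a" using prd(1)[OF assms] by simp
  ultimately have "m mod prd s a = 0"
    using prd_least[of "m mod prd s a" s a] by linarith
  then show "prd s a dvd m" by (simp add: dvd_eq_mod_eq_0)
next
  assume "prd s a dvd m"
  then have "m mod prd s a = 0" by simp
  then show "(nx s ^^ m) a = a"
    using funpow_mod_eq[OF prd(2)[OF assms], of m] by simp
qed

lemma closed_iff_dvd: "closed s a m \<longleftrightarrow> a \<in> per s \<and> m > 0 \<and> prd s a dvd m"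
  using fix_iff_dvd by (auto simp: closed_def)

lemma orb_self: "a \<in> orb s a"
  unfolding orb_def by (rule range_eqI[of _ _ 0]) simp

lemma orb_per: "a \<in> per s \<Longrightarrow> b \<in> orb s a \<Longrightarrow> b \<in> per s"
  by (auto simp: orb_def funpow_nx_per)

lemma orb_subset: "b \<in> orb s a \<Longrightarrow> orb s b \<subseteq> orb s a"
  by (auto simp: orb_def simp flip: funpow_add[THEN fun_cong, unfolded comp_apply])

lemma orb_eq: assumes "a \<in> per s" "b \<in> orb s a" shows "orb s b = orb s a"
proof
  show "orb s b \<subseteq> orb s a" using assms(2) by (rule orb_subset)
  obtain i where b: "b = (nx s ^^ i) a" using assms(2) by (auto simp: orb_def)
  \<comment> \<open>The \<open>i\<close> steps from \<open>a\<close> to \<open>b\<close> are undone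
    by going on until \<open>i\<close> full periods are completed.\<close>
  have "(nx s ^^ ((prd s a - 1) * i)) b = (nx s ^^ ((prd s a - 1) * i + i)) a"
    by (simp add: b funpow_add)
  also have "(prd s a - 1) * i + i = prd s a * i"
    using prd(1)[OF assms(1)] by (simp add: diff_mult_distrib)
  also have "(nx s ^^ (prd s a * i)) a = a"
    by (simp add: fix_iff_dvd[OF assms(1)])
  finally have "a \<in> orb s b" unfolding orb_def by (metis rangeI)
  then show "orb s a \<subseteq> orb s b" by (rule orb_subset)
qed

lemma nx_orb: "nx s a \<in> orb s a"
  unfolding orb_def by (rule range_eqI[of _ _ 1]) simp

lemma nx_orb_iff:
  assumes "a \<in> per s" "b \<in> per s" shows "nx s b \<in> orb s a \<longleftrightarrow> b \<in> orb s a"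
proof
  assume "nx s b \<in> orb s a"
  then have "orb s b = orb s a"
    using orb_eq[OF assms(1)] orb_eq[OF assms(2) nx_orb] by metis
  then show "b \<in> orb s a" using orb_self by blast
qed (use nx_orb orb_subset in blast)

lemma finite_orb: "a \<in> per s \<Longrightarrow> finite (orb s a)"
  using finite_subset[OF _ finite_arcs, of "orb s a"] orb_per per_arcs by blast

lemma bij_nx_orb: assumes "a \<in> per s" shows "bij_betw (nx s) (orb s a) (orb s a)"
proof -
  have "inj_on (nx s) (orb s a)"
    using assms nx_inj orb_per by (meson inj_onI)
  moreover have "nx s ` orb s a \<subseteq> orb s a"
    using nx_orb_iff[OF assms] orb_per[OF assms] by blast
  ultimately show ?thesis
    using endo_inj_surj[OF finite_orb[OF assms]] by (simp add: bij_betw_def)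
qed

lemma obtain_pred: assumes "a \<in> per s" obtains b where "b \<in> per s" "nx s b = a" "b \<in> orb s a"
proof -
  have "a \<in> nx s ` orb s a" using bij_nx_orb[OF assms] orb_self by (simp add: bij_betw_def)
  then show thesis using that orb_per[OF assms] by blast
qed

text \<open>A cycle cannot be entered from outside: the predecessor of \<open>a\<close> on its cycle
  is the only one it has.\<close>

lemma st_per: assumes "a \<in> per s" "st s c a" shows "c \<in> per s" "nx s c = a"
proof -
  obtain b where b: "b \<in> per s" "nx s b = a" by (rule obtain_pred[OF assms(1)])
  then have "c = b" using per_nx(1)[OF b(1)] assms(2) st_pred_unique by metis
  then show "c \<in> per s" "nx s c = a" using b by auto
qed

lemma closed_orb: assumes "closed s a m" "b \<in> orb s a" shows "closed s b m"
proof -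
  obtain i where "b = (nx s ^^ i) a" using assms(2) by (auto simp: orb_def)
  then have "(nx s ^^ m) b = (nx s ^^ i) ((nx s ^^ m) a)"
    by (simp flip: funpow_add[THEN fun_cong, unfolded comp_apply] add: add.commute)
  then show ?thesis
    using assms \<open>b = (nx s ^^ i) a\<close> by (simp add: closed_def funpow_nx_per)
qed

lemma closed_add: "closed s a m \<Longrightarrow> closed s a n \<Longrightarrow> closed s a (m + n)"
  by (simp add: closed_def funpow_add)

lemma closed_mult: "closed s a m \<Longrightarrow> n > 0 \<Longrightarrow> closed s a (n * m)"
  by (simp add: closed_iff_dvd)

lemma closed_nx: "closed s a m \<Longrightarrow> closed s (nx s a) m"
  using closed_orb nx_orb by blast

lemma closed_per: "closed s a m \<Longrightarrow> a \<in> per s"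
  by (simp add: closed_def)

lemma closed_pos: "closed s a m \<Longrightarrow> m > 0"
  by (simp add: closed_def)

lemma length_ol [simp]: "length (ol s a m) = m"
  by (simp add: ol_def)

lemma ol_0 [simp]: "ol s a 0 = []"
  by (simp add: ol_def)

lemma ol_eq_Nil [simp]: "ol s a m = [] \<longleftrightarrow> m = 0"
  by (simp add: ol_def)

lemma ol_snoc: "ol s a (Suc m) = ol s a m @ [(nx s ^^ m) a]"
  by (simp add: ol_def)

lemma ol_add: "ol s a (m + n) = ol s a m @ ol s ((nx s ^^ m) a) n"
  by (induction n) (simp_all add: ol_snoc flip: funpow_add[THEN fun_cong, unfolded comp_apply] add: add.commute)

lemma ol_Suc: "ol s a (Suc m) = a # ol s (nx s a) m"
  using ol_add[of s a 1 m] by (simp add: ol_def)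

lemma hd_ol [simp]: "m > 0 \<Longrightarrow> hd (ol s a m) = a"
  by (cases m) (simp_all add: ol_Suc)

lemma last_ol: "m > 0 \<Longrightarrow> last (ol s a m) = (nx s ^^ (m - 1)) a"
  by (cases m) (simp_all add: ol_snoc)

lemma st_last_ol: assumes "closed s a m" shows "st s (last (ol s a m)) a"
proof -
  have "nx s (last (ol s a m)) = a"
    using assms by (cases m) (auto simp: closed_def last_ol)
  moreover have "last (ol s a m) \<in> per s"
    using assms by (auto simp: closed_def last_ol funpow_nx_per)
  ultimately show ?thesis using per_nx(1) by metis
qed

lemma ol_eq_iff: "m > 0 \<Longrightarrow> ol s a m = ol s' b n \<longleftrightarrow> m = n \<and> a = b \<and> ol s a m = ol s' a m"
  by (metis hd_ol length_ol)

lemma set_ol: assumes "closed s a m" shows "set (ol s a m) = orb s a"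
proof
  show "set (ol s a m) \<subseteq> orb s a" by (auto simp: ol_def orb_def)
  show "orb s a \<subseteq> set (ol s a m)"
  proof
    fix b assume "b \<in> orb s a"
    then obtain i where "b = (nx s ^^ i) a" by (auto simp: orb_def)
    then have "b = (nx s ^^ (i mod m)) a" "i mod m < m"
      using assms funpow_mod_eq[of m "nx s" a i] by (auto simp: closed_def)
    then show "b \<in> set (ol s a m)" by (auto simp: ol_def)
  qed
qed

lemma walk_ol: "a \<in> per s \<Longrightarrow> walk s (tail Q a) (ol s a m) (tail Q ((nx s ^^ m) a))"
proof (induction m arbitrary: a)
  case 0
  then show ?case by (simp add: per_arcs)
next
  case (Suc m)
  show ?case
    using Suc.IH[OF per_nx(2)[OF Suc.prems]] Suc.prems per_nx(1)[OF Suc.prems]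
    by (simp add: ol_Suc walk_Cons per_arcs head_per funpow_swap1)
qed

lemma walk_closed: "closed s a m \<Longrightarrow> walk s (tail Q a) (ol s a m) (tail Q a)"
  using walk_ol[of a s m] by (simp add: closed_def)

lemma walk_is_ol: "walk s u p v \<Longrightarrow> p \<noteq> [] \<Longrightarrow> hd p \<in> per s \<Longrightarrow> p = ol s (hd p) (length p)"
proof (induction p arbitrary: u)
  case (Cons a p)
  show ?case
  proof (cases "p = []")
    case True
    then show ?thesis by (simp add: ol_def)
  next
    case False
    then have w: "walk s (head Q a) p v" "nx s a = hd p"
      using Cons.prems(1) st_nx by (auto simp: walk_Cons)
    then have "hd p \<in> per s" using per_nx(2)[of a s] Cons.prems(3) by simp
    then have "p = ol s (hd p) (length p)" using Cons.IH[OF w(1) False] by simp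
    then show ?thesis using w(2) by (simp add: ol_Suc)
  qed
qed simp

lemma walk_rtrancl: "walk s u p v \<Longrightarrow> p \<noteq> [] \<Longrightarrow> (hd p, last p) \<in> {(x, y). st s x y}\<^sup>*"
proof (induction p arbitrary: u)
  case (Cons a p)
  then show ?case
    by (cases "p = []") (auto simp: walk_Cons intro: converse_rtrancl_into_rtrancl)
qed simp

text \<open>Closing up makes the first arrow cyclic, and from a cyclic arrow a walk has no choice,
  so its arrows are iterates of \<open>nx\<close>.\<close>

lemma cyclic_walk:
  assumes w: "walk s u p v" and p: "p \<noteq> []" and c: "st s (last p) (hd p)"
  shows "closed s (hd p) (length p)" "p = ol s (hd p) (length p)" "u = tail Q (hd p)"
proof -
  have per: "hd p \<in> per s"
    using walk_rtrancl[OF w p] c by (auto simp: per_def intro: rtrancl_into_trancl1)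
  then show ol: "p = ol s (hd p) (length p)" by (rule walk_is_ol[OF w p])
  have "(nx s ^^ length p) (hd p) = nx s (last p)"
    using p by (subst ol) (cases "length p"; simp add: last_ol)
  then show "closed s (hd p) (length p)"
    using per p st_nx[OF c] by (simp add: closed_def)
  show "u = tail Q (hd p)" by (rule walk_source[OF w p])
qed

text \<open>\<open>zc\<close> is a cycle against its base vertex, and \<open>dc\<close> is that
  cycle prolonged by its first arrow, against this arrow. For a fixed orbit and a fixed
  \<open>m\<close> they span the two terms of a circulant complex, while \<open>vv\<close> and
  \<open>cc\<close> span those of the graph complex.\<close>

definition zc :: "bool \<Rightarrow> 'a \<Rightarrow> nat \<Rightarrow> ('v, 'a) path \<times> ('v, 'a) path" where
  "zc s a m = pr s (tail Q a) (ol s a m) []"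

definition dc :: "bool \<Rightarrow> 'a \<Rightarrow> nat \<Rightarrow> ('v, 'a) path \<times> ('v, 'a) path" where
  "dc s a m = pr s (tail Q a) (ol s a (Suc m)) [a]"

abbreviation cc :: "'a \<Rightarrow> ('v, 'a) path \<times> ('v, 'a) path" where
  "cc c \<equiv> pr True (tail Q c) [c] [c]"

abbreviation vv :: "'v \<Rightarrow> ('v, 'a) path \<times> ('v, 'a) path" where
  "vv v \<equiv> pr True v [] []"

text \<open>The sign picked up in one rotation step. It is that of the cohomological degree of
  \<open>zc s a m\<close>, which is the length \<open>m\<close> on the \<Gamma>-side and 0 on the
  other.\<close>

definition sg :: "bool \<Rightarrow> nat \<Rightarrow> 'k" where
  "sg s m = (if s then (- 1) ^ m else 1)"

lemma cc_pr: "cc c = pr s (tail Q c) [c] [c]" and vv_pr: "vv v = pr s v [] []"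
  by (auto simp: pr_def)

lemma zc_X: "closed s a m \<Longrightarrow> zc s a m \<in> X"
  using walk_closed by (auto simp: zc_def in_X per_arcs closed_def)

lemma dc_X: "closed s a m \<Longrightarrow> dc s a m \<in> X"
  using walk_ol[of a s "Suc m"]
  by (auto simp: dc_def in_X per_arcs closed_def head_per)

lemma cc_X: "c \<in> arcs Q \<Longrightarrow> cc c \<in> X" and vv_X: "v \<in> verts Q \<Longrightarrow> vv v \<in> X"
  by (auto simp: in_X)

lemma pr_eq_cases: "pr s u p q = pr s' u' p' q' \<longleftrightarrow>
    u = u' \<and> (if s = s' then p = p' \<and> q = q' else p = q' \<and> q = p')"
  by (auto simp: pr_def)

lemma zc_eq_iff: "m > 0 \<Longrightarrow> zc s a m = zc s' a' m' \<longleftrightarrow> s = s' \<and> a = a' \<and> m = m'"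
  by (auto simp: zc_def pr_eq_cases ol_eq_iff split: if_splits)

lemma dc_eq_iff: "m > 0 \<Longrightarrow> dc s a m = dc s' a' m' \<longleftrightarrow> s = s' \<and> a = a' \<and> m = m'"
  by (auto simp: dc_def pr_eq_cases ol_Suc split: if_splits)
    (metis length_ol)+

lemma basis_distinct:
  "m > 0 \<Longrightarrow> zc s a m \<noteq> dc s' a' m'" "m > 0 \<Longrightarrow> zc s a m \<noteq> cc c" "m > 0 \<Longrightarrow> zc s a m \<noteq> vv v"
  "m > 0 \<Longrightarrow> dc s a m \<noteq> cc c" "dc s a m \<noteq> vv v" "cc c \<noteq> vv v"
  by (auto simp: zc_def dc_def pr_eq_cases ol_Suc split: if_splits)

lemma special_basis:
  "special (vv v)" "special (cc c)" "closed s a m \<Longrightarrow> special (zc s a m)"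
  "closed s a m \<Longrightarrow> special (dc s a m)"
proof -
  show "special (vv v)" "special (cc c)" by (auto simp: special_pr)
  show "closed s a m \<Longrightarrow> special (zc s a m)"
    using st_last_ol[of s a m] closed_pos[of s a m] by (simp add: zc_def special_pr)
  show "closed s a m \<Longrightarrow> special (dc s a m)"
    using last_ol[of "Suc m" s a] by (auto simp: dc_def special_pr closed_def)
qed

lemma special_cases:
  assumes x: "x \<in> X" "special x"
  obtains v where "v \<in> verts Q" "x = vv v" | c where "c \<in> arcs Q" "x = cc c"
    | s a m where "closed s a m" "x = zc s a m" | s a m where "closed s a m" "x = dc s a m"
proof -
  obtain u p q v where x': "x = pr True u p q" "walk True u p v" "walk False u q v"
    by (rule X_cases[OF x(1), of True]) simp
  have zc: "\<exists>a m. closed s a m \<and> pr s u p [] = zc s a m"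
    if "walk s u p v" "p \<noteq> []" "st s (last p) (hd p)" for s p
    using cyclic_walk[OF that] zc_def by metis
  \<comment> \<open>Dropping the last arrow, which repeats the first one, leaves a walk that closes
    up. This is why \<open>dc s a m\<close> has a path of length \<open>m + 1\<close>.\<close>
  have dc: "\<exists>a m. closed s a m \<and> pr s u p [c] = dc s a m"
    if w: "walk s u p v" and p: "length p \<ge> 2" "hd p = c" "last p = c" for s p c
  proof -
    obtain b p' where b: "p = p' @ [c]" "p' \<noteq> []" "hd p' = c"
      using p by (cases p rule: rev_cases) (auto simp: hd_append Suc_le_eq split: if_splits)
    then have w': "walk s u p' (tail Q c)" "st s (last p') (hd p')"
      using w by (auto simp: walk_snoc)
    note * = cyclic_walk[OF w'(1) b(2) w'(2)]
    have "p = ol s c (Suc (length p'))"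
      using * b by (simp add: ol_snoc closed_def)
    then show ?thesis using * b by (intro exI[of _ c] exI[of _ "length p'"]) (simp add: dc_def)
  qed
  have xF: "x = pr False u q p" using x'(1) by (simp add: pr_def)
  have len: "length p \<ge> 2" if "p \<noteq> []" "p \<noteq> [c]" "hd p = c" for p :: "'a list" and c
    using that by (cases p; cases "tl p") auto
  have "(\<exists>v\<in>verts Q. x = vv v) \<or> (\<exists>c\<in>arcs Q. x = cc c)
      \<or> (\<exists>s a m. closed s a m \<and> x = zc s a m) \<or> (\<exists>s a m. closed s a m \<and> x = dc s a m)"
  proof -
    consider "p = []" "q = []" | "q = []" "p \<noteq> []" "st True (last p) (hd p)"
      | "p = []" "q \<noteq> []" "st False (last q) (hd q)" | c where "q = [c]" "p = [c]"
      | c where "q = [c]" "p \<noteq> []" "p \<noteq> [c]" "hd p = c" "last p = c"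
      | c where "p = [c]" "q \<noteq> []" "q \<noteq> [c]" "hd q = c" "last q = c"
      using x(2) unfolding x'(1) special_pr by (metis (full_types))
    then show ?thesis
    proof cases
      case 1
      then show ?thesis using x' by auto
    next
      case 2
      then show ?thesis using x' zc[of True p] by blast
    next
      case 3
      then show ?thesis using x'(3) xF zc[of False q] by blast
    next
      case 4
      then show ?thesis using x' by auto
    next
      case 5
      then show ?thesis using x' dc[of True p c] len[of p c] by blast
    next
      case 6
      then show ?thesis using x'(3) xF dc[of False q c] len[of q c] by blast
    qed
  qed
  then show thesis using that by blast
qed

lemma sign_zc: "sign (zc s a m) = sg s m" and sign_dc: "sign (dc s a m) = - sg s m"
  by (auto simp: sign_def sg_def zc_def dc_def deg_pr)

lemma chop_dc:
  assumes "closed s a m"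
  shows "shareL (dc s a m)" "chopL (dc s a m) = zc s a m"
    "shareR (dc s a m)" "chopR (dc s a m) = zc s (nx s a) m"
proof -
  have m: "(nx s ^^ m) a = a" "head Q a = tail Q (nx s a)"
    using assms head_per by (auto simp: closed_def)
  show "shareL (dc s a m)" "chopL (dc s a m) = zc s a m"
    using m by (auto simp: dc_def zc_def ol_snoc)
  show "shareR (dc s a m)" "chopR (dc s a m) = zc s (nx s a) m"
    using m by (auto simp: dc_def zc_def ol_Suc)
qed

text \<open>Chopping \<open>dc\<close> at its two ends leaves the same circuit begun at
  \<open>a\<close> and at the next arrow. For a cocycle, one coefficient therefore determines all
  others along the orbit.\<close>

lemma lookup_d_dc:
  assumes "closed s a m" "f \<in> kspace X"
  shows "Poly_Mapping.lookup (d f) (dc s a m)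
    = Poly_Mapping.lookup f (zc s a m) - sg s m * Poly_Mapping.lookup f (zc s (nx s a) m)"
  using lookup_d[OF assms(2) dc_X[OF assms(1)]] chop_dc[OF assms(1)] by (simp add: sign_dc)

text \<open>The coboundary of the underlying graph, up to sign, applied to the vertex function
  formed by the coefficients at \<open>vv\<close>.\<close>

lemma lookup_d_cc:
  assumes "c \<in> arcs Q" "f \<in> kspace X"
  shows "Poly_Mapping.lookup (d f) (cc c)
    = Poly_Mapping.lookup f (vv (tail Q c)) - Poly_Mapping.lookup f (vv (head Q c))"
  using lookup_d[OF assms(2) cc_X[OF assms(1)]] by (simp add: sign_def deg_pr)

lemma d_dc: assumes "closed s a m" shows "d (basis (dc s a m)) = 0"
proof -
  have "\<not> linkL (dc s a m) y \<and> \<not> linkR (dc s a m) y" for y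
    using assms by (auto simp: dc_def linkL_pr linkR_pr in_X walk_append walk_Cons ol_snoc closed_def
        dest: st_excl)
  then show ?thesis using d_basis[OF dc_X[OF assms]] by simp
qed

lemma d_cc: assumes "c \<in> arcs Q" shows "d (basis (cc c)) = 0"
proof -
  have "\<not> linkL (cc c) y \<and> \<not> linkR (cc c) y" for y
    by (auto simp: linkL_pr linkR_pr in_X walk_Cons dest: st_excl)
  then show ?thesis using d_basis[OF cc_X[OF assms]] by simp
qed

text \<open>Formulated at \<open>nx s a\<close> so that the predecessor, to which the second term
  belongs, has a name.\<close>

lemma d_zc:
  assumes "closed s a m"
  shows "d (basis (zc s (nx s a) m)) = basis (dc s (nx s a) m) - scale (sg s m) (basis (dc s a m))"
proof -
  let ?b = "nx s a"
  have b: "closed s ?b m" using closed_nx[OF assms] .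
  have "linkL (zc s ?b m) y \<longleftrightarrow> y = dc s ?b m" for y
  proof
    assume "linkL (zc s ?b m) y"
    then obtain c where c: "y = pr s (tail Q ?b) (ol s ?b m @ [c]) [c]" "y \<in> X"
      unfolding zc_def linkL_pr by auto
    have "st s (last (ol s ?b m)) c"
      using c closed_pos[OF b] by (auto simp: in_X walk_snoc)
    then have "c = ?b" using st_last_ol[OF b] st_succ_unique by blast
    then show "y = dc s ?b m" using c b by (simp add: dc_def ol_snoc closed_def)
  qed (use chop_dc[OF b] dc_X[OF b] in \<open>auto simp: linkL_def\<close>)
  moreover have "linkR (zc s ?b m) y \<longleftrightarrow> y = dc s a m" for y
  proof
    assume "linkR (zc s ?b m) y"
    then obtain c where c: "y = pr s (tail Q c) (c # ol s ?b m) [c]" "y \<in> X"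
      unfolding zc_def linkR_pr by auto
    have "st s c ?b"
      using c closed_pos[OF b] by (auto simp: in_X walk_Cons)
    then have "c = a" using per_nx(1)[OF closed_per[OF assms]] st_pred_unique by blast
    then show "y = dc s a m" using c by (simp add: dc_def ol_Suc)
  qed (use chop_dc[OF assms] dc_X[OF assms] in \<open>auto simp: linkR_def\<close>)
  ultimately show ?thesis
    using d_basis[OF zc_X[OF b]] by (simp add: sign_zc)
qed

end

section \<open>Spanning trees\<close>

text \<open>Reachability in the symmetrized digraph follows arrows in both directions, and
  \<open>f\<close> changes along neither. Taking for \<open>f\<close> the test for a single vertex
  shows that no set of arrows at that vertex can be cut off from the rest.\<close>

lemma connected_const:
  assumes wf: "wf_digraph H" and conn: "Digraph_Component.connected H"
    and f: "\<And>b. b \<in> arcs H \<Longrightarrow> f (tail H b) = f (head H b)" and uv: "u \<in> verts H" "v \<in> verts H"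
  shows "f u = f v"
proof -
  have "u \<rightarrow>\<^sup>*\<^bsub>with_proj (mk_symmetric H)\<^esub> v"
    using conn uv by (auto simp: connected_def strongly_connected_def)
  then have "(u, v) \<in> (arcs_ends (with_proj (mk_symmetric H)))\<^sup>*"
    unfolding reachable_def by (rule rtrancl_on_rtranclI)
  then show ?thesis
  proof (induction rule: rtrancl_induct)
    case (step y z)
    have "f y = f z"
      using step(2) f by (auto simp: arcs_ends_conv parcs_mk_symmetric)
    then show ?case using step(3) by simp
  qed simp
qed

lemma wf_double_quiver: "wf_digraph H \<Longrightarrow> wf_digraph (double_quiver H)"
  by (rule wf_digraph.intro) (auto simp: double_quiver_def wf_digraph.tail_in_verts wf_digraph.head_in_verts)

text \<open>A step to a vertex already visited cuts the walk back to that vertex; a step to a new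
  one appends an arrow. No arrow is repeated even with the opposite orientation, which is what
  \<open>undirected_acyclic\<close> asks of a cycle.\<close>

lemma connecting_path:
  fixes H :: "('v, 'a) pre_digraph"
  defines "E A \<equiv> {(x, y). \<exists>b\<in>A. (x, y) = (tail H b, head H b) \<or> (y, x) = (tail H b, head H b)}"
  assumes wf: "wf_digraph H" and A: "A \<subseteq> arcs H" and x: "x \<in> verts H" and xy: "(x, y) \<in> (E A)\<^sup>*"
  shows "\<exists>p. pre_digraph.awalk (double_quiver H) x p y \<and>
    distinct (pre_digraph.awalk_verts (double_quiver H) x p) \<and> fst ` set p \<subseteq> A \<and> distinct (map fst p)"
proof -
  interpret W: wf_digraph "double_quiver H" by (rule wf_double_quiver[OF wf])
  have sel: "verts (double_quiver H) = verts H" "arcs (double_quiver H) = arcs H \<times> UNIV"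
    by (auto simp: double_quiver_def)
  show ?thesis
    using xy
  proof (induction rule: rtrancl_induct)
    case base
    then show ?case using x by (intro exI[of _ "[]"]) (auto simp: W.awalk_Nil_iff sel)
  next
    case (step y z)
    then obtain p where p: "W.awalk x p y" "distinct (W.awalk_verts x p)" "fst ` set p \<subseteq> A" "distinct (map fst p)"
      by blast
    obtain b t where b: "b \<in> A" "tail (double_quiver H) (b, t) = y" "head (double_quiver H) (b, t) = z"
    proof -
      obtain b where "b \<in> A" "(y, z) = (tail H b, head H b) \<or> (z, y) = (tail H b, head H b)"
        using step(2) by (auto simp: E_def)
      then show thesis
        using that[of b True] that[of b False] by (auto simp: double_quiver_def)
    qed
    show ?case
    proof (cases "z \<in> set (W.awalk_verts x p)")
      case True
      then obtain q r where q: "p = q @ r" "W.awalk x q z"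
        using W.awalk_decomp[OF p(1)] by blast
      have "distinct (W.awalk_verts x q)"
        using p(2) W.awalk_verts_append[of x q r y] p(1) q(1) by simp
      then show ?thesis
        using q p by (intro exI[of _ q]) auto
    next
      case False
      \<comment> \<open>Both ends of an arrow used before are visited vertices, whereas
        \<open>z\<close> is new.\<close>
      have nb: "b \<notin> fst ` set p"
      proof
        assume "b \<in> fst ` set p"
        then obtain t' where t': "(b, t') \<in> set p" by auto
        have "z = tail (double_quiver H) (b, t') \<or> z = head (double_quiver H) (b, t')"
          using b(3) by (auto simp: double_quiver_def split: if_splits)
        then show False
          using False W.awalk_verts_arc1[OF t', of x] W.awalk_verts_arc2[OF p(1) t'] by auto
      qed
      have ba: "(b, t) \<in> arcs (double_quiver H)" using b(1) A by (auto simp: sel)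
      have aw: "W.awalk x (p @ [(b, t)]) z"
        using p(1) W.arc_implies_awalk[OF ba] b by (auto intro: W.awalk_appendI)
      have "distinct (W.awalk_verts x (p @ [(b, t)]))"
        using W.awalk_verts_append[OF aw] p(1,2) False b by simp
      then show ?thesis
        using aw p nb b(1) by (intro exI[of _ "p @ [(b, t)]"]) auto
    qed
  qed
qed

text \<open>Take for \<open>S\<close> the vertices reached from the tail of \<open>c\<close> without
  using \<open>c\<close>. If the head were among them, such a path followed by \<open>c\<close>
  traversed backwards would be an undirected cycle.\<close>

lemma tree_cut:
  assumes wf: "wf_digraph H" and ac: "undirected_acyclic H" and c: "c \<in> arcs H"
  obtains S where "tail H c \<in> S" "head H c \<notin> S" "\<And>b. b \<in> arcs H \<Longrightarrow> b \<noteq> c \<Longrightarrow> tail H b \<in> S \<longleftrightarrow> head H b \<in> S"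
proof -
  interpret W: wf_digraph "double_quiver H" by (rule wf_double_quiver[OF wf])
  define E where "E = {(x, y). \<exists>b\<in>arcs H - {c}. (x, y) = (tail H b, head H b) \<or> (y, x) = (tail H b, head H b)}"
  define S where "S = {w. (tail H c, w) \<in> E\<^sup>*}"
  have "head H c \<notin> S"
  proof
    assume "head H c \<in> S"
    then obtain p where p: "W.awalk (tail H c) p (head H c)" "distinct (W.awalk_verts (tail H c) p)"
      "fst ` set p \<subseteq> arcs H - {c}" "distinct (map fst p)"
      using connecting_path[OF wf, of "arcs H - {c}" "tail H c" "head H c"] wf_digraph.tail_in_verts[OF wf c]
      unfolding S_def E_def by blast
    let ?p = "p @ [(c, False)]"
    have "(c, False) \<in> arcs (double_quiver H)" using c by (simp add: double_quiver_def)
    then have "W.awalk (tail (double_quiver H) (c, False)) [(c, False)] (head (double_quiver H) (c, False))"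
      by (rule W.arc_implies_awalk)
    then have 1: "W.awalk (head H c) [(c, False)] (tail H c)"
      by (simp add: double_quiver_def)
    have aw: "W.awalk (tail H c) ?p (tail H c)"
      using p(1) 1 by (rule W.awalk_appendI)
    obtain vs where vs: "W.awalk_verts (tail H c) p = tail H c # vs"
      using W.awhd_of_awalk[OF p(1)] by (cases "W.awalk_verts (tail H c) p") auto
    have "head (double_quiver H) (c, False) = tail H c"
      by (simp add: double_quiver_def)
    then have "W.awalk_verts (tail H c) ?p = W.awalk_verts (tail H c) p @ [tail H c]"
      using W.awalk_verts_append[OF aw] by simp
    then have "distinct (tl (W.awalk_verts (tail H c) ?p))"
      using p(2) vs by simp
    then have "W.cycle ?p" using aw unfolding W.cycle_def by blast
    moreover have "distinct (map fst ?p)" using p(3,4) by auto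
    ultimately show False using ac unfolding undirected_acyclic_def by blast
  qed
  moreover have "tail H b \<in> S \<longleftrightarrow> head H b \<in> S" if "b \<in> arcs H" "b \<noteq> c" for b
  proof -
    have "(tail H b, head H b) \<in> E" "(head H b, tail H b) \<in> E"
      using that by (auto simp: E_def)
    then show ?thesis unfolding S_def by (auto intro: rtrancl_into_rtrancl)
  qed
  moreover have "tail H c \<in> S" by (simp add: S_def)
  ultimately show thesis using that by blast
qed

section \<open>Basic cycles\<close>

context gentle
begin

definition cyc :: "bool \<Rightarrow> 'a \<Rightarrow> nat \<Rightarrow> ('v, 'a) path" where
  "cyc s a m = (tail Q a, ol s a m)"

lemma cyc_eq_iff: "m > 0 \<Longrightarrow> cyc s a m = cyc s b n \<longleftrightarrow> m = n \<and> a = b"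
  by (auto simp: cyc_def ol_eq_iff)

lemma concat_replicate_ol:
  "closed s a m \<Longrightarrow> concat (replicate n (ol s a m)) = ol s a (n * m)"
  by (induction n) (simp_all add: ol_add closed_def)

lemma ppower_cyc: "closed s a m \<Longrightarrow> ppower (cyc s a m) n = cyc s a (n * m)"
  by (simp add: ppower_def cyc_def psrc_def concat_replicate_ol)

lemma is_cycle_cyc: "closed s a m \<Longrightarrow> is_cycle Q (cyc s a m)"
  using walk_awalk[OF walk_closed, of s a m] closed_pos[of s a m]
  by (auto simp: is_cycle_def cyc_def paths_iff plen_def psrc_def ptgt_awalk)

text \<open>Admissibility of the square says that the cycle closes up as an \<open>s\<close>-walk,
  which is the hypothesis of \<open>cyclic_walk\<close>.\<close>

lemma closed_cycle_iff:
  "is_cycle Q C \<and> (\<exists>v. walk s (fst C) (snd C @ snd C) v) \<longleftrightarrow> (\<exists>a m. closed s a m \<and> C = cyc s a m)"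
proof
  assume h: "is_cycle Q C \<and> (\<exists>v. walk s (fst C) (snd C @ snd C) v)"
  then have "snd C \<noteq> []" by (auto simp: is_cycle_def plen_def)
  moreover obtain w where "walk s (fst C) (snd C) w" "st s (last (snd C)) (hd (snd C))"
    using h calculation by (auto simp: walk_append)
  ultimately show "\<exists>a m. closed s a m \<and> C = cyc s a m"
    using cyclic_walk[of s "fst C" "snd C" w] by (metis cyc_def prod.collapse)
next
  assume "\<exists>a m. closed s a m \<and> C = cyc s a m"
  then obtain a m where *: "closed s a m" "C = cyc s a m" by blast
  then have "walk s (fst C) (snd C @ snd C) (tail Q a)"
    using walk_closed[OF *(1)] st_last_ol[OF *(1)] closed_pos[OF *(1)]
    by (auto simp: cyc_def walk_append)
  then show "is_cycle Q C \<and> (\<exists>v. walk s (fst C) (snd C @ snd C) v)"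
    using * is_cycle_cyc by blast
qed

lemma complete_cycle_iff: "complete_cycle Q I C \<longleftrightarrow> (\<exists>a m. closed True a m \<and> C = cyc True a m)"
  unfolding closed_cycle_iff[symmetric]
  by (simp add: complete_cycle_def ppower_def psrc_def Gamma_paths_iff numeral_2_eq_2)

lemma cocomplete_cycle_iff: "cocomplete_cycle Q I C \<longleftrightarrow> (\<exists>a m. closed False a m \<and> C = cyc False a m)"
  unfolding closed_cycle_iff[symmetric]
  by (simp add: cocomplete_cycle_def ppower_def psrc_def B_paths_iff numeral_2_eq_2)

lemma primitive_cyc_iff:
  assumes "closed s a m"
  shows "primitive_cycle Q (cyc s a m) \<longleftrightarrow> m = prd s a"
proof
  assume h: "primitive_cycle Q (cyc s a m)"
  have per: "a \<in> per s" using assms by (rule closed_per)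
  have cp: "closed s a (prd s a)" using prd[OF per] per by (simp add: closed_def)
  obtain n where n: "m = prd s a * n" using assms by (auto simp: closed_iff_dvd)
  then have "cyc s a m = ppower (cyc s a (prd s a)) n"
    by (simp add: ppower_cyc[OF cp] mult.commute)
  then have "\<not> n \<ge> 2" using h is_cycle_cyc[OF cp] by (auto simp: primitive_cycle_def)
  moreover have "n > 0" using n closed_pos[OF assms] by (cases n) auto
  ultimately show "m = prd s a" using n by (cases "n = 1") auto
next
  assume m: "m = prd s a"
  have False if D: "is_cycle Q C" "n \<ge> 2" "cyc s a m = ppower C n" for C n
  proof -
    obtain k where k: "n = Suc (Suc k)" using D(2) by (metis Suc_le_D numeral_2_eq_2 Suc_le_mono)
    let ?p = "snd C"
    have p: "?p \<noteq> []" using D(1) by (auto simp: is_cycle_def plen_def)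
    \<comment> \<open>The second copy of \<open>C\<close> brings the first arrow back after
      \<open>length ?p\<close> steps, fewer than the supposed least period.\<close>
    have eq: "ol s a m = ?p @ ?p @ concat (replicate k ?p)"
      using D(3) by (simp add: cyc_def ppower_def k)
    have lt: "length ?p < m" using arg_cong[OF eq, of length] p by simp
    have "hd ?p = a" using hd_ol[OF closed_pos[OF assms], of s a] eq p by simp
    moreover have "ol s a m ! length ?p = hd ?p"
      using p by (simp add: eq nth_append hd_conv_nth)
    moreover have "ol s a m ! length ?p = (nx s ^^ length ?p) a"
      using lt by (simp add: ol_def)
    ultimately have "prd s a \<le> length ?p" using p by (intro prd_least) (auto simp: Suc_le_eq)
    then show False using lt m by simp
  qed
  then show "primitive_cycle Q (cyc s a m)"
    using is_cycle_cyc[OF assms] by (auto simp: primitive_cycle_def)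
qed

text \<open>\<open>rot\<close> moves the last arrow to the front and so shifts the starting arrow
  against \<open>nx\<close>. Naming the cycle by the successor \<open>nx s b\<close> avoids an
  inverse of \<open>nx\<close>.\<close>

lemma rot_cyc: assumes "closed s (nx s b) m" "b \<in> per s" shows "rot Q (cyc s (nx s b) m) = cyc s b m"
proof -
  obtain k where k: "m = Suc k" using closed_pos[OF assms(1)] by (cases m) auto
  have "(nx s ^^ k) (nx s b) = b"
    using assms nx_inj[OF funpow_nx_per[OF per_nx(2)[OF assms(2)]] assms(2), of k]
    by (simp add: closed_def k)
  then have "ol s (nx s b) m = ol s (nx s b) k @ [b]"
    by (simp add: k ol_snoc)
  then show ?thesis by (simp add: rot_def cyc_def k ol_Suc)
qed

lemma rot_funpow_cyc:
  assumes "closed s b m" shows "(rot Q ^^ i) (cyc s ((nx s ^^ i) b) m) = cyc s b m"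
proof (induction i)
  case (Suc i)
  have c: "closed s ((nx s ^^ i) b) m" using assms closed_orb by (auto simp: orb_def)
  have "(rot Q ^^ Suc i) (cyc s ((nx s ^^ Suc i) b) m)
      = (rot Q ^^ i) (rot Q (cyc s (nx s ((nx s ^^ i) b)) m))"
    by (simp add: funpow_swap1)
  also have "\<dots> = cyc s b m"
    using Suc rot_cyc[OF closed_nx[OF c] closed_per[OF c]] by simp
  finally show ?case .
qed simp

lemma orb_sym: "a \<in> per s \<Longrightarrow> b \<in> orb s a \<Longrightarrow> a \<in> orb s b"
  using orb_eq orb_self by metis

lemma obtain_funpow:
  assumes "a \<in> per s" obtains b where "b \<in> orb s a" "(nx s ^^ i) b = a"
proof -
  have "bij_betw (nx s ^^ i) (orb s a) (orb s a)"
    using bij_nx_orb[OF assms] by (rule bij_betw_funpow)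
  then have "a \<in> (nx s ^^ i) ` orb s a" using orb_self[of a s] by (simp add: bij_betw_def)
  then show thesis using that by blast
qed

lemma rot_orbit:
  assumes "closed s a m"
  shows "(\<exists>i. (rot Q ^^ i) (cyc s a m) = C) \<longleftrightarrow> (\<exists>b\<in>orb s a. C = cyc s b m)"
proof
  assume "\<exists>i. (rot Q ^^ i) (cyc s a m) = C"
  then obtain i where i: "(rot Q ^^ i) (cyc s a m) = C" by blast
  obtain b where b: "b \<in> orb s a" "(nx s ^^ i) b = a"
    by (rule obtain_funpow[OF closed_per[OF assms]])
  show "\<exists>b\<in>orb s a. C = cyc s b m"
    using rot_funpow_cyc[OF closed_orb[OF assms b(1)], of i] i b by auto
next
  assume "\<exists>b\<in>orb s a. C = cyc s b m"
  then obtain b where b: "b \<in> orb s a" "C = cyc s b m" by blast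
  obtain i where "a = (nx s ^^ i) b"
    using orb_sym[OF closed_per[OF assms] b(1)] by (auto simp: orb_def)
  then show "\<exists>i. (rot Q ^^ i) (cyc s a m) = C"
    using rot_funpow_cyc[OF closed_orb[OF assms b(1)], of i] b(2) by metis
qed

text \<open>The rotations are the copies of the cycle begun at the arrows of the orbit, each met
  once within a period. That period is \<open>prd s a\<close>, also if the cycle is a proper
  power.\<close>

lemma sum_rotations:
  assumes "closed s a m"
  shows "(\<Sum>i<period Q (cyc s a m). F ((rot Q ^^ i) (cyc s a m))) = (\<Sum>b\<in>orb s a. F (cyc s b m))"
proof -
  define g where "g i = (rot Q ^^ i) (cyc s a m)" for i
  define r where "r = period Q (cyc s a m)"
  have per: "a \<in> per s" using assms by (rule closed_per)
  have gfix: "g i = cyc s a m \<longleftrightarrow> (nx s ^^ i) a = a" for i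
  proof -
    obtain b where b: "b \<in> orb s a" "(nx s ^^ i) b = a" by (rule obtain_funpow[OF per])
    have "g i = cyc s b m"
      using rot_funpow_cyc[OF closed_orb[OF assms b(1)], of i] b by (simp add: g_def)
    then have "g i = cyc s a m \<longleftrightarrow> b = a" by (auto simp: cyc_eq_iff[OF closed_pos[OF assms]])
    then show ?thesis
      using b funpow_nx_inj[OF orb_per[OF per b(1)] per, of i] by auto
  qed
  have r: "r = prd s a"
    using gfix unfolding r_def period_def prd_def g_def by simp
  have inj: "inj_on g {..<r}"
  proof -
    have False if ij: "i < j" "j < r" "g i = g j" for i j
    proof -
      obtain b where b: "b \<in> orb s a" "(nx s ^^ i) b = a" by (rule obtain_funpow[OF per])
      obtain c where c: "c \<in> orb s a" "(nx s ^^ j) c = a" by (rule obtain_funpow[OF per])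
      have "cyc s b m = cyc s c m"
        using ij(3) rot_funpow_cyc[OF closed_orb[OF assms b(1)], of i]
          rot_funpow_cyc[OF closed_orb[OF assms c(1)], of j] b c by (simp add: g_def)
      then have "b = c" by (auto simp: cyc_eq_iff[OF closed_pos[OF assms]])
      then have "(nx s ^^ (j - i)) a = a"
        using b c ij(1) funpow_add[of "j - i" i "nx s"] by (metis comp_apply le_add_diff_inverse2 less_imp_le_nat)
      then have "prd s a \<le> j - i" using ij(1) by (intro prd_least) auto
      then show False using ij r by simp
    qed
    then show ?thesis by (metis (no_types, lifting) inj_onI lessThan_iff linorder_neqE_nat)
  qed
  have img: "g ` {..<r} = (\<lambda>b. cyc s b m) ` orb s a"
  proof
    show "g ` {..<r} \<subseteq> (\<lambda>b. cyc s b m) ` orb s a"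
      using rot_orbit[OF assms] unfolding g_def by blast
    have "g i = g (i mod r)" for i
      using funpow_mod_eq[of r "rot Q" "cyc s a m" i] prd(2)[OF per] gfix[of r]
      by (simp add: g_def r)
    moreover have "i mod r < r" for i using prd(1)[OF per] r by simp
    moreover have "(\<lambda>b. cyc s b m) ` orb s a \<subseteq> range g"
    proof
      fix C assume "C \<in> (\<lambda>b. cyc s b m) ` orb s a"
      then obtain i where "(rot Q ^^ i) (cyc s a m) = C" using rot_orbit[OF assms, of C] by blast
      then have "C = g i" by (simp add: g_def)
      then show "C \<in> range g" by blast
    qed
    ultimately show "(\<lambda>b. cyc s b m) ` orb s a \<subseteq> g ` {..<r}"
      by (metis (no_types, lifting) image_iff lessThan_iff subset_iff)
  qed
  have "(\<Sum>i<r. F (g i)) = (\<Sum>C\<in>(\<lambda>b. cyc s b m) ` orb s a. F C)"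
    unfolding img[symmetric] by (simp add: sum.reindex[OF inj])
  also have "\<dots> = (\<Sum>b\<in>orb s a. F (cyc s b m))"
    by (subst sum.reindex) (auto simp: inj_on_def cyc_eq_iff[OF closed_pos[OF assms]])
  finally show ?thesis by (simp add: g_def r_def)
qed

lemma B_sum_cyc: "closed False a m \<Longrightarrow> B_sum Q (cyc False a m) = (\<Sum>b\<in>orb False a. basis (zc False b m))"
  unfolding B_sum_def
  by (subst sum_rotations) (auto simp: cyc_def zc_def pr_def vertex_path_def psrc_def)

lemma Gamma_sum_cyc: "closed True a m \<Longrightarrow> Gamma_sum Q (cyc True a m) = (\<Sum>b\<in>orb True a. basis (zc True b m))"
  unfolding Gamma_sum_def
  by (subst sum_rotations) (auto simp: cyc_def zc_def pr_def vertex_path_def psrc_def)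

text \<open>Rotation classes of primitive cycles correspond to orbits of \<open>nx\<close>, so
  choosing one cycle in each class means choosing exactly one through each cyclic arrow. Only this
  second form is convenient later on.\<close>

lemma representatives:
  assumes R: "circuit_representatives Q {C. primitive_cycle Q C \<and> (\<exists>a m. closed s a m \<and> C = cyc s a m)} S"
  shows "C \<in> S \<Longrightarrow> \<exists>a\<in>per s. C = cyc s a (prd s a)"
    and "a \<in> per s \<Longrightarrow> \<exists>!C. C \<in> S \<and> a \<in> set (snd C)"
proof -
  have cl: "closed s a (prd s a)" if "a \<in> per s" for a
    using prd[OF that] that by (simp add: closed_def)
  have X: "{C. primitive_cycle Q C \<and> (\<exists>a m. closed s a m \<and> C = cyc s a m)} = {cyc s a (prd s a) | a. a \<in> per s}"
    using primitive_cyc_iff cl closed_per by fastforce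
  have S: "\<exists>a\<in>per s. C = cyc s a (prd s a)" if "C \<in> S" for C
    using R that unfolding circuit_representatives_def X by blast
  then show "C \<in> S \<Longrightarrow> \<exists>a\<in>per s. C = cyc s a (prd s a)" .
  show "\<exists>!C. C \<in> S \<and> a \<in> set (snd C)" if a: "a \<in> per s"
  proof -
    have "(\<exists>i. (rot Q ^^ i) (cyc s a (prd s a)) = C) \<longleftrightarrow> a \<in> set (snd C)" if C: "C \<in> S" for C
    proof -
      obtain b where b: "b \<in> per s" "C = cyc s b (prd s b)" using S[OF C] by blast
      have set: "set (snd C) = orb s b" using set_ol[OF cl[OF b(1)]] b(2) by (simp add: cyc_def)
      have "prd s b = prd s a" if "b \<in> orb s a"
      proof (rule dvd_antisym)
        show "prd s b dvd prd s a" "prd s a dvd prd s b"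
          using closed_orb[OF cl[OF a] that] closed_orb[OF cl[OF b(1)] orb_sym[OF a that]]
          by (simp_all add: closed_iff_dvd)
      qed
      moreover have "cyc s b (prd s b) = cyc s c (prd s a) \<longleftrightarrow> prd s b = prd s a \<and> b = c" for c
        using prd(1)[OF b(1)] by (intro cyc_eq_iff) simp
      ultimately have "(\<exists>c\<in>orb s a. C = cyc s c (prd s a)) \<longleftrightarrow> b \<in> orb s a"
        using b(2) by metis
      also have "\<dots> \<longleftrightarrow> a \<in> orb s b"
        using orb_sym[OF a] orb_sym[OF b(1)] by metis
      finally show ?thesis
        unfolding rot_orbit[OF cl[OF a]] set .
    qed
    moreover have "\<exists>!C. C \<in> S \<and> (\<exists>i. (rot Q ^^ i) (cyc s a (prd s a)) = C)"
      using R a unfolding circuit_representatives_def X by blast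
    ultimately show ?thesis by (metis (no_types, lifting))
  qed
qed

lemma char_two: "CHAR('k) = 2 \<longleftrightarrow> (2 :: 'k) = 0"
proof
  assume "CHAR('k) = 2"
  then show "(2 :: 'k) = 0" using of_nat_CHAR[where 'a = 'k] by simp
next
  assume "(2 :: 'k) = 0"
  then have "CHAR('k) dvd 2" using of_nat_eq_0_iff_char_dvd[where 'a = 'k, of 2] by simp
  moreover have "CHAR('k) \<noteq> 1" by simp
  ultimately show "CHAR('k) = 2" using prime_nat_iff two_is_prime_nat by blast
qed

text \<open>The least length at which the cycle through \<open>a\<close> closes up and a rotation
  step has sign 1, as \<open>blen_dvd\<close> shows. Outside characteristic 2 an odd complete
  circuit has to be run through twice to reach an even degree.\<close>

definition blen :: "bool \<Rightarrow> 'a \<Rightarrow> nat" where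
  "blen s a = (if s \<and> (2 :: 'k) \<noteq> 0 \<and> odd (prd s a) then 2 * prd s a else prd s a)"

lemma sg_eq_1: "sg s m = 1 \<longleftrightarrow> \<not> s \<or> (2 :: 'k) = 0 \<or> even m"
proof -
  have "(- 1 :: 'k) = 1 \<longleftrightarrow> (2 :: 'k) = 0"
    by (metis add.right_inverse one_add_one add_eq_0_iff)
  then show ?thesis by (cases "even m") (auto simp: sg_def)
qed

lemma blen_dvd: "closed s a m \<and> sg s m = 1 \<longleftrightarrow> a \<in> per s \<and> m > 0 \<and> blen s a dvd m"
  by (auto simp: closed_iff_dvd sg_eq_1 blen_def)

lemma closed_blen: "a \<in> per s \<Longrightarrow> closed s a (blen s a)" "a \<in> per s \<Longrightarrow> sg s (blen s a) = 1"
proof -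
  have "blen s a > 0" if "a \<in> per s" using prd(1)[OF that] by (auto simp: blen_def)
  then show "a \<in> per s \<Longrightarrow> closed s a (blen s a)" "a \<in> per s \<Longrightarrow> sg s (blen s a) = 1"
    using blen_dvd[of s a "blen s a"] by simp_all
qed

end

section \<open>A basis of the cohomology\<close>

lemma lookup_sum_basis:
  assumes "finite A" "inj_on f A"
  shows "Poly_Mapping.lookup (\<Sum>a\<in>A. basis (f a)) x = (if \<exists>a\<in>A. x = f a then 1 else 0 :: 'k::field)"
proof -
  have "Poly_Mapping.lookup (\<Sum>a\<in>A. basis (f a)) x = (\<Sum>y\<in>f ` A. if y = x then 1 else 0 :: 'k)"
    by (simp add: lookup_sum lookup_basis sum.reindex[OF assms(2)])
  also have "\<dots> = (if x \<in> f ` A then 1 else 0)"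
    using assms(1) by simp
  finally show ?thesis by (simp add: image_iff)
qed

text \<open>One index set for two families: \<open>repr\<close> turns an index into a cocycle, and
  \<open>word\<close> turns it into a word in the generators.\<close>

datatype ('v, 'a) idx = Unit | Iso "('v, 'a) path \<times> ('v, 'a) path" | Arr 'a
  | Cyc bool "('v, 'a) path" nat | ArrCyc bool "('v, 'a) path" nat

locale gentle_data = gentle Q I
  for Q :: "('v, 'a) pre_digraph" and I :: "(('v, 'a) path \<Rightarrow>\<^sub>0 'k::field) set" +
  fixes T :: "'a set" and CB D CG :: "('v, 'a) path set"
  assumes connected: "Digraph_Component.connected Q"
    and arrows: "arcs Q \<noteq> {}"
    and no_dual_numbers: "\<not> (\<exists>x. one_loop_quiver Q x \<and> arrow_prod Q x x \<in> I) \<or> CHAR('k) \<noteq> 2"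
    and no_polynomials: "\<not> polynomial_case Q I"
    and tree: "quiver_spanning_tree Q T"
    and CB: "circuit_representatives Q {\<alpha>. primitive_cycle Q \<alpha> \<and> cocomplete_cycle Q I \<alpha>} CB"
    and D: "circuit_representatives Q {C. primitive_cycle Q C \<and> complete_cycle Q I C} D"
    and CG: "CG = basic_complete CHAR('k) D"
begin

text \<open>Two properties of a spanning tree are extracted: it joins all vertices, and each of its
  arrows is the only tree arrow across some cut.\<close>

lemma T_arcs: "T \<subseteq> arcs Q"
  and T_const: "(\<And>b. b \<in> T \<Longrightarrow> f (tail Q b) = f (head Q b)) \<Longrightarrow> u \<in> verts Q \<Longrightarrow> v \<in> verts Q \<Longrightarrow> f u = f v"
  and T_cut: "c \<in> T \<Longrightarrow> \<exists>S. tail Q c \<in> S \<and> head Q c \<notin> S \<and>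
    (\<forall>b\<in>T. b \<noteq> c \<longrightarrow> (tail Q b \<in> S \<longleftrightarrow> head Q b \<in> S))"
proof -
  obtain H where H: "spanning H Q" "Digraph_Component.connected H" "undirected_acyclic H" "T = arcs H"
    using tree by (auto simp: quiver_spanning_tree_def)
  have wf: "wf_digraph H" and V: "verts H = verts Q" and sel: "tail H = tail Q" "head H = head Q"
    and A: "arcs H \<subseteq> arcs Q"
    using H(1) by (auto simp: spanning_def subgraph_def compatible_def)
  show "T \<subseteq> arcs Q" using A H(4) by simp
  show "(\<And>b. b \<in> T \<Longrightarrow> f (tail Q b) = f (head Q b)) \<Longrightarrow> u \<in> verts Q \<Longrightarrow> v \<in> verts Q \<Longrightarrow> f u = f v"
    using connected_const[OF wf H(2), of f u v] by (simp add: V sel H(4))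
  show "\<exists>S. tail Q c \<in> S \<and> head Q c \<notin> S \<and> (\<forall>b\<in>T. b \<noteq> c \<longrightarrow> (tail Q b \<in> S \<longleftrightarrow> head Q b \<in> S))"
    if c: "c \<in> T"
  proof -
    obtain S where "tail H c \<in> S" "head H c \<notin> S"
      "\<And>b. b \<in> arcs H \<Longrightarrow> b \<noteq> c \<Longrightarrow> tail H b \<in> S \<longleftrightarrow> head H b \<in> S"
      using tree_cut[OF wf H(3)] c H(4) by blast
    then show ?thesis by (intro exI[of _ S]) (simp add: sel H(4))
  qed
qed

text \<open>An undirected tree contains no oriented cycle: the orbit leaves the set \<open>S\<close>
  of the cut at \<open>a\<close> with its first arrow, and no other tree arrow leads back into
  \<open>S\<close>, so it never returns to the tail of \<open>a\<close>.\<close>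

lemma orb_not_in_T: assumes "a \<in> per s" shows "\<exists>c\<in>orb s a. c \<in> arcs Q - T"
proof (rule ccontr)
  assume "\<not> ?thesis"
  then have T: "orb s a \<subseteq> T" using orb_per[OF assms] per_arcs by blast
  then obtain S where S: "tail Q a \<in> S" "head Q a \<notin> S"
    "\<forall>b\<in>T. b \<noteq> a \<longrightarrow> (tail Q b \<in> S \<longleftrightarrow> head Q b \<in> S)"
    using T_cut[of a] orb_self by blast
  have "tail Q ((nx s ^^ Suc i) a) \<notin> S" for i
  proof (induction i)
    case 0
    then show ?case using S(2) head_per[OF assms] by simp
  next
    case (Suc i)
    let ?b = "(nx s ^^ Suc i) a"
    have "?b \<in> per s" "?b \<in> T" using funpow_nx_per[OF assms] T by (auto simp only: orb_def)
    then have "head Q ?b \<notin> S" using Suc S by metis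
    then show ?case using head_per[OF \<open>?b \<in> per s\<close>] by simp
  qed
  from this[of "prd s a - 1"] show False
    using prd[OF assms] S(1) by simp
qed

lemma prd_orb: assumes a: "a \<in> per s" and b: "b \<in> orb s a" shows "prd s b = prd s a"
proof (rule dvd_antisym)
  have "closed s a (prd s a)" "closed s b (prd s b)"
    using prd[OF a] prd[OF orb_per[OF a b]] a orb_per[OF a b] by (simp_all add: closed_def)
  then show "prd s b dvd prd s a" "prd s a dvd prd s b"
    using closed_orb[of s a _ b] closed_orb[of s b _ a] b orb_sym[OF a b] by (auto simp: closed_iff_dvd)
qed

lemma blen_orb: "a \<in> per s \<Longrightarrow> b \<in> orb s a \<Longrightarrow> blen s b = blen s a"
  using prd_orb[of a s b] by (cases s) (simp_all add: blen_def)

definition BC :: "bool \<Rightarrow> ('v, 'a) path set" where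
  "BC s = (if s then CG else CB)"

text \<open>Squaring a representative changes neither its starting arrow nor its set of arrows, so
  \<open>CG\<close> inherits from \<open>D\<close> that exactly one member passes through each
  cyclic arrow.\<close>

lemma BC_cyc: "C \<in> BC s \<Longrightarrow> \<exists>a\<in>per s. C = cyc s a (blen s a)"
  and BC_ex1: "a \<in> per s \<Longrightarrow> \<exists>!C. C \<in> BC s \<and> a \<in> set (snd C)"
proof -
  note rB = representatives[of False CB, OF CB[unfolded cocomplete_cycle_iff]]
  note rD = representatives[of True D, OF D[unfolded complete_cycle_iff]]
  have cl: "closed s a (prd s a)" if "a \<in> per s" for s a
    using prd[OF that] that by (simp add: closed_def)
  define sq where "sq C = (if (2 :: 'k) \<noteq> 0 \<and> odd (plen C) then ppower C 2 else C)" for C :: "('v, 'a) path"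
  have CG_sq: "CG = sq ` D"
    unfolding CG basic_complete_def char_two sq_def by (auto simp: image_iff)
  have sq: "sq (cyc True a (prd True a)) = cyc True a (blen True a)" if "a \<in> per True" for a
    using ppower_cyc[OF cl[OF that], of 2] by (simp add: sq_def blen_def) (simp add: cyc_def plen_def)
  show "\<exists>a\<in>per s. C = cyc s a (blen s a)" if C: "C \<in> BC s"
  proof (cases s)
    case True
    then have "C \<in> CG" using C by (simp add: BC_def)
    then obtain C' where "C' \<in> D" "C = sq C'" using CG_sq by blast
    then show ?thesis using rD(1)[of C'] sq True by auto
  next
    case False
    then show ?thesis using rB(1)[of C] C by (auto simp: BC_def blen_def)
  qed
  show "\<exists>!C. C \<in> BC s \<and> a \<in> set (snd C)" if a: "a \<in> per s"
  proof (cases s)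
    case True
    have set: "set (snd (sq C)) = set (snd C)" if "C \<in> D" for C
    proof -
      obtain b where "b \<in> per True" "C = cyc True b (prd True b)" using rD(1) \<open>C \<in> D\<close> by blast
      then show ?thesis
        using sq[of b] set_ol[OF cl[of b True]] set_ol[OF closed_blen(1)[of b True]] by (simp add: cyc_def)
    qed
    have ex: "\<exists>!C. C \<in> D \<and> a \<in> set (snd C)" using rD(2)[of a] a True by simp
    then obtain C where C: "C \<in> D" "a \<in> set (snd C)" by blast
    have BC: "BC s = sq ` D" unfolding BC_def using True CG_sq by simp
    show ?thesis
    proof (rule ex1I[of _ "sq C"])
      show "sq C \<in> BC s \<and> a \<in> set (snd (sq C))" using C BC set[OF C(1)] by blast
      fix E assume E: "E \<in> BC s \<and> a \<in> set (snd E)"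
      then obtain C' where C': "C' \<in> D" "E = sq C'" using BC by blast
      then have "C' = C" using E set[OF C'(1)] ex C by metis
      then show "E = sq C" using C' by simp
    qed
  next
    case False
    then show ?thesis using rB(2)[of a] a by (simp add: BC_def)
  qed
qed

lemma BC_arrow:
  assumes C: "C \<in> BC s" and a: "a \<in> set (snd C)"
  shows "closed s a (plen C)" "sg s (plen C) = 1" "set (snd C) = orb s a" "plen C = blen s a" "a \<in> per s"
proof -
  obtain b where b: "b \<in> per s" "C = cyc s b (blen s b)" using BC_cyc[OF C] by blast
  have set: "set (snd C) = orb s b" using set_ol[OF closed_blen(1)[OF b(1)]] b(2) by (simp add: cyc_def)
  have len: "plen C = blen s b" using b(2) by (simp add: cyc_def plen_def)
  have ab: "a \<in> orb s b" using a set by simp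
  show "closed s a (plen C)" "sg s (plen C) = 1"
    using closed_orb[OF closed_blen(1)[OF b(1)] ab] closed_blen(2)[OF b(1)] len by auto
  show "set (snd C) = orb s a" using set orb_eq[OF b(1) ab] by simp
  show "plen C = blen s a" using len blen_orb[OF b(1) ab] by simp
  show "a \<in> per s" using orb_per[OF b(1) ab] .
qed

lemma BC_nonempty: "C \<in> BC s \<Longrightarrow> hd (snd C) \<in> set (snd C)" "C \<in> BC s \<Longrightarrow> plen C > 0"
proof -
  assume "C \<in> BC s"
  then obtain b where "b \<in> per s" "C = cyc s b (blen s b)" using BC_cyc by blast
  then have "length (snd C) > 0" using closed_pos[OF closed_blen(1)] by (simp add: cyc_def)
  then show "hd (snd C) \<in> set (snd C)" "plen C > 0" by (auto simp: plen_def)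
qed

lemma BC_eq: "C \<in> BC s \<Longrightarrow> C' \<in> BC s \<Longrightarrow> a \<in> set (snd C) \<Longrightarrow> a \<in> set (snd C') \<Longrightarrow> C = C'"
  using BC_ex1[of a s] BC_arrow(5) by blast

text \<open>Any arrow of \<open>C\<close> outside the tree would do, since by
  \<open>dc_rotate\<close> the resulting classes coincide. Fixing one makes the normal forms
  unique.\<close>

definition ch :: "('v, 'a) path \<Rightarrow> 'a" where
  "ch C = (SOME c. c \<in> set (snd C) \<and> c \<in> arcs Q - T)"

lemma ch: assumes "C \<in> BC s" shows "ch C \<in> set (snd C)" "ch C \<in> arcs Q - T"
proof -
  note a = BC_nonempty(1)[OF assms]
  have "\<exists>c. c \<in> set (snd C) \<and> c \<in> arcs Q - T"
    using orb_not_in_T[OF BC_arrow(5)[OF assms a]] BC_arrow(3)[OF assms a] by auto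
  from someI_ex[OF this] show "ch C \<in> set (snd C)" "ch C \<in> arcs Q - T"
    unfolding ch_def by auto
qed

definition IX :: "('v, 'a) idx set" where
  "IX = {Unit} \<union> Iso ` NN \<union> Arr ` (arcs Q - T)
    \<union> {Cyc s C n | s C n. C \<in> BC s \<and> n > 0} \<union> {ArrCyc s C n | s C n. C \<in> BC s \<and> n > 0}"

primrec repr :: "('v, 'a) idx \<Rightarrow> ('v, 'a, 'k) cochain" where
  "repr Unit = unit_cochain"
| "repr (Iso x) = basis x"
| "repr (Arr c) = basis (cc c)"
| "repr (Cyc s C n) = (\<Sum>a\<in>set (snd C). basis (zc s a (n * plen C)))"
| "repr (ArrCyc s C n) = basis (dc s (ch C) (n * plen C))"

lemma BC_mult:
  assumes "C \<in> BC s" "a \<in> set (snd C)" "n > 0"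
  shows "closed s a (n * plen C)" "sg s (n * plen C) = 1" "n * plen C > 0"
proof -
  show "closed s a (n * plen C)" using closed_mult BC_arrow(1)[OF assms(1,2)] assms(3) by blast
  show "sg s (n * plen C) = 1" using BC_arrow(2)[OF assms(1,2)] by (auto simp: sg_eq_1)
  show "n * plen C > 0" using assms(3) BC_nonempty(2)[OF assms(1)] by simp
qed

text \<open>The two halves of the differential are sums over the orbit that differ by the bijection
  \<open>nx\<close>; with sign 1 they cancel.\<close>

lemma d_orbit_sum:
  assumes c: "closed s a m" and sg: "sg s m = 1"
  shows "d (\<Sum>b\<in>orb s a. basis (zc s b m)) = 0"
proof -
  have per: "a \<in> per s" using c by (rule closed_per)
  note bij = bij_nx_orb[OF per]
  have "(\<Sum>b\<in>orb s a. basis (zc s b m)) = (\<Sum>b\<in>orb s a. basis (zc s (nx s b) m) :: ('v, 'a, 'k) cochain)"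
    by (rule sum.reindex_bij_betw[OF bij, symmetric])
  then have "d (\<Sum>b\<in>orb s a. basis (zc s b m)) = (\<Sum>b\<in>orb s a. d (basis (zc s (nx s b) m)))"
    by (simp add: klinearD(6)[OF klinear_d])
  also have "\<dots> = (\<Sum>b\<in>orb s a. basis (dc s (nx s b) m)) - (\<Sum>b\<in>orb s a. basis (dc s b m))"
    using closed_orb[OF c] by (simp add: d_zc sg sum_subtractf)
  also have "(\<Sum>b\<in>orb s a. basis (dc s (nx s b) m)) = (\<Sum>b\<in>orb s a. basis (dc s b m) :: ('v, 'a, 'k) cochain)"
    by (rule sum.reindex_bij_betw[OF bij])
  finally show ?thesis by simp
qed

lemma repr_Z: assumes "i \<in> IX" shows "repr i \<in> Z"
proof -
  consider "i = Unit" | x where "i = Iso x" "x \<in> NN" | c where "i = Arr c" "c \<in> arcs Q"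
    | s C n where "i = Cyc s C n" "C \<in> BC s" "n > 0" | s C n where "i = ArrCyc s C n" "C \<in> BC s" "n > 0"
    using assms by (auto simp: IX_def)
  then show ?thesis
  proof cases
    case 1
    then show ?thesis by (simp add: unit_Z)
  next
    case 2
    then have "x \<in> Y" "\<nexists>y. linkL x y" "\<nexists>y. linkR x y" by (auto simp: sq.isolated_def)
    then have "d (basis x) = 0" by (rule sq.D_0)
    then show ?thesis using 2 NN_X[OF 2(2)] by (simp add: Z_iff)
  next
    case 3
    then show ?thesis by (simp add: Z_iff cc_X d_cc)
  next
    case 4
    note a = BC_nonempty(1)[OF 4(2)]
    have "repr i \<in> kspace X"
      using 4 by (auto intro!: ksubspace_sum[OF ksubspace_kspace] zc_X BC_mult)
    moreover have "d (repr i) = 0"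
      using d_orbit_sum[OF BC_mult(1,2)[OF 4(2) a 4(3)]] BC_arrow(3)[OF 4(2) a] 4(1) by simp
    ultimately show ?thesis by (simp add: Z_iff)
  next
    case 5
    note c = BC_mult(1)[OF 5(2) ch(1)[OF 5(2)] 5(3)]
    show ?thesis using 5(1) dc_X[OF c] d_dc[OF c] by (simp add: Z_iff)
  qed
qed

text \<open>The span of the listed cocycles, enlarged by the coboundaries; the aim is that it
  contains all of \<open>Z\<close>.\<close>

definition SP :: "('v, 'a, 'k) cochain set" where
  "SP = {f. \<exists>l\<in>kspace IX. f - linear_ext repr l \<in> Bd}"

lemma ksubspace_SP: "ksubspace SP"
  unfolding SP_def by (rule ksubspace_mod_span[OF ksubspace_Bd])

lemma Bd_SP: "f \<in> Bd \<Longrightarrow> f \<in> SP"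
  unfolding SP_def using klinearD(3)[OF klinear_linear_ext[of repr]] kspace_intros(1)
  by (auto intro!: bexI[of _ 0])

lemma repr_SP: "i \<in> IX \<Longrightarrow> repr i \<in> SP"
  unfolding SP_def using ksubspaceD(1)[OF ksubspace_Bd] by (auto intro!: bexI[of _ "basis i"])

lemmas SP_intros = ksubspaceD[OF ksubspace_SP] ksubspace_sum[OF ksubspace_SP]

lemma SP_diff: "f - g \<in> SP \<Longrightarrow> g \<in> SP \<Longrightarrow> f \<in> SP"
  using SP_intros(2)[of "f - g" g] by simp

text \<open>For \<open>c\<close> in the tree, the coboundary of the indicator function of one side
  of its cut has coefficient 1 at \<open>cc c\<close> and otherwise involves only arrows outside the
  tree, since no other tree arrow crosses the cut.\<close>

lemma cc_SP: assumes c: "c \<in> arcs Q" shows "basis (cc c) \<in> SP"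
proof (cases "c \<in> T")
  case False
  then show ?thesis using repr_SP[of "Arr c"] c by (simp add: IX_def)
next
  case True
  obtain S where S: "tail Q c \<in> S" "head Q c \<notin> S"
    "\<forall>b\<in>T. b \<noteq> c \<longrightarrow> (tail Q b \<in> S \<longleftrightarrow> head Q b \<in> S)"
    using T_cut[OF True] by blast
  define g :: "('v, 'a, 'k) cochain" where "g = (\<Sum>v\<in>verts Q \<inter> S. basis (vv v))"
  have gX: "g \<in> kspace X" unfolding g_def by (rule ksubspace_sum[OF ksubspace_kspace]) (simp add: vv_X)
  have g: "Poly_Mapping.lookup g x = (if \<exists>v\<in>verts Q \<inter> S. x = vv v then 1 else 0)" for x
    unfolding g_def by (rule lookup_sum_basis) (auto simp: inj_on_def pr_eq_iff)
  let ?c = "\<lambda>b. (if tail Q b \<in> S then 1 else 0) - (if head Q b \<in> S then 1 else 0) :: 'k"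
  have "d g = (\<Sum>b\<in>arcs Q. scale (?c b) (basis (cc b)))"
  proof (rule poly_mapping_eqI)
    fix y
    have R: "Poly_Mapping.lookup (\<Sum>b\<in>arcs Q. scale (?c b) (basis (cc b))) y
        = (\<Sum>b\<in>arcs Q. ?c b * (if cc b = y then 1 else 0))"
      by (simp add: lookup_sum lookup_basis)
    show "Poly_Mapping.lookup (d g) y = Poly_Mapping.lookup (\<Sum>b\<in>arcs Q. scale (?c b) (basis (cc b))) y"
    proof (cases "\<exists>b\<in>arcs Q. y = cc b")
      case True
      then obtain b where b: "b \<in> arcs Q" "y = cc b" by blast
      have "(\<Sum>b'\<in>arcs Q. ?c b' * (if cc b' = y then 1 else 0)) = (\<Sum>b'\<in>arcs Q. if b' = b then ?c b' else 0)"
        by (rule sum.cong) (auto simp: b pr_eq_iff)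
      also have "\<dots> = ?c b" using b(1) by simp
      also have "\<dots> = Poly_Mapping.lookup (d g) y"
        using b(1) by (auto simp: b(2) lookup_d_cc[OF b(1) gX] g pr_eq_iff)
      finally show ?thesis unfolding R by simp
    next
      case False
      then have "(\<Sum>b\<in>arcs Q. ?c b * (if cc b = y then 1 else 0)) = 0"
        by (intro sum.neutral) auto
      moreover have "Poly_Mapping.lookup (d g) y = 0"
      proof (cases "y \<in> X")
        case True
        obtain u p q v where y: "y = pr True u p q" "walk True u p v"
          by (rule X_cases[OF True, of True])
        have "linkL x y \<Longrightarrow> x \<noteq> vv w" "linkR x y \<Longrightarrow> x \<noteq> vv w" for x w
          using False by (auto simp: linkL_pr linkR_pr in_X) blast+
        then have "shareL y \<Longrightarrow> chopL y \<noteq> vv w" "shareR y \<Longrightarrow> chopR y \<noteq> vv w" for w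
          using True unfolding linkL_def linkR_def by blast+
        then show ?thesis by (auto simp: lookup_d[OF gX True] g)
      qed (use kspace_lookup[OF d_in_X[OF gX]] in blast)
      ultimately show ?thesis unfolding R by simp
    qed
  qed
  also have "\<dots> = scale (?c c) (basis (cc c)) + (\<Sum>b\<in>arcs Q - {c}. scale (?c b) (basis (cc b)))"
    using c by (subst sum.remove[of _ c]) auto
  finally have "d g - (\<Sum>b\<in>arcs Q - {c}. scale (?c b) (basis (cc b))) = basis (cc c)"
    using S(1,2) by simp
  moreover have "scale (?c b) (basis (cc b)) \<in> SP" if "b \<in> arcs Q - {c}" for b
  proof (cases "b \<in> T")
    case True
    then have "?c b = 0" using S(3) that by auto
    then show ?thesis using SP_intros(1) by simp
  next
    case False
    then show ?thesis using repr_SP[of "Arr b"] that by (intro SP_intros(3)) (simp add: IX_def)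
  qed
  moreover have "d g \<in> SP" using Bd_I[OF gX] by (rule Bd_SP)
  ultimately show ?thesis using SP_intros(5)[of "d g"] SP_intros(6) by (metis (no_types, lifting))
qed

text \<open>Neighbouring \<open>dc\<close> differ by the factor \<open>sg s m\<close>, modulo the
  boundary of the \<open>zc\<close> between them; iteration collects the powers of this
  factor.\<close>

lemma dc_rotate:
  assumes "closed s a m"
  shows "basis (dc s ((nx s ^^ i) a) m) - scale (sg s m ^ i) (basis (dc s a m)) \<in> Bd"
proof (induction i)
  case 0
  then show ?case using ksubspaceD(1)[OF ksubspace_Bd] by simp
next
  case (Suc i)
  let ?b = "(nx s ^^ i) a"
  have b: "closed s ?b m" using closed_orb[OF assms] by (auto simp: orb_def)
  have "d (basis (zc s (nx s ?b) m)) \<in> Bd"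
    using zc_X[OF closed_nx[OF b]] by (intro Bd_I) simp
  then have "d (basis (zc s (nx s ?b) m))
      + scale (sg s m) (basis (dc s ?b m) - scale (sg s m ^ i) (basis (dc s a m))) \<in> Bd"
    using Suc by (intro ksubspaceD(2,3)[OF ksubspace_Bd])
  then show ?case
    by (simp add: d_zc[OF b] scale_distribs)
qed

text \<open>The sign is -1 and \<open>m\<close> is odd, so the \<open>m\<close> rotation steps that
  lead back to \<open>a\<close> multiply by -1. Twice the pair is then a coboundary, and 2 is
  nonzero.\<close>

lemma dc_Bd: assumes c: "closed s a m" and sg: "sg s m \<noteq> 1" shows "basis (dc s a m) \<in> Bd"
proof -
  have *: "s" "odd m" "(2 :: 'k) \<noteq> 0" using sg by (auto simp: sg_eq_1)
  then have sg: "sg s m ^ m = - 1" by (simp add: sg_def)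
  have "(nx s ^^ m) a = a" using c by (simp add: closed_def)
  then have "basis (dc s a m) + basis (dc s a m) \<in> Bd"
    using dc_rotate[OF c, of m] sg by simp
  then have "scale (1 / 2) (basis (dc s a m) + basis (dc s a m)) \<in> Bd" by (rule ksubspaceD(3)[OF ksubspace_Bd])
  moreover have "scale (1 / 2) (basis (dc s a m) + basis (dc s a m)) = (basis (dc s a m) :: ('v, 'a, 'k) cochain)"
    using *(3) by (auto intro!: poly_mapping_eqI simp: lookup_add field_simps)
  ultimately show ?thesis by simp
qed

text \<open>With sign 1, \<open>m\<close> is a multiple of the length of the basic cycle through
  \<open>a\<close>, and the rotation to the chosen arrow of that cycle costs no sign.\<close>

lemma dc_SP: assumes c: "closed s a m" shows "basis (dc s a m) \<in> SP"
proof (cases "sg s m = 1")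
  case True
  have a: "a \<in> per s" using c by (rule closed_per)
  then obtain C where C: "C \<in> BC s" "a \<in> set (snd C)" using BC_ex1 by blast
  have "blen s a dvd m" "m > 0" using blen_dvd[of s a m] True c by auto
  then obtain n where n: "m = n * plen C" "n > 0"
    using BC_arrow(4)[OF C] by (metis dvd_div_mult_self gr0I mult_0)
  have "ch C \<in> orb s a" using ch(1)[OF C(1)] BC_arrow(3)[OF C] by simp
  then have "a \<in> orb s (ch C)" using orb_sym[OF a] by simp
  then obtain i where i: "a = (nx s ^^ i) (ch C)" by (auto simp: orb_def)
  have "closed s (ch C) m" using BC_mult(1)[OF C(1) ch(1)[OF C(1)] n(2)] n(1) by simp
  from dc_rotate[OF this, of i] have "basis (dc s a m) - basis (dc s (ch C) m) \<in> SP"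
    using True i by (simp add: Bd_SP)
  moreover have "basis (dc s (ch C) m) \<in> SP"
    using repr_SP[of "ArrCyc s C n"] C n by (auto simp: IX_def)
  ultimately show ?thesis by (rule SP_diff)
qed (simp add: Bd_SP dc_Bd[OF c])

lemma zc_coeff:
  assumes c: "closed s a m" and r: "r \<in> Z"
  shows "Poly_Mapping.lookup r (zc s a m) = sg s m ^ i * Poly_Mapping.lookup r (zc s ((nx s ^^ i) a) m)"
proof (induction i)
  case (Suc i)
  have b: "closed s ((nx s ^^ i) a) m" using closed_orb[OF c] by (auto simp: orb_def)
  have "0 = Poly_Mapping.lookup r (zc s ((nx s ^^ i) a) m)
      - sg s m * Poly_Mapping.lookup r (zc s ((nx s ^^ Suc i) a) m)"
    using lookup_d_dc[OF b, of r] r by (simp add: Z_iff)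
  then show ?case using Suc by (simp add: mult.assoc[symmetric] mult.commute)
qed simp

text \<open>Induction on the number of terms \<open>zc\<close>. Such a term brings along its whole
  orbit with equal coefficients, so a multiple of the orbit sum can be subtracted within the
  cocycles. Once they are gone, only \<open>cc\<close> and \<open>dc\<close> remain.\<close>

lemma special_SP_aux:
  assumes "r \<in> Z" "r \<in> kspace {x \<in> X. special x}" "\<And>v. Poly_Mapping.lookup r (vv v) = 0"
  shows "r \<in> SP"
  using assms
proof (induction "card {x \<in> Poly_Mapping.keys r. \<exists>s a m. closed s a m \<and> x = zc s a m}"
    arbitrary: r rule: less_induct)
  case less
  let ?K = "\<lambda>r :: ('v, 'a, 'k) cochain. {x \<in> Poly_Mapping.keys r. \<exists>s a m. closed s a m \<and> x = zc s a m}"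
  show ?case
  proof (cases "?K r = {}")
    case True
    have "basis x \<in> SP" if x: "x \<in> Poly_Mapping.keys r" for x
    proof -
      have "x \<in> X" "special x" using less.prems(2) x by (auto simp: kspace_def)
      then show ?thesis
        by (cases rule: special_cases)
          (use x True less.prems(3) cc_SP dc_SP in \<open>auto simp: in_keys_iff\<close>)
    qed
    then show ?thesis
      by (intro klinear_memI[OF klinear_id ksubspace_SP, of r "Poly_Mapping.keys r"]) (auto simp: kspace_def)
  next
    case False
    then obtain s a m where c: "closed s a m" and k: "Poly_Mapping.lookup r (zc s a m) \<noteq> 0"
      by (auto simp: in_keys_iff)
    note co = zc_coeff[OF c less.prems(1)]
    \<comment> \<open>A full turn multiplies the nonzero coefficient by this power. For odd
      \<open>m\<close> the power is the sign itself; for even \<open>m\<close> the sign is 1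
      anyway.\<close>
    have "sg s m ^ m = 1"
      using co[of m] k c by (simp add: closed_def)
    then have sg: "sg s m = 1"
      by (cases "even m") (auto simp: sg_def split: if_splits)
    have a: "a \<in> per s" using c by (rule closed_per)
    then obtain C where C: "C \<in> BC s" "a \<in> set (snd C)" using BC_ex1 by blast
    have "blen s a dvd m" "m > 0" using blen_dvd[of s a m] sg c by auto
    then obtain n where n: "m = n * plen C" "n > 0"
      using BC_arrow(4)[OF C] by (metis dvd_div_mult_self gr0I mult_0)
    have IX: "Cyc s C n \<in> IX" using C n by (auto simp: IX_def)
    define l where "l = Poly_Mapping.lookup r (zc s a m)"
    define g where "g = repr (Cyc s C n)"
    have set: "set (snd C) = orb s a" using BC_arrow(3)[OF C] .
    have g: "Poly_Mapping.lookup g x = (if \<exists>b\<in>orb s a. x = zc s b m then 1 else 0)" for x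
      unfolding g_def repr.simps n(1)[symmetric] set
      by (rule lookup_sum_basis[OF finite_orb[OF a]]) (auto simp: inj_on_def zc_eq_iff[OF \<open>m > 0\<close>])
    define r' where "r' = r - scale l g"
    have gZ: "g \<in> Z" using repr_Z[OF IX] by (simp add: g_def)
    have gS: "g \<in> kspace {x \<in> X. special x}"
      unfolding g_def repr.simps n(1)[symmetric]
      by (rule ksubspace_sum[OF ksubspace_kspace])
        (use closed_orb[OF c] set in \<open>auto simp: zc_X special_basis(3)\<close>)
    have rb: "Poly_Mapping.lookup r (zc s b m) = l" if "b \<in> orb s a" for b
      using that co sg by (auto simp: orb_def l_def)
    have r': "Poly_Mapping.lookup r' x = (if \<exists>b\<in>orb s a. x = zc s b m then 0 else Poly_Mapping.lookup r x)" for x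
      by (auto simp: r'_def lookup_minus g rb)
    have "?K r' \<subset> ?K r"
    proof
      show "?K r' \<subseteq> ?K r" by (auto simp: in_keys_iff r' split: if_splits)
      have "zc s a m \<in> ?K r" using c k by (auto simp: in_keys_iff)
      moreover have "zc s a m \<notin> ?K r'" using orb_self[of a s] by (auto simp: in_keys_iff r')
      ultimately show "?K r' \<noteq> ?K r" by blast
    qed
    then have "card (?K r') < card (?K r)" by (intro psubset_card_mono) auto
    moreover have "r' \<in> Z"
      unfolding r'_def using less.prems(1) gZ by (intro ksubspaceD[OF ksubspace_Z])
    moreover have "r' \<in> kspace {x \<in> X. special x}"
      unfolding r'_def using less.prems(2) gS by (intro kspace_intros(5,3))
    moreover have "Poly_Mapping.lookup r' (vv v) = 0" for v
      using less.prems(3) by (simp add: r')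
    ultimately have "r' \<in> SP" by (rule less.hyps)
    moreover have "scale l g \<in> SP" using repr_SP[OF IX] by (simp add: g_def SP_intros(3))
    ultimately show ?thesis using SP_diff[of r "scale l g"] by (simp add: r'_def)
  qed
qed

lemma lookup_unit: "Poly_Mapping.lookup unit_cochain x = (if \<exists>v\<in>verts Q. x = vv v then 1 else 0)"
  unfolding unit_cochain_def by (rule lookup_sum_basis) (auto simp: inj_on_def pr_eq_iff)

lemma obtain_vertex: obtains v where "v \<in> verts Q"
  using arrows tail_in_verts by blast

text \<open>The special part is a cocycle, so its coefficients at \<open>vv\<close> agree at the
  ends of every arrow. They form one constant, and that multiple of the unit removes them
  all.\<close>

theorem cocycle_SP: assumes f: "f \<in> Z" shows "f \<in> SP"
proof -
  obtain g e r where *: "g \<in> kspace X" "e \<in> kspace NN" "r \<in> kspace {x \<in> X. special x}"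
    "f = d g + e + r" "d r = 0"
    by (rule split_special[OF f])
  have rX: "r \<in> kspace X" using *(3) by (rule kspace_mono[rotated]) blast
  have "e \<in> SP"
  proof (rule klinear_memI[OF klinear_id ksubspace_SP *(2)])
    fix x assume "x \<in> NN"
    then show "basis x \<in> SP" using repr_SP[of "Iso x"] by (simp add: IX_def)
  qed
  moreover have "d g \<in> SP" using Bd_SP[OF Bd_I[OF *(1)]] .
  moreover have "r \<in> SP"
  proof -
    obtain v0 where v0: "v0 \<in> verts Q" by (rule obtain_vertex)
    define l where "l = Poly_Mapping.lookup r (vv v0)"
    have const: "Poly_Mapping.lookup r (vv v) = l" if "v \<in> verts Q" for v
      unfolding l_def
    proof (rule T_const[OF _ that v0])
      fix b assume "b \<in> T"
      then have b: "b \<in> arcs Q" using T_arcs by blast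
      show "Poly_Mapping.lookup r (vv (tail Q b)) = Poly_Mapping.lookup r (vv (head Q b))"
        using lookup_d_cc[OF b rX] *(5) by simp
    qed
    have "r - scale l unit_cochain \<in> SP"
    proof (rule special_SP_aux)
      have "r \<in> Z" using rX *(5) by (simp add: Z_iff)
      then show "r - scale l unit_cochain \<in> Z"
        using unit_Z by (intro ksubspaceD[OF ksubspace_Z])
      have "unit_cochain \<in> kspace {x \<in> X. special x}"
        unfolding unit_cochain_def
        by (rule ksubspace_sum[OF ksubspace_kspace]) (simp add: vv_X special_basis(1))
      then show "r - scale l unit_cochain \<in> kspace {x \<in> X. special x}"
        using *(3) by (intro kspace_intros(5,3))
      show "Poly_Mapping.lookup (r - scale l unit_cochain) (vv v) = 0" for v
      proof (cases "v \<in> verts Q")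
        case True
        then have "\<exists>w\<in>verts Q. vv v = vv w" by blast
        then show ?thesis using const[OF True] by (simp add: lookup_minus lookup_unit)
      next
        case False
        then have "vv v \<notin> X" by (simp add: in_X)
        then show ?thesis
          using kspace_lookup[OF rX, of "vv v"] kspace_lookup[OF unit_in_X, of "vv v"]
          by (simp add: lookup_minus)
      qed
    qed
    moreover have "scale l unit_cochain \<in> SP"
      using repr_SP[of Unit] by (intro SP_intros(3)) (simp add: IX_def)
    ultimately show ?thesis by (rule SP_diff)
  qed
  ultimately show ?thesis unfolding *(4) by (intro SP_intros(2))
qed

end

section \<open>Linear independence of the listed classes\<close>

context gentle_data
begin

text \<open>Independence is shown by functionals dual to \<open>repr\<close>. The set
  \<open>A\<close> is there for \<open>ArrCyc\<close>: a single coefficient at \<open>dc\<close>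
  does not vanish on coboundaries in general, while the sum along the orbit does.\<close>

lemma repr_functional:
  assumes l: "l \<in> kspace IX" and A: "finite A"
    and j: "\<And>i. i \<in> IX \<Longrightarrow> (\<Sum>z\<in>A. Poly_Mapping.lookup (repr i) z) = (if i = j then 1 else 0)"
  shows "(\<Sum>z\<in>A. Poly_Mapping.lookup (linear_ext repr l) z) = Poly_Mapping.lookup l j"
proof -
  have "(\<Sum>z\<in>A. Poly_Mapping.lookup (linear_ext repr l) z)
      = (\<Sum>i\<in>Poly_Mapping.keys l. Poly_Mapping.lookup l i * (\<Sum>z\<in>A. Poly_Mapping.lookup (repr i) z))"
    by (simp add: lookup_linear_ext sum_distrib_left) (rule sum.swap)
  also have "\<dots> = (\<Sum>i\<in>Poly_Mapping.keys l. if i = j then Poly_Mapping.lookup l i else 0)"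
    using l j by (intro sum.cong) (auto simp: kspace_def)
  also have "\<dots> = Poly_Mapping.lookup l j" by (simp add: in_keys_iff)
  finally show ?thesis .
qed

lemma IX_cases:
  assumes "i \<in> IX"
  obtains "i = Unit" | x where "i = Iso x" "x \<in> NN" | c where "i = Arr c" "c \<in> arcs Q" "c \<notin> T"
    | s C n where "i = Cyc s C n" "C \<in> BC s" "n > 0" | s C n where "i = ArrCyc s C n" "C \<in> BC s" "n > 0"
  using assms by (auto simp: IX_def)

lemma lookup_Cyc:
  assumes "C \<in> BC s" "n > 0"
  shows "Poly_Mapping.lookup (repr (Cyc s C n)) x = (if \<exists>a\<in>set (snd C). x = zc s a (n * plen C) then 1 else 0)"
  unfolding repr.simps
  by (rule lookup_sum_basis) (auto simp: inj_on_def zc_eq_iff[OF BC_mult(3)[OF assms(1) BC_nonempty(1)[OF assms(1)] assms(2)]])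

lemma NN_ne: "x \<in> NN \<Longrightarrow> special z \<Longrightarrow> x \<noteq> z"
  using NN_not_special by blast

lemma BC_same:
  assumes "C \<in> BC s" "n > 0" "a \<in> set (snd C)" "C' \<in> BC s" "a \<in> set (snd C')" "n * plen C = n' * plen C'"
  shows "C = C' \<and> n = n'"
  using BC_eq[OF assms(1,4,3,5)] assms(6) BC_nonempty(2)[OF assms(1)] by simp

lemma repr_at_Cyc:
  assumes C: "C \<in> BC s" "n > 0" "a \<in> set (snd C)" and i: "i \<in> IX"
  shows "Poly_Mapping.lookup (repr i) (zc s a (n * plen C)) = (if i = Cyc s C n then 1 else 0)"
proof -
  note m = BC_mult[OF C(1,3,2)]
  note ne = basis_distinct(1-4)[OF m(3)]
  show ?thesis
    using i
  proof (cases rule: IX_cases)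
    case 1
    then show ?thesis using ne by (auto simp: lookup_unit)
  next
    case (2 x)
    then show ?thesis using NN_ne special_basis(3)[OF m(1)] by (auto simp: lookup_basis)
  next
    case (3 c)
    then show ?thesis using ne(2)[of s a c] by (auto simp: lookup_basis)
  next
    case (4 s' C' n')
    show ?thesis
    proof (cases "\<exists>b\<in>set (snd C'). zc s a (n * plen C) = zc s' b (n' * plen C')")
      case True
      then have "s' = s" "a \<in> set (snd C')" "n * plen C = n' * plen C'"
        by (auto simp: zc_eq_iff[OF m(3)])
      moreover have "C' \<in> BC s" using 4(2) calculation(1) by simp
      ultimately have "C = C' \<and> n = n'" using BC_same[OF C(1,2,3), of C' n'] by blast
      then show ?thesis unfolding 4(1) lookup_Cyc[OF 4(2,3)] using True \<open>s' = s\<close> by simp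
    next
      case False
      then have "\<not> (s' = s \<and> C' = C \<and> n' = n)" using C(3) by blast
      then show ?thesis unfolding 4(1) lookup_Cyc[OF 4(2,3)] using False by auto
    qed
  next
    case (5 s' C' n')
    then show ?thesis using ne(1)[of s a s'] by (auto simp: lookup_basis eq_commute[of "dc _ _ _"])
  qed
qed

lemma repr_at_ArrCyc:
  assumes C: "C \<in> BC s" "n > 0" "a \<in> set (snd C)" and i: "i \<in> IX"
  shows "Poly_Mapping.lookup (repr i) (dc s a (n * plen C)) = (if i = ArrCyc s C n \<and> a = ch C then 1 else 0)"
proof -
  note m = BC_mult[OF C(1,3,2)]
  show ?thesis
    using i
  proof (cases rule: IX_cases)
    case 1
    then show ?thesis using basis_distinct(5)[of s a "n * plen C"] by (auto simp: lookup_unit)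
  next
    case (2 x)
    then show ?thesis using NN_ne special_basis(4)[OF m(1)] by (auto simp: lookup_basis)
  next
    case (3 c)
    then show ?thesis using basis_distinct(4)[OF m(3), of s a c] by (auto simp: lookup_basis)
  next
    case (4 s' C' n')
    have "n' * plen C' > 0" using 4 BC_nonempty(2) by simp
    then have "dc s a (n * plen C) \<noteq> zc s' b (n' * plen C')" for b
      using basis_distinct(1) by metis
    then show ?thesis unfolding 4(1) lookup_Cyc[OF 4(2,3)] by simp
  next
    case (5 s' C' n')
    have "dc s' (ch C') (n' * plen C') = dc s a (n * plen C) \<longleftrightarrow> s' = s \<and> C' = C \<and> n' = n \<and> a = ch C"
    proof
      assume "dc s' (ch C') (n' * plen C') = dc s a (n * plen C)"
      then have "dc s a (n * plen C) = dc s' (ch C') (n' * plen C')" by (rule sym)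
      then have *: "s = s'" "a = ch C'" "n * plen C = n' * plen C'" by (auto simp: dc_eq_iff[OF m(3)])
      moreover have "C' \<in> BC s" "a \<in> set (snd C')" using 5(2) ch(1)[OF 5(2)] * by simp_all
      ultimately have "C = C' \<and> n = n'" using BC_same[OF C(1,2,3), of C' n'] by blast
      then show "s' = s \<and> C' = C \<and> n' = n \<and> a = ch C" using * by simp
    qed auto
    then show ?thesis unfolding 5(1) by (auto simp: lookup_basis)
  qed
qed

text \<open>Every coefficient of \<open>l\<close> is read off from the coboundary. For
  \<open>Unit\<close>, \<open>Iso\<close> and \<open>Cyc\<close> this happens at a pair without a
  shared end arrow, where coboundaries vanish; for \<open>ArrCyc\<close> the sum along the orbit
  telescopes, the sign of a rotation step being 1.\<close>

theorem repr_independent: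
  assumes l: "l \<in> kspace IX" and B: "linear_ext repr l \<in> Bd"
  shows "l = 0"
proof (rule poly_mapping_eqI)
  fix j
  obtain g where g: "g \<in> kspace X" "linear_ext repr l = d g"
    using B by (auto simp: coboundaries_def)
  obtain v0 where v0: "v0 \<in> verts Q" by (rule obtain_vertex)
  have single: "Poly_Mapping.lookup (linear_ext repr l) z = Poly_Mapping.lookup l j"
    if "\<And>i. i \<in> IX \<Longrightarrow> Poly_Mapping.lookup (repr i) z = (if i = j then 1 else 0)" for z j
    using repr_functional[OF l, of "{z}" j] that by simp
  have "Poly_Mapping.lookup l j = 0"
  proof (cases "j \<in> IX")
    case True
    then show ?thesis
    proof (cases rule: IX_cases)
      case 1
      have "Poly_Mapping.lookup (linear_ext repr l) (vv v0) = Poly_Mapping.lookup l j"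
      proof (rule single)
        fix i assume "i \<in> IX"
        then show "Poly_Mapping.lookup (repr i) (vv v0) = (if i = j then 1 else 0)"
        proof (cases rule: IX_cases)
          case (2 x)
          then show ?thesis using NN_ne special_basis(1)[of v0] 1 by (auto simp: lookup_basis)
        next
          case (3 c)
          then show ?thesis using basis_distinct(6)[of c v0] 1 by (auto simp: lookup_basis)
        next
          case (4 s C n)
          then show ?thesis using basis_distinct(3)[of "n * plen C" s _ v0] BC_nonempty(2)[OF 4(2)] 1
            unfolding 4(1) lookup_Cyc[OF 4(2,3)] by fastforce
        next
          case (5 s C n)
          then show ?thesis using basis_distinct(5)[of s _ _ v0] 1 by (auto simp: lookup_basis)
        qed (use v0 1 in \<open>auto simp: lookup_unit\<close>)
      qed
      then show ?thesis using lookup_Bd_unshared[OF B, of "vv v0"] v0 by (simp add: vv_X)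
    next
      case (2 x)
      have "Poly_Mapping.lookup (linear_ext repr l) x = Poly_Mapping.lookup l j"
      proof (rule single)
        fix i assume "i \<in> IX"
        then show "Poly_Mapping.lookup (repr i) x = (if i = j then 1 else 0)"
        proof (cases rule: IX_cases)
          case 1
          then show ?thesis using NN_ne[OF 2(2) special_basis(1)] 2 by (auto simp: lookup_unit)
        next
          case (3 c)
          then show ?thesis using NN_ne[OF 2(2) special_basis(2), of c] 2 by (auto simp: lookup_basis)
        next
          case (4 s C n)
          have "\<not> (\<exists>a\<in>set (snd C). x = zc s a (n * plen C))"
            using NN_ne[OF 2(2) special_basis(3)] BC_mult(1)[OF 4(2) _ 4(3)] by blast
          then show ?thesis using 2 unfolding 4(1) lookup_Cyc[OF 4(2,3)] by auto
        next
          case (5 s C n)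
          then show ?thesis
            using NN_ne[OF 2(2) special_basis(4)[OF BC_mult(1)[OF 5(2) ch(1)[OF 5(2)] 5(3)]]] 2
            by (auto simp: lookup_basis)
        qed (use 2 in \<open>auto simp: lookup_basis\<close>)
      qed
      then show ?thesis using lookup_Bd_unshared[OF B NN_X[OF 2(2)] NN_not_share[OF 2(2)]] by simp
    next
      case (3 c)
      have cc: "Poly_Mapping.lookup (linear_ext repr l) (cc b) = Poly_Mapping.lookup l (Arr b)" for b
      proof (rule single)
        fix i assume "i \<in> IX"
        then show "Poly_Mapping.lookup (repr i) (cc b) = (if i = Arr b then 1 else 0)"
        proof (cases rule: IX_cases)
          case 1
          then show ?thesis using basis_distinct(6) by (auto simp: lookup_unit)
        next
          case (2 x)
          then show ?thesis using NN_ne special_basis(2)[of b] by (auto simp: lookup_basis)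
        next
          case (4 s C n)
          then show ?thesis using basis_distinct(2)[of "n * plen C" s _ b] BC_nonempty(2)[OF 4(2)]
            unfolding 4(1) lookup_Cyc[OF 4(2,3)] by fastforce
        next
          case (5 s C n)
          then show ?thesis using basis_distinct(4)[of "n * plen C" s _ b] BC_nonempty(2)[OF 5(2)]
            by (auto simp: lookup_basis)
        qed (auto simp: lookup_basis pr_eq_iff)
      qed
      let ?g = "\<lambda>v. Poly_Mapping.lookup g (vv v)"
      have d: "Poly_Mapping.lookup l (Arr b) = ?g (tail Q b) - ?g (head Q b)" if "b \<in> arcs Q" for b
        using cc[of b] lookup_d_cc[OF that g(1)] g(2) by simp
      \<comment> \<open>Tree arrows have no index in \<open>IX\<close>, so their coefficients in
        \<open>l\<close> are zero and \<open>?g\<close> agrees at their ends. Thus \<open>?g\<close>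
        is constant on all vertices, and its coboundary vanishes at \<open>c\<close> as
        well.\<close>
      have "?g (tail Q c) = ?g (head Q c)"
      proof (rule T_const[of ?g])
        fix b assume b: "b \<in> T"
        then have "Arr b \<notin> IX" by (auto simp: IX_def)
        then show "?g (tail Q b) = ?g (head Q b)"
          using d[of b] b T_arcs kspace_lookup[OF l] by auto
      qed (use 3 in auto)
      then show ?thesis using d[OF 3(2)] 3(1) by simp
    next
      case (4 s C n)
      note a = BC_nonempty(1)[OF 4(2)]
      let ?z = "zc s (hd (snd C)) (n * plen C)"
      have "Poly_Mapping.lookup (linear_ext repr l) ?z = Poly_Mapping.lookup l j"
        using repr_at_Cyc[OF 4(2,3) a] by (intro single) (simp add: 4(1))
      moreover have "Poly_Mapping.lookup (linear_ext repr l) ?z = 0"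
        by (rule lookup_Bd_unshared[OF B zc_X[OF BC_mult(1)[OF 4(2) a 4(3)]]]) (simp_all add: zc_def)
      ultimately show ?thesis by simp
    next
      case (5 s C n)
      note c = BC_mult[OF 5(2) _ 5(3)]
      note a = BC_nonempty(1)[OF 5(2)]
      let ?O = "set (snd C)" let ?m = "n * plen C"
      let ?F = "linear_ext repr l"
      have inj: "inj_on (\<lambda>a. dc s a ?m) ?O"
        using c(3)[OF a] by (auto simp: inj_on_def dc_eq_iff)
      have "(\<Sum>z\<in>(\<lambda>a. dc s a ?m) ` ?O. Poly_Mapping.lookup ?F z) = Poly_Mapping.lookup l j"
      proof (rule repr_functional[OF l])
        fix i assume i: "i \<in> IX"
        have "(\<Sum>z\<in>(\<lambda>a. dc s a ?m) ` ?O. Poly_Mapping.lookup (repr i) z)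
            = (\<Sum>a\<in>?O. if a = ch C then (if i = ArrCyc s C n then 1 else 0) else 0)"
          unfolding sum.reindex[OF inj] using repr_at_ArrCyc[OF 5(2,3) _ i] by (intro sum.cong) auto
        then show "(\<Sum>z\<in>(\<lambda>a. dc s a ?m) ` ?O. Poly_Mapping.lookup (repr i) z) = (if i = j then 1 else 0)"
          using ch(1)[OF 5(2)] 5(1) by simp
      qed simp
      moreover have "(\<Sum>z\<in>(\<lambda>a. dc s a ?m) ` ?O. Poly_Mapping.lookup ?F z)
          = (\<Sum>a\<in>?O. Poly_Mapping.lookup g (zc s a ?m) - Poly_Mapping.lookup g (zc s (nx s a) ?m))"
        unfolding sum.reindex[OF inj] g(2) using c lookup_d_dc[OF _ g(1)] by (intro sum.cong) auto
      moreover have "(\<Sum>a\<in>?O. Poly_Mapping.lookup g (zc s (nx s a) ?m)) = (\<Sum>a\<in>?O. Poly_Mapping.lookup g (zc s a ?m))"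
        using bij_nx_orb[OF BC_arrow(5)[OF 5(2) a]] BC_arrow(3)[OF 5(2) a]
        by (intro sum.reindex_bij_betw) simp
      ultimately show ?thesis by (simp add: sum_subtractf)
    qed
  qed (use kspace_lookup[OF l] in auto)
  then show "Poly_Mapping.lookup l j = Poly_Mapping.lookup 0 j" by simp
qed

section \<open>Products of the generators\<close>

lemma cup_zc_zc:
  assumes a: "closed s a m" and b: "closed s b n"
  shows "cup_basis Q I (zc s a m) (zc s b n) = (if a = b then basis (zc s a (m + n)) else 0)"
proof -
  have wN: "walk (\<not> s) (tail Q a) [] (tail Q a)" "walk (\<not> s) (tail Q b) [] (tail Q b)"
    using per_arcs[OF closed_per[OF a]] per_arcs[OF closed_per[OF b]] by simp_all
  note c = cup_basis_pr[OF walk_closed[OF a] wN(1) walk_closed[OF b] wN(2)]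
  show ?thesis
  proof (cases "a = b")
    case True
    have "ol s a n @ ol s a m = ol s a (m + n)"
      using ol_add[of s a n m] b True by (simp add: closed_def add.commute)
    then show ?thesis
      using c zc_X[OF closed_add[OF a b[folded True]]] True by (simp add: zc_def)
  next
    case False
    have "st s (last (ol s b n)) a" if "pr s (tail Q b) (ol s b n @ ol s a m) [] \<in> X"
      using that closed_pos[OF a] closed_pos[OF b] by (auto simp: in_X walk_append)
    then have "pr s (tail Q b) (ol s b n @ ol s a m) [] \<notin> X"
      using False st_last_ol[OF b] st_succ_unique by blast
    then show ?thesis using c False by (simp add: zc_def)
  qed
qed

lemma cup_cc_zc:
  assumes a: "closed s a m" and c: "c \<in> arcs Q"
  shows "cup_basis Q I (cc c) (zc s a m) = (if c = a then basis (dc s a m) else 0)"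
proof -
  have wN: "walk (\<not> s) (tail Q a) [] (tail Q a)" "walk s (tail Q c) [c] (head Q c)" "walk (\<not> s) (tail Q c) [c] (head Q c)"
    using per_arcs[OF closed_per[OF a]] c by simp_all
  note cu = cup_basis_pr[OF wN(2,3) walk_closed[OF a] wN(1)]
  have "st s (last (ol s a m)) c" if "pr s (tail Q a) (ol s a m @ [c]) [c] \<in> X"
    using that closed_pos[OF a] by (auto simp: in_X walk_append)
  then have ne: "c = a" if "pr s (tail Q a) (ol s a m @ [c]) [c] \<in> X"
    using that st_last_ol[OF a] st_succ_unique by metis
  show ?thesis
  proof (cases "c = a")
    case True
    have "dc s a m = pr s (tail Q a) (ol s a m @ [c]) [c]"
      using True a by (simp add: dc_def ol_snoc closed_def)
    then show ?thesis
      using cu dc_X[OF a] True by (simp add: zc_def cc_pr[of _ s])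
  next
    case False
    then show ?thesis using cu ne by (auto simp: zc_def cc_pr[of _ s])
  qed
qed

text \<open>Here the arrow is traversed before the cycle, so it has to precede \<open>a\<close>, and
  the result is the circuit begun at \<open>c\<close>.\<close>

lemma cup_zc_cc:
  assumes a: "closed s a m" and c: "c \<in> arcs Q"
  shows "cup_basis Q I (zc s a m) (cc c) = (if st s c a then basis (dc s c m) else 0)"
proof -
  have wN: "walk (\<not> s) (tail Q a) [] (tail Q a)" "walk s (tail Q c) [c] (head Q c)" "walk (\<not> s) (tail Q c) [c] (head Q c)"
    using per_arcs[OF closed_per[OF a]] c by simp_all
  note cu = cup_basis_pr[OF walk_closed[OF a] wN(1) wN(2,3)]
  have ne: "st s c a" if "pr s (tail Q c) ([c] @ ol s a m) [c] \<in> X"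
    using that closed_pos[OF a] by (auto simp: in_X walk_Cons)
  show ?thesis
  proof (cases "st s c a")
    case True
    then have p: "c \<in> per s" "nx s c = a" using st_per[OF closed_per[OF a]] by auto
    have "closed s c m"
      using closed_orb[OF a] orb_sym[OF p(1)] nx_orb[of s c] p(2) by metis
    moreover have "dc s c m = pr s (tail Q c) ([c] @ ol s a m) [c]"
      using p by (simp add: dc_def ol_Suc)
    ultimately show ?thesis
      using cu dc_X[of s c m] True st_arcs[OF True] by (simp add: zc_def cc_pr[of _ s])
  next
    case False
    then show ?thesis using cu ne by (auto simp: zc_def cc_pr[of _ s])
  qed
qed

abbreviation ZS :: "bool \<Rightarrow> ('v, 'a) path \<Rightarrow> nat \<Rightarrow> ('v, 'a, 'k) cochain" where
  "ZS s C n \<equiv> repr (Cyc s C n)"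

lemma ZS_mult:
  assumes C: "C \<in> BC s" "C' \<in> BC s" and n: "n > 0" "n' > 0"
  shows "ZS s C n \<star> ZS s C' n' = (if C = C' then ZS s C (n + n') else 0)"
proof -
  have "ZS s C n \<star> ZS s C' n' = (\<Sum>a\<in>set (snd C). \<Sum>b\<in>set (snd C').
      if a = b then basis (zc s a (n * plen C + n' * plen C')) else 0)"
    unfolding repr.simps klinearD(6)[OF klinear_bilinear_left]
    unfolding klinearD(6)[OF klinear_bilinear_right] bilinear_ext_basis
    by (rule sum.cong[OF refl], rule sum.cong[OF refl]) (simp add: cup_zc_zc BC_mult C n)
  also have "\<dots> = (if C = C' then ZS s C (n + n') else 0)"
  proof (cases "C = C'")
    case True
    then show ?thesis by (simp add: distrib_right)
  next
    case False
    then have "a \<noteq> b" if "a \<in> set (snd C)" "b \<in> set (snd C')" for a b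
      using BC_eq[OF C] that by blast
    then show ?thesis using False by (auto intro!: sum.neutral)
  qed
  finally show ?thesis .
qed

text \<open>In either order exactly one rotation survives, the one begun at \<open>c\<close> or the
  one begun at \<open>nx s c\<close>, and both give the same pair. Arrows and circuits therefore
  commute already as cochains, without a sign.\<close>

lemma cc_ZS:
  assumes C: "C \<in> BC s" and n: "n > 0" and c: "c \<in> arcs Q"
  shows "basis (cc c) \<star> ZS s C n = (if c \<in> set (snd C) then basis (dc s c (n * plen C)) else 0)"
    and "ZS s C n \<star> basis (cc c) = (if c \<in> set (snd C) then basis (dc s c (n * plen C)) else 0)"
proof -
  have "basis (cc c) \<star> ZS s C n = (\<Sum>a\<in>set (snd C). if c = a then basis (dc s a (n * plen C)) else 0)"
    unfolding repr.simps bilinear_simps using C n c by (intro sum.cong) (simp_all add: cup_cc_zc BC_mult)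
  then show "basis (cc c) \<star> ZS s C n = (if c \<in> set (snd C) then basis (dc s c (n * plen C)) else 0)"
    by simp
  have 1: "ZS s C n \<star> basis (cc c) = (\<Sum>a\<in>set (snd C). if st s c a then basis (dc s c (n * plen C)) else 0)"
    unfolding repr.simps bilinear_simps using C n c by (intro sum.cong) (simp_all add: cup_zc_cc BC_mult)
  show "ZS s C n \<star> basis (cc c) = (if c \<in> set (snd C) then basis (dc s c (n * plen C)) else 0)"
  proof (cases "c \<in> set (snd C)")
    case True
    note b = BC_arrow(3,5)[OF C True]
    have "st s c a \<longleftrightarrow> a = nx s c" for a
      using per_nx(1)[OF b(2)] st_nx by blast
    then have "(\<Sum>a\<in>set (snd C). if st s c a then basis (dc s c (n * plen C)) else 0)
        = (\<Sum>a\<in>set (snd C). if a = nx s c then basis (dc s c (n * plen C)) else 0 :: ('v, 'a, 'k) cochain)"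
      by simp
    also have "\<dots> = basis (dc s c (n * plen C))"
      using nx_orb[of s c] b(1) finite_orb[OF b(2)] by simp
    finally show ?thesis using 1 True by simp
  next
    case False
    have "\<not> st s c a" if a: "a \<in> set (snd C)" for a
    proof
      assume "st s c a"
      then have "c \<in> per s" "nx s c = a" using st_per[OF BC_arrow(5)[OF C a]] by auto
      then have "c \<in> orb s a" using orb_sym[OF _ nx_orb] by metis
      then show False using False BC_arrow(3)[OF C a] by simp
    qed
    then show ?thesis using 1 False by (auto intro!: sum.neutral)
  qed
qed

lemma cc_cc: "b \<in> arcs Q \<Longrightarrow> c \<in> arcs Q \<Longrightarrow> basis (cc b) \<star> basis (cc c) = 0"
  using cup_basis_pr[of True "tail Q b" "[b]" "head Q b" "[b]" "tail Q c" "[c]" "head Q c" "[c]"]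
  by (auto simp: in_X walk_Cons dest: st_excl)

text \<open>A nontrivial component of an isolated pair cannot be prolonged, so only trivial components can meet it.\<close>

lemma NN_cup:
  assumes x: "x \<in> NN" and y: "y \<in> X"
  shows "cup_basis Q I x y = 0 \<or>
      (\<exists>s w p q. p \<noteq> [] \<and> x = pr s w p [] \<and> y = pr (\<not> s) w q []) \<or> y = vv (psrc (fst x))"
    and "cup_basis Q I y x = 0 \<or>
      (\<exists>s w p q. p \<noteq> [] \<and> x = pr s w p [] \<and> y = pr (\<not> s) w q []) \<or> y = vv (tgt x)"
proof -
  obtain u p q v where x': "x = pr True u p q" "walk True u p v" "walk False u q v"
    by (rule X_cases[OF NN_X[OF x], of True]) simp
  obtain u' p' q' v' where y': "y = pr True u' p' q'" "walk True u' p' v'" "walk False u' q' v'"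
    by (rule X_cases[OF y, of True]) simp
  have xF: "pr False u q p \<in> NN" using x x'(1) by (simp add: pr_def)
  have xT: "pr True u p q \<in> NN" using x x'(1) by simp
  have ne: "p \<noteq> [] \<or> q \<noteq> []" using NN_not_special[OF x] by (auto simp: x' special_pr)
  have e: "p \<noteq> [] \<Longrightarrow> \<not> st True (last p) b" "p \<noteq> [] \<Longrightarrow> \<not> st True b (hd p)"
    "q \<noteq> [] \<Longrightarrow> \<not> st False (last q) b" "q \<noteq> [] \<Longrightarrow> \<not> st False b (hd q)" for b
    using NN_no_extension[OF xT] NN_no_extension[OF xF] by auto
  have fin: "(\<exists>s w p q. p \<noteq> [] \<and> x = pr s w p [] \<and> y = pr (\<not> s) w q []) \<or> (y = vv u' \<and> p' = [] \<and> q' = [])"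
    if "p \<noteq> [] \<longrightarrow> p' = []" "q \<noteq> [] \<longrightarrow> q' = []" "u' = u"
  proof -
    have "p \<noteq> [] \<Longrightarrow> q = [] \<Longrightarrow> x = pr True u p [] \<and> y = pr (\<not> True) u q' []"
      "q \<noteq> [] \<Longrightarrow> p = [] \<Longrightarrow> x = pr False u q [] \<and> y = pr (\<not> False) u p' []"
      using that x'(1) y'(1) by (auto simp: pr_def)
    then show ?thesis using ne that y'(1) by blast
  qed
  show "cup_basis Q I x y = 0 \<or>
      (\<exists>s w p q. p \<noteq> [] \<and> x = pr s w p [] \<and> y = pr (\<not> s) w q []) \<or> y = vv (psrc (fst x))"
  proof (cases "v' = u \<and> pr True u' (p' @ p) (q' @ q) \<in> X")
    case True
    then have m: "p \<noteq> [] \<longrightarrow> p' = []" "q \<noteq> [] \<longrightarrow> q' = []"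
      using e(2)[of "last p'"] e(4)[of "last q'"] by (auto simp: in_X walk_append)
    then have "u' = u" using ne True y'(2,3) by auto
    moreover have "psrc (fst x) = u" by (simp add: x'(1) pr_def psrc_def)
    ultimately show ?thesis using fin[OF m] by blast
  next
    case False
    then show ?thesis using cup_basis_True[OF x'(2,3) y'(2,3)] x'(1) y'(1) by auto
  qed
  show "cup_basis Q I y x = 0 \<or>
      (\<exists>s w p q. p \<noteq> [] \<and> x = pr s w p [] \<and> y = pr (\<not> s) w q []) \<or> y = vv (tgt x)"
  proof (cases "v = u' \<and> pr True u (p @ p') (q @ q') \<in> X")
    case True
    then have m: "p \<noteq> [] \<longrightarrow> p' = []" "q \<noteq> [] \<longrightarrow> q' = []"
      using e(1)[of "hd p'"] e(3)[of "hd q'"] by (auto simp: in_X walk_append)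
    show ?thesis
    proof (cases "p' = [] \<and> q' = []")
      case True
      then show ?thesis using tgt_pr[of True u p v q] x' y' \<open>v = u' \<and> _\<close> by simp
    next
      case False
      then have "p = [] \<or> q = []" using m by auto
      then have "u' = u" using True x'(2,3) by auto
      then show ?thesis using fin[OF m] False by blast
    qed
  next
    case False
    then show ?thesis using cup_basis_True[OF y'(2,3) x'(2,3)] x'(1) y'(1) by auto
  qed
qed

text \<open>Both cycles are based at \<open>w\<close>, so the last arrow of \<open>q\<close>
  composes with the first one of \<open>p\<close>. Whether or not this composite is a relation, it
  prolongs one of the two.\<close>

lemma NN_opposite: "pr s w p [] \<in> NN \<Longrightarrow> pr (\<not> s) w q [] \<in> NN \<Longrightarrow> p \<noteq> [] \<Longrightarrow> q \<noteq> [] \<Longrightarrow> False"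
proof -
  assume x: "pr s w p [] \<in> NN" and y: "pr (\<not> s) w q [] \<in> NN" and p: "p \<noteq> []" and q: "q \<noteq> []"
  have wp: "walk s w p w" and wq: "walk (\<not> s) w q w"
    using NN_X[OF x] NN_X[OF y] by (auto simp: in_X)
  have "last q \<in> arcs Q" "hd p \<in> arcs Q" "head Q (last q) = tail Q (hd p)"
    using walk_arcs[OF wp] walk_arcs[OF wq] p q walk_source[OF wp p] walk_target[OF wq q] by auto
  then show False
    using NN_no_extension(2)[OF x p] NN_no_extension(1)[OF y q] st_cases by blast
qed

lemma NN_NN: assumes "x \<in> NN" "y \<in> NN" shows "basis x \<star> basis y = 0"
proof -
  have "y \<noteq> vv w" for w using NN_ne[OF assms(2)] special_basis(1) by blast
  moreover have False if *: "p \<noteq> []" "x = pr s w p []" "y = pr (\<not> s) w q []" for s w p q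
  proof -
    have "q \<noteq> []" using * NN_not_special[OF assms(2)] by (auto simp: special_pr)
    then show False using NN_opposite[of s w p q] * assms by simp
  qed
  ultimately have "cup_basis Q I x y = 0" using NN_cup(1)[OF assms(1) NN_X[OF assms(2)]] by blast
  then show ?thesis by simp
qed

lemma NN_cc: assumes "x \<in> NN" "c \<in> arcs Q" shows "basis x \<star> basis (cc c) = 0" "basis (cc c) \<star> basis x = 0"
  using NN_cup[OF assms(1) cc_X[OF assms(2)]] basis_distinct(6)
  by (auto simp: pr_eq_cases split: if_splits)

lemma only_loop:
  assumes a: "a \<in> arcs Q" "tail Q a = head Q a"
    and out: "\<And>b. b \<in> arcs Q \<Longrightarrow> tail Q b = tail Q a \<Longrightarrow> b = a"
    and inc: "\<And>b. b \<in> arcs Q \<Longrightarrow> head Q b = tail Q a \<Longrightarrow> b = a"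
  shows "one_loop_quiver Q a"
proof -
  have "(u = tail Q a) = (v = tail Q a)" if "u \<in> verts Q" "v \<in> verts Q" for u v
    by (rule connected_const[OF wf_digraph connected _ that]) (use a out inc in metis)
  then have V: "verts Q = {tail Q a}" using a(1) tail_in_verts by blast
  then have "arcs Q = {a}" using out a(1) tail_in_verts by blast
  then show ?thesis using V by (simp add: one_loop_quiver_def)
qed

text \<open>Since \<open>q\<close> cannot be prolonged, the arrows \<open>e\<close> and
  \<open>a\<close> of the circuit before and after the base vertex must be the last and the first
  arrow of \<open>q\<close>. Removing the common first arrow gives a pair whose boundary is the
  product up to sign, as long as \<open>q\<close> is longer than one arrow.\<close>

lemma NN_zc:
  assumes a: "closed s a m" and sg: "sg s m = 1" and x: "pr (\<not> s) (tail Q a) q [] \<in> NN"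
  shows "basis (pr s (tail Q a) (ol s a m) q) \<in> Bd"
proof -
  define e where "e = last (ol s a m)"
  have ea: "st s e a" using st_last_ol[OF a] by (simp add: e_def)
  have q: "q \<noteq> []" using NN_not_special[OF x] by (auto simp: special_pr)
  have wq: "walk (\<not> s) (tail Q a) q (tail Q a)" using NN_X[OF x] by (auto simp: in_X)
  note ext = NN_no_extension[OF x q]
  have mem: "hd q \<in> arcs Q" "last q \<in> arcs Q" using walk_arcs[OF wq] q by auto
  have "st s e (hd q)"
    using st_cases[of e "hd q" s] ext(2)[of e] mem st_arcs[OF ea] walk_source[OF wq q] by auto
  then have hd: "hd q = a" using ea st_succ_unique by blast
  have "st s (last q) a"
    using st_cases[of "last q" a s] ext(1)[of a] mem st_arcs[OF ea] walk_target[OF wq q] by auto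
  then have la: "last q = e" using ea st_pred_unique by blast
  obtain q1 where q1: "q = a # q1" using hd q by (cases q) auto
  obtain k where k: "m = Suc k" using closed_pos[OF a] by (cases m) auto
  let ?z = "pr s (tail Q a) (ol s a m) q"
  have zX: "?z \<in> X" using walk_closed[OF a] wq by (auto simp: in_X)
  have ol: "ol s a m = a # ol s (nx s a) k" by (simp add: k ol_Suc)
  show ?thesis
  proof (cases "q1 = []")
    case False
    let ?y = "pr s (head Q a) (ol s (nx s a) k) q1"
    have "linkR ?y ?z" using zX mem hd unfolding linkR_pr ol q1 by auto
    then have yX: "?y \<in> X" using linkR_X by blast
    have "linkR ?y z' \<longleftrightarrow> z' = ?z" for z'
    proof
      assume "linkR ?y z'"
      then obtain c where c: "z' = pr s (tail Q c) (c # ol s (nx s a) k) (c # q1)" "z' \<in> X"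
        unfolding linkR_pr by blast
      then have "st (\<not> s) c (hd q1)" "st (\<not> s) a (hd q1)"
        using False wq by (auto simp: in_X walk_Cons q1)
      then have "c = a" using st_pred_unique by blast
      then show "z' = ?z" using c q1 ol by simp
    qed (use \<open>linkR ?y ?z\<close> in simp)
    \<comment> \<open>An arrow added at this end would prolong \<open>q\<close>.\<close>
    moreover have "\<not> linkL ?y z'" for z'
      using ext(1) False by (auto simp: linkL_pr in_X walk_snoc q1)
    ultimately have "d (basis ?y) = - scale (sign ?y) (basis ?z)"
      using d_basis[OF yX] by simp
    then have "scale (- sign ?y) (basis ?z) \<in> Bd"
      using Bd_I[of "basis ?y"] yX by simp
    then have "scale (- sign ?y) (scale (- sign ?y) (basis ?z)) \<in> Bd"
      by (rule ksubspaceD(3)[OF ksubspace_Bd])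
    then show ?thesis by simp
  next
    case True
    then have [simp]: "e = a" "q = [a]" using la q1 by auto
    \<comment> \<open>Now the loop \<open>a\<close> is the only arrow at its vertex, hence all of
      the quiver. Excluding polynomials forces \<open>s\<close>, and then excluding characteristic 2
      makes \<open>m\<close> even. The product is \<open>dc s a k\<close> with
      \<open>k = m - 1\<close> odd, a coboundary by \<open>dc_Bd\<close>.\<close>
    have aa: "st s a a" using ea by simp
    have out: "b = a" if "b \<in> arcs Q" "tail Q b = tail Q a" for b
      using st_cases[of a b s] ext(1)[of b] st_succ_unique[OF aa] st_arcs[OF aa] that by auto
    have inc: "b = a" if "b \<in> arcs Q" "head Q b = tail Q a" for b
      using st_cases[of b a s] ext(2)[of b] st_pred_unique[OF aa] st_arcs[OF aa] that by auto
    have loop: "one_loop_quiver Q a"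
      by (rule only_loop) (use st_arcs[OF aa] out inc in auto)
    have s: s
      using no_polynomials loop aa by (auto simp: polynomial_case_def st_def)
    then have "CHAR('k) \<noteq> 2" using no_dual_numbers loop aa by (auto simp: st_def)
    then have "even m" "(2 :: 'k) \<noteq> 0" using sg s by (auto simp: sg_eq_1 char_two)
    then have k': "k > 0" "odd k" using k by (auto elim: oddE)
    have nxa: "nx s a = a" using st_nx[OF aa] .
    have "(nx s ^^ k) a = a" by (induction k) (auto simp: nxa)
    then have c: "closed s a k" using k'(1) closed_per[OF a] by (simp add: closed_def)
    have "sg s k \<noteq> 1" using k'(2) s \<open>(2 :: 'k) \<noteq> 0\<close> by (simp add: sg_eq_1)
    then have "basis (dc s a k) \<in> Bd" using dc_Bd[OF c] by blast
    then show ?thesis by (simp add: dc_def k)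
  qed
qed

text \<open>By \<open>NN_cup\<close> a rotation can contribute only if \<open>x\<close> is a cycle
  on the other side, against the base vertex of that rotation. In both orders the product is then
  the pair of the two cycles, to which \<open>NN_zc\<close> applies.\<close>

lemma NN_ZS:
  assumes C: "C \<in> BC s" and x: "x \<in> NN"
  shows "basis x \<star> ZS s C 1 \<in> Bd" "ZS s C 1 \<star> basis x \<in> Bd"
proof -
  let ?m = "plen C"
  have trm: "cup_basis Q I x (zc s a ?m) \<in> Bd \<and> cup_basis Q I (zc s a ?m) x \<in> Bd" if a: "a \<in> set (snd C)" for a
  proof -
    note c = BC_arrow(1)[OF C a]
    have nv: "zc s a ?m \<noteq> vv w" for w using basis_distinct(3)[OF closed_pos[OF c]] .
    show ?thesis
    proof (cases "\<exists>s' w p q. p \<noteq> [] \<and> x = pr s' w p [] \<and> zc s a ?m = pr (\<not> s') w q []")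
      case True
      then obtain s' w p q where *: "p \<noteq> []" "x = pr s' w p []" "zc s a ?m = pr (\<not> s') w q []" by blast
      have s': "s' = (\<not> s)" and w: "w = tail Q a"
        using *(3) closed_pos[OF c] by (auto simp: zc_def pr_eq_cases split: if_splits)
      have x': "x = pr (\<not> s) (tail Q a) p []" using * s' w by simp
      have wp: "walk (\<not> s) (tail Q a) p (tail Q a)" using NN_X[OF x] by (auto simp: x' in_X)
      have tv: "tail Q a \<in> verts Q" using walk_verts[OF wp] by simp
      have xs: "x = pr s (tail Q a) [] p" using x' pr_swap[of s] by simp
      have B: "basis (pr s (tail Q a) (ol s a ?m) p) \<in> Bd"
        using NN_zc[OF c BC_arrow(2)[OF C a]] x x' by simp
      have w0: "walk s (tail Q a) [] (tail Q a)" "walk (\<not> s) (tail Q a) [] (tail Q a)" using tv by auto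
      have "cup_basis Q I x (zc s a ?m) \<in> Bd"
        using cup_basis_pr[OF w0(1) wp walk_closed[OF c] w0(2)] B ksubspaceD(1)[OF ksubspace_Bd]
        by (simp add: xs zc_def)
      moreover have "cup_basis Q I (zc s a ?m) x \<in> Bd"
        using cup_basis_pr[OF walk_closed[OF c] w0(2) w0(1) wp] B ksubspaceD(1)[OF ksubspace_Bd]
        by (simp add: xs zc_def)
      ultimately show ?thesis by blast
    next
      case False
      then have "cup_basis Q I x (zc s a ?m) = 0" "cup_basis Q I (zc s a ?m) x = 0"
        using NN_cup[OF x zc_X[OF c]] nv by blast+
      then show ?thesis using ksubspaceD(1)[OF ksubspace_Bd] by simp
    qed
  qed
  show "basis x \<star> ZS s C 1 \<in> Bd" "ZS s C 1 \<star> basis x \<in> Bd"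
    using trm by (auto simp: bilinear_simps intro!: ksubspace_sum[OF ksubspace_Bd])
qed

text \<open>Removing the common arrow \<open>c\<close> from both cycles leaves \<open>?y\<close>;
  putting it back at its two ends gives the two pairs, and \<open>?y\<close> has no further links.
  The sign conditions give \<open>sign ?y = - 1\<close>, so its boundary is their sum and not their
  difference.\<close>

lemma diagonal_square_Bd:
  assumes c: "closed s c m" "closed (\<not> s) c n" and sg: "sg s m = 1" "sg (\<not> s) n = 1"
  shows "basis (pr s (tail Q c) (ol s c m) (ol (\<not> s) c n))
    + basis (pr s (head Q c) (ol s (nx s c) m) (ol (\<not> s) (nx (\<not> s) c) n)) \<in> Bd"
proof -
  obtain k l where k: "m = Suc k" and l: "n = Suc l"
    using closed_pos[OF c(1)] closed_pos[OF c(2)] by (metis gr0_implies_Suc)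
  note p = closed_per[OF c(1)] closed_per[OF c(2)]
  let ?p = "ol s (nx s c) k" let ?q = "ol (\<not> s) (nx (\<not> s) c) l"
  have fk: "(nx s ^^ k) (nx s c) = c" "(nx (\<not> s) ^^ l) (nx (\<not> s) c) = c"
    using c by (simp_all add: closed_def k l funpow_swap1)
  let ?y = "pr s (head Q c) ?p ?q"
  let ?W = "pr s (tail Q c) (ol s c m) (ol (\<not> s) c n)"
  let ?V = "pr s (head Q c) (ol s (nx s c) m) (ol (\<not> s) (nx (\<not> s) c) n)"
  have W: "?W = pr s (tail Q c) (c # ?p) (c # ?q)" by (simp add: k l ol_Suc)
  have V: "?V = pr s (head Q c) (?p @ [c]) (?q @ [c])" by (simp add: k l ol_snoc fk)
  have ca: "c \<in> arcs Q" using per_arcs[OF p(1)] .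
  have WX: "?W \<in> X" using walk_closed[OF c(1)] walk_closed[OF c(2)] by (auto simp: in_X)
  have VX: "?V \<in> X"
    using walk_closed[OF closed_nx[OF c(1)]] walk_closed[OF closed_nx[OF c(2)]] head_per[OF p(1)] head_per[OF p(2)]
    by (auto simp: in_X)
  have R: "linkR ?y ?W" using WX ca unfolding linkR_pr W by auto
  have L: "linkL ?y ?V" using VX ca unfolding linkL_pr V by auto
  have yX: "?y \<in> X" using linkL_X[OF L] by simp
  \<comment> \<open>If both cycles were just \<open>c\<close>, its square would be a relation and
    not be one.\<close>
  have ne: "?p \<noteq> [] \<or> ?q \<noteq> []"
  proof (rule ccontr)
    assume "\<not> ?thesis"
    then have "nx s c = c" "nx (\<not> s) c = c" using fk by simp_all
    then show False using per_nx(1)[OF p(1)] per_nx(1)[OF p(2)] st_excl by metis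
  qed
  have lp: "st s (last ?p) c" if "?p \<noteq> []"
    using VX that unfolding V by (auto simp: in_X walk_snoc)
  have lq: "st (\<not> s) (last ?q) c" if "?q \<noteq> []"
    using VX that unfolding V by (auto simp: in_X walk_snoc)
  have hp: "st s c (hd ?p)" if "?p \<noteq> []"
    using WX that unfolding W by (auto simp: in_X walk_Cons)
  have hq: "st (\<not> s) c (hd ?q)" if "?q \<noteq> []"
    using WX that unfolding W by (auto simp: in_X walk_Cons)
  have "linkL ?y z \<longleftrightarrow> z = ?V" for z
  proof
    assume "linkL ?y z"
    then obtain b where b: "z = pr s (head Q c) (?p @ [b]) (?q @ [b])" "z \<in> X" unfolding linkL_pr by blast
    have "b = c"
    proof (cases "?p = []")
      case True
      then have "st (\<not> s) (last ?q) b" using b ne by (auto simp: in_X walk_snoc)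
      then show ?thesis using lq True ne st_succ_unique by blast
    next
      case False
      then have "st s (last ?p) b" using b by (auto simp: in_X walk_snoc)
      then show ?thesis using lp[OF False] st_succ_unique by blast
    qed
    then show "z = ?V" using b V by simp
  qed (use L in simp)
  moreover have "linkR ?y z \<longleftrightarrow> z = ?W" for z
  proof
    assume "linkR ?y z"
    then obtain b where b: "z = pr s (tail Q b) (b # ?p) (b # ?q)" "z \<in> X" unfolding linkR_pr by blast
    have "b = c"
    proof (cases "?p = []")
      case True
      then have "st (\<not> s) b (hd ?q)" using b ne by (auto simp: in_X walk_Cons)
      then show ?thesis using hq True ne st_pred_unique by blast
    next
      case False
      then have "st s b (hd ?p)" using b by (auto simp: in_X walk_Cons)
      then show ?thesis using hp[OF False] st_pred_unique by blast
    qed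
    then show "z = ?W" using b W by simp
  qed (use R in simp)
  moreover have "sign ?y = - 1"
  proof (cases s)
    case True
    then have "- ((- 1 :: 'k) ^ k) = 1" using sg(1) by (simp add: sg_def k)
    then show ?thesis using True by (simp add: sign_def deg_pr) (metis add.inverse_inverse)
  next
    case False
    then have "- ((- 1 :: 'k) ^ l) = 1" using sg(2) by (simp add: sg_def l)
    then show ?thesis using False by (simp add: sign_def deg_pr) (metis add.inverse_inverse)
  qed
  ultimately have "d (basis ?y) = basis ?V + basis ?W"
    using d_basis[OF yX] by simp
  then show ?thesis
    using Bd_I[of "basis ?y"] yX by (simp add: add.commute)
qed

text \<open>A term needs two rotations \<open>a\<close>, \<open>b\<close> with a common base vertex.
  Either \<open>a = b\<close>, or they are the two successors of an arrow common to both circuits.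
  So the product is a sum over the common arrows \<open>c\<close> of the two pairs in
  \<open>diagonal_square_Bd\<close>.\<close>

lemma ZS_opposite:
  assumes C: "C \<in> BC s" and C': "C' \<in> BC (\<not> s)"
  shows "ZS s C 1 \<star> ZS (\<not> s) C' 1 \<in> Bd"
proof -
  let ?O = "set (snd C)" let ?P = "set (snd C')" let ?m = "plen C" let ?n = "plen C'"
  let ?W = "\<lambda>(a, b). pr s (tail Q a) (ol s a ?m) (ol (\<not> s) b ?n)"
  have trm: "cup_basis Q I (zc s a ?m) (zc (\<not> s) b ?n) = (if tail Q a = tail Q b then basis (?W (a, b)) else 0)"
    if a: "a \<in> ?O" and b: "b \<in> ?P" for a b
  proof -
    note wa = walk_closed[OF BC_arrow(1)[OF C a]] and wb = walk_closed[OF BC_arrow(1)[OF C' b]]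
    have w0: "walk (\<not> s) (tail Q a) [] (tail Q a)" "walk s (tail Q b) [] (tail Q b)"
      using walk_verts[OF wa] walk_verts[OF wb] by auto
    have "tail Q a = tail Q b \<Longrightarrow> ?W (a, b) \<in> X" using wa wb by (auto simp: in_X)
    then show ?thesis
      using cup_basis_pr[OF wa w0(1) w0(2) wb] by (auto simp: zc_def pr_swap)
  qed
  have "ZS s C 1 \<star> ZS (\<not> s) C' 1 = (\<Sum>a\<in>?O. \<Sum>b\<in>?P. if tail Q a = tail Q b then basis (?W (a, b)) else 0)"
    unfolding repr.simps klinearD(6)[OF klinear_bilinear_left]
    unfolding klinearD(6)[OF klinear_bilinear_right] bilinear_ext_basis
    by (rule sum.cong[OF refl], rule sum.cong[OF refl]) (simp add: trm)
  also have "\<dots> = (\<Sum>x\<in>?O \<times> ?P. if tail Q (fst x) = tail Q (snd x) then basis (?W x) else 0)"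
    unfolding sum.cartesian_product by (rule sum.cong) auto
  also have "\<dots> = (\<Sum>x\<in>{x \<in> ?O \<times> ?P. tail Q (fst x) = tail Q (snd x)}. basis (?W x))"
    by (rule sum.inter_filter[symmetric]) simp
  also have "{x \<in> ?O \<times> ?P. tail Q (fst x) = tail Q (snd x)}
      = (\<lambda>c. (c, c)) ` (?O \<inter> ?P) \<union> (\<lambda>c. (nx s c, nx (\<not> s) c)) ` (?O \<inter> ?P)" (is "?L = ?A \<union> ?B")
  proof
    show "?A \<union> ?B \<subseteq> ?L"
    proof (auto)
      fix c assume c: "c \<in> ?O" "c \<in> ?P"
      show "nx s c \<in> ?O" using nx_orb[of s c] BC_arrow(3)[OF C c(1)] by simp
      show "nx (\<not> s) c \<in> ?P" using nx_orb[of "\<not> s" c] BC_arrow(3)[OF C' c(2)] by simp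
      show "tail Q (nx s c) = tail Q (nx (\<not> s) c)"
        using head_per[OF BC_arrow(5)[OF C c(1)]] head_per[OF BC_arrow(5)[OF C' c(2)]] by simp
    qed
    show "?L \<subseteq> ?A \<union> ?B"
    proof
      fix x assume "x \<in> ?L"
      then obtain a b where x: "x = (a, b)" "a \<in> ?O" "b \<in> ?P" "tail Q a = tail Q b" by auto
      show "x \<in> ?A \<union> ?B"
      proof (cases "a = b")
        case False
        note pa = BC_arrow(5)[OF C x(2)] and pb = BC_arrow(5)[OF C' x(3)]
        \<comment> \<open>Let \<open>e\<close> precede \<open>a\<close> on its circuit. As
          \<open>b\<close> is not its \<open>s\<close>-successor, it is its successor on the other
          side, so \<open>e\<close> lies on both circuits.\<close>
        obtain e where e: "e \<in> per s" "nx s e = a" "e \<in> orb s a" by (rule obtain_pred[OF pa])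
        have sa: "st s e a" using per_nx(1)[OF e(1)] e(2) by simp
        have "\<not> st s e b" using sa False st_succ_unique by blast
        then have "st (\<not> s) e b"
          using st_cases[of e b s] st_arcs[OF sa] per_arcs[OF pb] x(4) by auto
        then have e': "e \<in> per (\<not> s)" "nx (\<not> s) e = b" using st_per[OF pb] by auto
        have "e \<in> ?O" using e(3) BC_arrow(3)[OF C x(2)] by simp
        moreover have "e \<in> ?P"
          using orb_sym[OF e'(1) nx_orb] e'(2) BC_arrow(3)[OF C' x(3)] by simp
        ultimately show ?thesis using x(1) e(2) e'(2) by blast
      qed (use x in auto)
    qed
  qed
  also have "(\<Sum>x\<in>?A \<union> ?B. basis (?W x)) = (\<Sum>x\<in>?A. basis (?W x)) + (\<Sum>x\<in>?B. basis (?W x))"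
  proof (rule sum.union_disjoint)
    have "nx s c \<noteq> nx (\<not> s) c" if "c \<in> ?O" "c \<in> ?P" for c
      using per_nx(1)[OF BC_arrow(5)[OF C that(1)]] per_nx(1)[OF BC_arrow(5)[OF C' that(2)]] st_excl by metis
    then show "?A \<inter> ?B = {}" by auto
  qed auto
  also have "(\<Sum>x\<in>?A. basis (?W x)) = (\<Sum>c\<in>?O \<inter> ?P. basis (?W (c, c)))"
    by (subst sum.reindex) (auto simp: inj_on_def)
  also have "(\<Sum>x\<in>?B. basis (?W x)) = (\<Sum>c\<in>?O \<inter> ?P. basis (?W (nx s c, nx (\<not> s) c)))"
    using nx_inj BC_arrow(5)[OF C] by (subst sum.reindex) (auto simp: inj_on_def)
  also have "(\<Sum>c\<in>?O \<inter> ?P. basis (?W (c, c))) + (\<Sum>c\<in>?O \<inter> ?P. basis (?W (nx s c, nx (\<not> s) c)))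
      = (\<Sum>c\<in>?O \<inter> ?P. basis (?W (c, c)) + basis (?W (nx s c, nx (\<not> s) c)))"
    by (rule sum.distrib[symmetric])
  finally have eq: "ZS s C 1 \<star> ZS (\<not> s) C' 1
      = (\<Sum>c\<in>?O \<inter> ?P. basis (?W (c, c)) + basis (?W (nx s c, nx (\<not> s) c)))" .
  show ?thesis
    unfolding eq
  proof (rule ksubspace_sum[OF ksubspace_Bd])
    fix c assume c: "c \<in> ?O \<inter> ?P"
    have cO: "c \<in> ?O" and cP: "c \<in> ?P" using c by auto
    show "basis (?W (c, c)) + basis (?W (nx s c, nx (\<not> s) c)) \<in> Bd"
      using diagonal_square_Bd[OF BC_arrow(1)[OF C cO] BC_arrow(1)[OF C' cP] BC_arrow(2)[OF C cO] BC_arrow(2)[OF C' cP]]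
        head_per[OF BC_arrow(5)[OF C cO]] by simp
  qed
qed

end

section \<open>The generators\<close>

context gentle_data
begin

text \<open>A proper prolongation contains one by a single arrow, because pieces of an
  \<open>s\<close>-walk are \<open>s\<close>-walks.\<close>

lemma maximal_iff:
  fixes s defines "P \<equiv> if s then Gamma_paths Q I else B_paths Q I"
  assumes w: "walk s u p v"
  shows "maximal_path Q P (u, p) \<longleftrightarrow>
    (\<forall>b w. \<not> walk s u (p @ [b]) w) \<and> (\<forall>a w. head Q a = u \<longrightarrow> \<not> walk s (tail Q a) (a # p) w)"
    (is "?L \<longleftrightarrow> ?R")
proof -
  have P: "(u, p) \<in> P \<longleftrightarrow> (\<exists>v. walk s u p v)" for u p
    by (simp add: P_def Gamma_paths_iff B_paths_iff)
  have path: "(u, p) \<in> paths Q" if "walk s u p v" for u p v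
    using walk_awalk[OF that] by (auto simp: paths_iff)
  show ?thesis
  proof
    assume L: ?L
    have "\<not> walk s u (p @ [b]) w'" for b w'
    proof
      assume h: "walk s u (p @ [b]) w'"
      have "subpath Q (u, p) (u, p @ [b])"
        using path[OF h] path[OF w] by (subst subpath_iff) (auto simp: ptgt_cases intro!: exI[of _ "[]"])
      moreover have "(u, p @ [b]) \<in> P" using h P by blast
      ultimately show False using L unfolding maximal_path_def by fastforce
    qed
    moreover have "\<not> walk s (tail Q a) (a # p) w'" if "head Q a = u" for a w'
    proof
      assume h: "walk s (tail Q a) (a # p) w'"
      have "\<exists>x y. a # p = x @ p @ y \<and> u = ptgt Q (tail Q a, x)"
        using that by (intro exI[of _ "[a]"] exI[of _ "[]"]) (simp add: ptgt_cases)
      then have "subpath Q (u, p) (tail Q a, a # p)"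
        using subpath_iff[OF path[OF h] path[OF w]] by blast
      moreover have "(tail Q a, a # p) \<in> P" using h P by blast
      ultimately show False using L unfolding maximal_path_def by fastforce
    qed
    ultimately show ?R by blast
  next
    assume R: ?R
    have "\<pi> = (u, p)" if \<pi>: "\<pi> \<in> P" "subpath Q (u, p) \<pi>" for \<pi>
    proof -
      obtain u' p' where \<pi>': "\<pi> = (u', p')" by (cases \<pi>)
      obtain v' where v': "walk s u' p' v'" using \<pi>(1) P \<pi>' by blast
      obtain x y where xy: "p' = x @ p @ y" "u = ptgt Q (u', x)"
        using \<pi>(2) subpath_iff[OF path[OF v'] path[OF w]] \<pi>' by blast
      obtain t where t: "walk s u' x t" "walk s t (p @ y) v'" "x \<noteq> [] \<Longrightarrow> p @ y \<noteq> [] \<Longrightarrow> st s (last x) (hd (p @ y))"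
        using v' unfolding xy(1) walk_append[of s u' x] by blast
      have tu: "t = u" using ptgt_walk[OF t(1)] xy(2) by simp
      have "y = []"
      proof (cases y)
        case (Cons b y')
        then have "walk s u (p @ [b] @ y') v'" using t(2) tu by simp
        then have "\<exists>w. walk s u (p @ [b]) w" unfolding append_assoc[symmetric] walk_append[of s u "p @ [b]"] by blast
        then show ?thesis using R by blast
      qed
      moreover have "x = []"
      proof (cases x rule: rev_cases)
        case (snoc x' a)
        then have a: "a \<in> arcs Q" "head Q a = u" using t(1) tu by (auto simp: walk_snoc)
        have "p \<noteq> [] \<longrightarrow> st s a (hd p)" using t(3) snoc by auto
        then have "walk s (tail Q a) (a # p) v" using w a by (simp add: walk_Cons)
        then show ?thesis using R a(2) by blast
      qed
      ultimately show ?thesis using xy \<pi>' t(1) tu by simp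
    qed
    then show ?L using w P unfolding maximal_path_def by blast
  qed
qed

lemma no_isolated_vertex:
  assumes "u \<in> verts Q" shows "\<exists>b\<in>arcs Q. tail Q b = u \<or> head Q b = u"
proof (rule ccontr)
  assume h: "\<not> ?thesis"
  obtain b where b: "b \<in> arcs Q" using arrows by blast
  have "(u = u) = (tail Q b = u)"
    by (rule connected_const[OF wf_digraph connected, of "\<lambda>w. w = u"]) (use h assms b in auto)
  then show False using h b by simp
qed

text \<open>A path of length 0 is prolonged by any arrow at its vertex, and connectedness together
  with the existence of an arrow provides one.\<close>

lemma maximal_ne:
  assumes "walk s u p v" "maximal_path Q (if s then Gamma_paths Q I else B_paths Q I) (u, p)"
  shows "p \<noteq> []"
proof
  assume p: "p = []"
  have u: "u \<in> verts Q" using walk_verts[OF assms(1)] by blast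
  obtain b where "b \<in> arcs Q" "tail Q b = u \<or> head Q b = u" using no_isolated_vertex[OF u] by blast
  then show False using assms(2) p unfolding maximal_iff[OF assms(1)] by auto
qed

lemma maximal_ext:
  assumes "walk s u p v" "p \<noteq> []"
  shows "maximal_path Q (if s then Gamma_paths Q I else B_paths Q I) (u, p) \<longleftrightarrow>
    (\<forall>b. \<not> st s (last p) b) \<and> (\<forall>a. \<not> st s a (hd p))"
proof -
  have "(\<exists>w. walk s u (p @ [b]) w) \<longleftrightarrow> st s (last p) b" for b
    using assms walk_target[OF assms] by (auto simp: walk_snoc dest: st_arcs)
  moreover have "head Q a = u \<and> (\<exists>w. walk s (tail Q a) (a # p) w) \<longleftrightarrow> st s a (hd p)" for a
    using assms walk_source[OF assms] st_arcs[of s a "hd p"] by (auto simp: walk_Cons)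
  ultimately show ?thesis unfolding maximal_iff[OF assms(1)] by blast
qed

text \<open>\<open>NN_I\<close> and \<open>NN_no_extension\<close> say that the isolated pairs are
  those with an unprolongable component and no shared end arrow. If the \<Gamma>-component is
  trivial, the other one is a maximal cycle; otherwise the \<Gamma>-component is itself
  maximal.\<close>

lemma NN_generators:
  "{(vertex_path (psrc \<alpha>), \<alpha>) | \<alpha>. is_cycle Q \<alpha> \<and> maximal_path Q (B_paths Q I) \<alpha>} \<union>
   {(\<gamma>, \<alpha>) | \<gamma> \<alpha>. (\<gamma>, \<alpha>) \<in> X \<and> maximal_path Q (Gamma_paths Q I) \<gamma> \<and>
        \<not> share_first_arrow \<gamma> \<alpha> \<and> \<not> share_last_arrow \<gamma> \<alpha>} = NN" (is "?M \<union> ?N = NN")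
proof
  have "?M \<subseteq> NN"
  proof
    fix x assume "x \<in> ?M"
    then obtain u q where x: "x = (vertex_path u, (u, q))" and cyc: "is_cycle Q (u, q)"
      and max: "maximal_path Q (B_paths Q I) (u, q)" by (auto simp: psrc_def)
    obtain v where w: "walk False u q v"
      using max by (auto simp: maximal_path_def B_paths_iff)
    have q: "q \<noteq> []" "v = u" using cyc ptgt_walk[OF w] by (auto simp: is_cycle_def plen_def psrc_def)
    have "pr False u q [] \<in> NN"
    proof (rule NN_I[OF _ q(1)])
      show "pr False u q [] \<in> X" using w q(2) walk_verts[OF w] by (auto simp: in_X)
    qed (use max maximal_ext[OF w q(1)] in auto)
    then show "x \<in> NN" by (simp add: x pr_def vertex_path_def)
  qed
  moreover have "?N \<subseteq> NN"
  proof
    fix x assume "x \<in> ?N"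
    then obtain \<gamma> \<alpha> where *: "x = (\<gamma>, \<alpha>)" "x \<in> X" "maximal_path Q (Gamma_paths Q I) \<gamma>"
      "\<not> share_first_arrow \<gamma> \<alpha>" "\<not> share_last_arrow \<gamma> \<alpha>" by blast
    obtain u p q v where x: "x = pr True u p q" "walk True u p v" "walk False u q v"
      by (rule X_cases[OF *(2), of True]) simp
    have ga: "\<gamma> = (u, p)" "\<alpha> = (u, q)" using *(1) x(1) by (auto simp: pr_def)
    have p: "p \<noteq> []" using maximal_ne[OF x(2)] *(3) ga by simp
    have "pr True u p q \<in> NN"
    proof (rule NN_I[OF _ p])
      show "pr True u p q \<in> X" using *(2) x(1) by simp
      show "q \<noteq> [] \<Longrightarrow> last p \<noteq> last q" "q \<noteq> [] \<Longrightarrow> hd p \<noteq> hd q"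
        using *(4,5) p by (auto simp: ga share_first_arrow_def share_last_arrow_def)
    qed (use *(3) maximal_ext[OF x(2) p] ga in auto)
    then show "x \<in> NN" using x(1) by simp
  qed
  ultimately show "?M \<union> ?N \<subseteq> NN" by blast
  show "NN \<subseteq> ?M \<union> ?N"
  proof
    fix x assume x: "x \<in> NN"
    obtain u p q v where x': "x = pr True u p q" "walk True u p v" "walk False u q v"
      by (rule X_cases[OF NN_X[OF x], of True]) simp
    show "x \<in> ?M \<union> ?N"
    proof (cases "p = []")
      case True
      then have q: "q \<noteq> []" using NN_not_special[OF x] by (auto simp: x' special_pr)
      have x2: "pr False u q [] \<in> NN" using x True x'(1) by (simp add: pr_def)
      have "maximal_path Q (B_paths Q I) (u, q)"
        using NN_no_extension[OF x2 q] maximal_ext[OF x'(3) q] by simp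
      moreover have "is_cycle Q (u, q)"
        using x'(2,3) True q walk_awalk[OF x'(3)]
        by (auto simp: is_cycle_def paths_iff plen_def psrc_def ptgt_awalk)
      moreover have "x = (vertex_path (psrc (u, q)), (u, q))"
        using x'(1) True by (simp add: pr_def vertex_path_def psrc_def)
      ultimately show ?thesis by blast
    next
      case False
      have x2: "pr True u p q \<in> NN" using x x'(1) by simp
      have "maximal_path Q (Gamma_paths Q I) (u, p)"
        using NN_no_extension[OF x2 False] maximal_ext[OF x'(2) False] by simp
      moreover have "\<not> share_first_arrow (u, p) (u, q)" "\<not> share_last_arrow (u, p) (u, q)"
        using NN_not_share[OF x2] by (auto simp: share_first_arrow_def share_last_arrow_def)
      moreover have "x = ((u, p), (u, q))" using x'(1) by (simp add: pr_def)
      ultimately show ?thesis using NN_X[OF x] by blast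
    qed
  qed
qed

definition GI :: "('v, 'a) idx set" where
  "GI = Iso ` NN \<union> Arr ` (arcs Q - T) \<union> {Cyc s C 1 | s C. C \<in> BC s}"

definition gen :: "('v, 'a) idx \<Rightarrow> ('v, 'a, 'k) cochain set" where
  "gen i = cls (repr i)"

abbreviation "G \<equiv> HH_generators Q I T CB CG"

lemma GI_IX: "GI \<subseteq> IX"
  by (auto simp: GI_def IX_def)

lemma ZS_eq: "C \<in> BC s \<Longrightarrow> ZS s C 1 = (if s then Gamma_sum Q C else B_sum Q C)"
proof -
  assume "C \<in> BC s"
  then obtain a where a: "a \<in> per s" "C = cyc s a (blen s a)" using BC_cyc by blast
  have "set (snd C) = orb s a" "plen C = blen s a"
    using a set_ol[OF closed_blen(1)[OF a(1)]] by (simp_all add: cyc_def plen_def)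
  then show ?thesis
    using a closed_blen(1)[OF a(1)] by (cases s) (simp_all add: Gamma_sum_cyc B_sum_cyc)
qed

lemma gen_Cyc: "C \<in> CG \<Longrightarrow> Gamma_class Q I C = gen (Cyc True C 1)"
    "C \<in> CB \<Longrightarrow> B_class Q I C = gen (Cyc False C 1)"
  using ZS_eq[of C True] ZS_eq[of C False]
  by (simp_all add: gen_def BC_def Gamma_class_def B_class_def del: repr.simps)

lemma gen_Arr: "arrow_class Q I c = gen (Arr c)"
  by (simp add: gen_def arrow_class_def arrow_path_def pr_def)

lemma image_Collect1: "h ` {f a | a. P a} = {h (f a) | a. P a}"
  and image_Collect2: "h ` {g a b | a b. R a b} = {h (g a b) | a b. R a b}"
  by blast+

lemma G_eq: "G = gen ` GI"
proof -
  have 1: "{cls (basis (vertex_path (psrc \<alpha>), \<alpha>)) | \<alpha>. is_cycle Q \<alpha> \<and> maximal_path Q (B_paths Q I) \<alpha>} \<union>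
      {cls (basis (\<gamma>, \<alpha>)) | \<gamma> \<alpha>. (\<gamma>, \<alpha>) \<in> X \<and> maximal_path Q (Gamma_paths Q I) \<gamma> \<and>
        \<not> share_first_arrow \<gamma> \<alpha> \<and> \<not> share_last_arrow \<gamma> \<alpha>} = gen ` Iso ` NN"
  proof -
    have "gen ` Iso ` NN = (\<lambda>x. cls (basis x)) ` NN" by (simp add: image_image gen_def)
    also have "\<dots> = (\<lambda>x. cls (basis x)) ` ({(vertex_path (psrc \<alpha>), \<alpha>) | \<alpha>. is_cycle Q \<alpha> \<and> maximal_path Q (B_paths Q I) \<alpha>} \<union>
      {(\<gamma>, \<alpha>) | \<gamma> \<alpha>. (\<gamma>, \<alpha>) \<in> X \<and> maximal_path Q (Gamma_paths Q I) \<gamma> \<and>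
        \<not> share_first_arrow \<gamma> \<alpha> \<and> \<not> share_last_arrow \<gamma> \<alpha>})"
      unfolding NN_generators ..
    finally show ?thesis by (simp only: image_Un image_Collect1 image_Collect2)
  qed
  have 2: "B_class Q I ` CB \<union> Gamma_class Q I ` CG = gen ` {Cyc s C 1 | s C. C \<in> BC s}"
  proof -
    have "{Cyc s C 1 | s C. C \<in> BC s} = (\<lambda>C. Cyc False C 1) ` CB \<union> (\<lambda>C. Cyc True C 1) ` CG"
      by (auto simp: ex_bool_eq BC_def)
    moreover have "B_class Q I ` CB = gen ` (\<lambda>C. Cyc False C 1) ` CB"
      unfolding image_image using gen_Cyc(2) by (intro image_cong) auto
    moreover have "Gamma_class Q I ` CG = gen ` (\<lambda>C. Cyc True C 1) ` CG"
      unfolding image_image using gen_Cyc(1) by (intro image_cong) auto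
    ultimately show ?thesis by (simp only: image_Un)
  qed
  have 3: "arrow_class Q I ` (arcs Q - T) = gen ` Arr ` (arcs Q - T)"
    by (simp add: gen_Arr image_image)
  show ?thesis
    unfolding HH_generators_def GI_def image_Un 1[symmetric] 2[symmetric] 3[symmetric] by (simp only: Un_ac)
qed

text \<open>The letters of words and the entries of exceptional pairs are cohomology classes.
  Independence allows an index to be recovered from its class, so case distinctions can be made on
  indices.\<close>

lemma gen_inj: assumes "i \<in> IX" "j \<in> IX" "gen i = gen j" shows "i = j"
proof -
  have "repr i - repr j \<in> Bd"
    using assms cls_eq_iff[OF repr_Z repr_Z, of i j] by (simp add: gen_def)
  then have "linear_ext repr (basis i - basis j) \<in> Bd"
    by (simp add: klinearD[OF klinear_linear_ext])
  then have "basis i - basis j = (0 :: ('v, 'a) idx \<Rightarrow>\<^sub>0 'k)"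
    using assms(1,2) by (intro repr_independent kspace_intros(5)) simp_all
  then show ?thesis by simp
qed

definition exc :: "('v, 'a) idx \<Rightarrow> ('v, 'a) idx \<Rightarrow> bool" where
  "exc i j \<longleftrightarrow> (\<exists>s. \<exists>C\<in>BC s. (i = Cyc s C 1 \<and> j = Cyc s C 1) \<or>
     (\<exists>c\<in>arcs Q - T. c \<in> set (snd C) \<and> (i = Cyc s C 1 \<and> j = Arr c \<or> i = Arr c \<and> j = Cyc s C 1)))"

lemma exceptional_pair_iff:
  assumes i: "i \<in> GI" and j: "j \<in> GI"
  shows "exceptional_pair Q I T CB CG (gen i) (gen j) \<longleftrightarrow> exc i j"
proof -
  have IX: "i \<in> IX" "j \<in> IX" "C \<in> BC s \<Longrightarrow> Cyc s C 1 \<in> IX" "c \<in> arcs Q - T \<Longrightarrow> Arr c \<in> IX" for C s c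
    using i j GI_IX by (auto simp: IX_def)
  have e: "gen i = gen k \<Longrightarrow> i = k" "gen j = gen k \<Longrightarrow> j = k" if "k \<in> IX" for k
    using gen_inj IX(1,2) that by blast+
  show ?thesis
  proof
    have one: "exc i j" if "C \<in> BC s" "gen i = gen (Cyc s C 1)" "gen j = gen (Cyc s C 1)" for s C
      using e[OF IX(3)[OF that(1)]] that unfolding exc_def by blast
    have two: "exc i j" if "C \<in> BC s" "c \<in> arcs Q - T" "c \<in> set (snd C)"
      "{gen i, gen j} = {gen (Cyc s C 1), gen (Arr c)}" for s C c
      using e[OF IX(3)[OF that(1)]] e[OF IX(4)[OF that(2)]] that unfolding exc_def doubleton_eq_iff by blast
    have BC: "CG = BC True" "CB = BC False" by (simp_all add: BC_def)
    have cl: "C \<in> BC True \<Longrightarrow> Gamma_class Q I C = gen (Cyc True C 1)"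
      "C \<in> BC False \<Longrightarrow> B_class Q I C = gen (Cyc False C 1)" for C
      using gen_Cyc by (simp_all add: BC_def)
    show "exceptional_pair Q I T CB CG (gen i) (gen j) \<Longrightarrow> exc i j"
      unfolding exceptional_pair_def gen_Arr
    proof (elim disjE bexE conjE)
      fix C assume "C \<in> CG" "gen i = Gamma_class Q I C" "gen j = Gamma_class Q I C"
      then show ?thesis using one[of C True] cl(1)[of C] BC(1) by metis
    next
      fix C assume "C \<in> CB" "gen i = B_class Q I C" "gen j = B_class Q I C"
      then show ?thesis using one[of C False] cl(2)[of C] BC(2) by metis
    next
      fix C c assume "C \<in> CG" "c \<in> arcs Q - T" "c \<in> set (snd C)" "{gen i, gen j} = {Gamma_class Q I C, gen (Arr c)}"
      then show ?thesis using two[of C True c] cl(1)[of C] BC(1) by metis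
    next
      fix C c assume "C \<in> CB" "c \<in> arcs Q - T" "c \<in> set (snd C)" "{gen i, gen j} = {B_class Q I C, gen (Arr c)}"
      then show ?thesis using two[of C False c] cl(2)[of C] BC(2) by metis
    qed
    assume "exc i j"
    then obtain s C where C: "C \<in> BC s" and *: "(i = Cyc s C 1 \<and> j = Cyc s C 1) \<or>
       (\<exists>c\<in>arcs Q - T. c \<in> set (snd C) \<and> (i = Cyc s C 1 \<and> j = Arr c \<or> i = Arr c \<and> j = Cyc s C 1))"
      unfolding exc_def by blast
    show "exceptional_pair Q I T CB CG (gen i) (gen j)"
    proof (cases s)
      case True
      then have "C \<in> CG" "Gamma_class Q I C = gen (Cyc s C 1)" using C cl(1)[of C] BC(1) by simp_all
      then show ?thesis using * unfolding exceptional_pair_def gen_Arr doubleton_eq_iff by metis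
    next
      case False
      then have "C \<in> CB" "B_class Q I C = gen (Cyc s C 1)" using C cl(2)[of C] BC(2) by simp_all
      then show ?thesis using * unfolding exceptional_pair_def gen_Arr doubleton_eq_iff by metis
    qed
  qed
qed

lemma GI_cases:
  assumes "i \<in> GI"
  obtains x where "i = Iso x" "x \<in> NN" | c where "i = Arr c" "c \<in> arcs Q - T"
    | s C where "i = Cyc s C 1" "C \<in> BC s"
  using assms by (auto simp: GI_def)

lemma product_zero:
  assumes i: "i \<in> GI" and j: "j \<in> GI" and ne: "\<not> exc i j"
  shows "repr i \<star> repr j \<in> Bd"
proof -
  have zero: "f = 0 \<Longrightarrow> f \<in> Bd" for f using ksubspaceD(1)[OF ksubspace_Bd] by simp
  show ?thesis
    using i
  proof (cases rule: GI_cases)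
    case I: (1 x)
    show ?thesis
      using j
    proof (cases rule: GI_cases)
      case (1 y)
      show ?thesis unfolding I(1) 1(1) repr.simps by (rule zero[OF NN_NN[OF I(2) 1(2)]])
    next
      case (2 c)
      show ?thesis unfolding I(1) 2(1) repr.simps by (rule zero[OF NN_cc(1)[OF I(2)]]) (use 2 in blast)
    next
      case (3 s C)
      show ?thesis unfolding I(1) 3(1) repr.simps(2) by (rule NN_ZS(1)[OF 3(2) I(2)])
    qed
  next
    case I: (2 b)
    show ?thesis
      using j
    proof (cases rule: GI_cases)
      case (1 y)
      show ?thesis unfolding I(1) 1(1) repr.simps by (rule zero[OF NN_cc(2)[OF 1(2)]]) (use I in blast)
    next
      case (2 c)
      show ?thesis unfolding I(1) 2(1) repr.simps by (rule zero[OF cc_cc]) (use I 2 in blast)+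
    next
      case (3 s C)
      have "b \<notin> set (snd C)" using ne I 3 unfolding exc_def by blast
      then have "basis (cc b) \<star> ZS s C 1 = 0"
        using cc_ZS(1)[OF 3(2) zero_less_one, of b] I(2) by (metis DiffD1)
      then show ?thesis unfolding I(1) 3(1) repr.simps(3) by (rule zero)
    qed
  next
    case I: (3 s C)
    show ?thesis
      using j
    proof (cases rule: GI_cases)
      case (1 y)
      show ?thesis unfolding I(1) 1(1) repr.simps(2) by (rule NN_ZS(2)[OF I(2) 1(2)])
    next
      case (2 c)
      have "c \<notin> set (snd C)" using ne I 2 unfolding exc_def by blast
      then have "ZS s C 1 \<star> basis (cc c) = 0"
        using cc_ZS(2)[OF I(2) zero_less_one, of c] 2(2) by (metis DiffD1)
      then show ?thesis unfolding I(1) 2(1) repr.simps(3) by (rule zero)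
    next
      case (3 s' C')
      show ?thesis
      proof (cases "s' = s")
        case True
        then have "C \<noteq> C'" using ne I 3 unfolding exc_def by blast
        moreover have "C' \<in> BC s" using 3(2) True by simp
        ultimately have "ZS s C 1 \<star> ZS s C' 1 = 0"
          unfolding ZS_mult[OF I(2) \<open>C' \<in> BC s\<close> zero_less_one zero_less_one] by (simp only: if_False)
        then show ?thesis unfolding I(1) 3(1) True by (rule zero)
      next
        case False
        then have s': "s' = (\<not> s)" by simp
        show ?thesis unfolding I(1) 3(1) s' by (rule ZS_opposite[OF I(2) 3(2)[unfolded s']])
      qed
    qed
  qed
qed

lemma exc_sym: "exc i j \<longleftrightarrow> exc j i"
  unfolding exc_def by blast

lemma exc_commute: assumes "exc i j" shows "repr i \<star> repr j = repr j \<star> repr i"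
proof -
  obtain s C where C: "C \<in> BC s" and *: "(i = Cyc s C 1 \<and> j = Cyc s C 1) \<or>
     (\<exists>c\<in>arcs Q - T. c \<in> set (snd C) \<and> (i = Cyc s C 1 \<and> j = Arr c \<or> i = Arr c \<and> j = Cyc s C 1))"
    using assms by (auto simp: exc_def)
  have "basis (cc c) \<star> ZS s C 1 = ZS s C 1 \<star> basis (cc c)" if "c \<in> arcs Q" for c
    unfolding cc_ZS(1)[OF C zero_less_one that] cc_ZS(2)[OF C zero_less_one that] ..
  then have "repr (Arr c) \<star> repr (Cyc s C 1) = repr (Cyc s C 1) \<star> repr (Arr c)" if "c \<in> arcs Q - T" for c
    using that by (simp only: repr.simps(3) DiffD1)
  then show ?thesis using * by metis
qed

text \<open>The two products are the same circuit begun at \<open>c\<close> and at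
  \<open>c'\<close>, and for a basic cycle rotation has sign 1.\<close>

lemma arrow_change:
  assumes C: "C \<in> BC s" and c: "c \<in> set (snd C)" "c' \<in> set (snd C)"
  shows "basis (cc c) \<star> ZS s C 1 - basis (cc c') \<star> ZS s C 1 \<in> Bd"
proof -
  note pc = BC_arrow[OF C c(2)]
  obtain k where k: "c = (nx s ^^ k) c'"
    using c(1) pc(3) by (auto simp: orb_def)
  have "basis (dc s c (plen C)) - basis (dc s c' (plen C)) \<in> Bd"
    using dc_rotate[OF pc(1), of k] pc(2) k by simp
  then show ?thesis
    using c cc_ZS(1)[OF C zero_less_one per_arcs[OF pc(5)]]
      cc_ZS(1)[OF C zero_less_one per_arcs[OF BC_arrow(5)[OF C c(1)]]]
    by (simp only: if_True mult_1)
qed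

text \<open>The graded commutators are formed for every degree in which a class lies. The
  coefficient at an unshared pair shows that the class of a circuit lies in no degree but its own,
  whose sign is 1.\<close>

lemma gen_deg:
  assumes C: "C \<in> BC s" and m: "gen (Cyc s C 1) \<in> HH_deg Q I m"
  shows "(- 1 :: 'k) ^ m = 1"
proof -
  note a = BC_nonempty(1)[OF C]
  let ?z = "zc s (hd (snd C)) (plen C)"
  have zX: "?z \<in> X" using zc_X[OF BC_arrow(1)[OF C a]] .
  obtain f where f: "f \<in> Z" "f \<in> kspace (Gamma_B_deg Q I m)" "cls (ZS s C 1) = cls f"
    using m by (auto simp: HH_deg_def gen_def simp del: repr.simps)
  have Z: "ZS s C 1 \<in> Z" using repr_Z[of "Cyc s C 1"] C by (simp add: IX_def del: repr.simps)
  have "ZS s C 1 - f \<in> Bd" using cls_eq_iff[OF Z f(1)] f(3) by simp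
  then have "Poly_Mapping.lookup (ZS s C 1 - f) ?z = 0"
    by (rule lookup_Bd_unshared[OF _ zX]) (simp_all add: zc_def)
  moreover have "Poly_Mapping.lookup (ZS s C 1) ?z = 1"
    using lookup_Cyc[OF C, of 1 ?z] a by (auto simp del: repr.simps)
  ultimately have "?z \<in> Gamma_B_deg Q I m"
    using kspace_lookup[OF f(2), of ?z] by (auto simp: lookup_minus simp del: repr.simps)
  then have "m = (if s then plen C else 0)"
    by (auto simp: Gamma_B_deg_eq zc_def deg_pr)
  then show ?thesis using BC_arrow(2)[OF C a] by (auto simp: sg_def split: if_splits)
qed

lemma gen_in_deg: "C \<in> BC s \<Longrightarrow> gen (Cyc s C 1) \<in> HH_deg Q I (if s then plen C else 0)"
  "c \<in> arcs Q - T \<Longrightarrow> gen (Arr c) \<in> HH_deg Q I 1"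
proof -
  show "gen (Cyc s C 1) \<in> HH_deg Q I (if s then plen C else 0)" if C: "C \<in> BC s"
    unfolding HH_deg_def gen_def
  proof (intro imageI IntI)
    show "ZS s C 1 \<in> Z" using repr_Z[of "Cyc s C 1"] C by (simp add: IX_def del: repr.simps)
    show "ZS s C 1 \<in> kspace (Gamma_B_deg Q I (if s then plen C else 0))"
      using zc_X[OF BC_arrow(1)[OF C]]
      by (auto simp: Gamma_B_deg_eq deg_pr zc_def intro!: ksubspace_sum[OF ksubspace_kspace])
  qed
  show "gen (Arr c) \<in> HH_deg Q I 1" if c: "c \<in> arcs Q - T"
    unfolding HH_deg_def gen_def
    using c cc_X[of c] d_cc[of c] by (auto simp: Gamma_B_deg_eq deg_pr Z_iff intro!: imageI)
qed

end

section \<open>Presentations of rings\<close>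

text \<open>Values are taken at arbitrary preimages; the condition on the kernels makes them
  independent of the choice.\<close>

lemma ring_hom_factor:
  assumes A: "ring A" and B: "ring B" and C: "ring C"
    and \<pi>: "\<pi> \<in> ring_hom A B" "\<pi> ` carrier A = carrier B" and \<psi>: "\<psi> \<in> ring_hom A C"
    and ker: "\<And>a. a \<in> carrier A \<Longrightarrow> \<pi> a = \<zero>\<^bsub>B\<^esub> \<Longrightarrow> \<psi> a = \<zero>\<^bsub>C\<^esub>"
  obtains \<phi> where "\<phi> \<in> ring_hom B C" "\<And>a. a \<in> carrier A \<Longrightarrow> \<phi> (\<pi> a) = \<psi> a"
proof -
  interpret A: ring A by (rule A)
  interpret B: ring B by (rule B)
  interpret C: ring C by (rule C)
  interpret \<pi>: ring_hom_ring A B \<pi> by (rule ring_hom_ringI2[OF A B \<pi>(1)])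
  interpret \<psi>: ring_hom_ring A C \<psi> by (rule ring_hom_ringI2[OF A C \<psi>])
  have eq: "\<psi> a = \<psi> a'" if a: "a \<in> carrier A" "a' \<in> carrier A" "\<pi> a = \<pi> a'" for a a'
  proof -
    have "\<pi> (a \<ominus>\<^bsub>A\<^esub> a') = \<zero>\<^bsub>B\<^esub>"
      using a by (simp add: A.minus_eq B.r_neg)
    then have "\<psi> (a \<ominus>\<^bsub>A\<^esub> a') = \<zero>\<^bsub>C\<^esub>" using ker a by simp
    then have "\<psi> a \<oplus>\<^bsub>C\<^esub> \<ominus>\<^bsub>C\<^esub> \<psi> a' = \<zero>\<^bsub>C\<^esub>" using a by (simp add: A.minus_eq)
    then show ?thesis using a C.minus_equality[of "\<psi> a" "\<ominus>\<^bsub>C\<^esub> \<psi> a'"] by simp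
  qed
  define \<phi> where "\<phi> b = \<psi> (SOME a. a \<in> carrier A \<and> \<pi> a = b)" for b
  have \<phi>: "\<phi> (\<pi> a) = \<psi> a" if a: "a \<in> carrier A" for a
  proof -
    have "(SOME a'. a' \<in> carrier A \<and> \<pi> a' = \<pi> a) \<in> carrier A \<and> \<pi> (SOME a'. a' \<in> carrier A \<and> \<pi> a' = \<pi> a) = \<pi> a"
      by (rule someI[of _ a]) (simp add: a)
    then show ?thesis unfolding \<phi>_def using eq a by blast
  qed
  have lift: "\<exists>a\<in>carrier A. b = \<pi> a" if "b \<in> carrier B" for b
    using that \<pi>(2) by blast
  have "\<phi> \<in> ring_hom B C"
  proof (rule ring_hom_memI)
    fix x assume "x \<in> carrier B"
    then obtain a where a: "a \<in> carrier A" "x = \<pi> a" using lift by blast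
    show "\<phi> x \<in> carrier C" using a by (simp add: \<phi>)
    fix y assume "y \<in> carrier B"
    then obtain b where b: "b \<in> carrier A" "y = \<pi> b" using lift by blast
    show "\<phi> (x \<otimes>\<^bsub>B\<^esub> y) = \<phi> x \<otimes>\<^bsub>C\<^esub> \<phi> y"
      using a b \<phi>[of "a \<otimes>\<^bsub>A\<^esub> b"] by (simp add: \<phi>)
    show "\<phi> (x \<oplus>\<^bsub>B\<^esub> y) = \<phi> x \<oplus>\<^bsub>C\<^esub> \<phi> y"
      using a b \<phi>[of "a \<oplus>\<^bsub>A\<^esub> b"] by (simp add: \<phi>)
  next
    show "\<phi> \<one>\<^bsub>B\<^esub> = \<one>\<^bsub>C\<^esub>" using \<phi>[of "\<one>\<^bsub>A\<^esub>"] by simp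
  qed
  then show thesis using that \<phi> by blast
qed

lemma ring_hom_kernel_ideal:
  assumes "ring A" "ring B" "h \<in> ring_hom A B"
  shows "ideal {a \<in> carrier A. h a = \<zero>\<^bsub>B\<^esub>} A"
  using ring_hom_ring.kernel_is_ideal[OF ring_hom_ringI2[OF assms]] by (simp add: a_kernel_def')

lemma quotient_facts:
  assumes "ideal N A"
  shows "(+>\<^bsub>A\<^esub>) N \<in> ring_hom A (A Quot N)" "(+>\<^bsub>A\<^esub>) N ` carrier A = carrier (A Quot N)" "ring (A Quot N)"
    "a \<in> carrier A \<Longrightarrow> N +>\<^bsub>A\<^esub> a = \<zero>\<^bsub>A Quot N\<^esub> \<longleftrightarrow> a \<in> N"
proof -
  interpret N: ideal N A by (rule assms)
  show "(+>\<^bsub>A\<^esub>) N \<in> ring_hom A (A Quot N)" by (rule N.rcos_ring_hom)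
  show "(+>\<^bsub>A\<^esub>) N ` carrier A = carrier (A Quot N)"
    by (auto simp: FactRing_def A_RCOSETS_def')
  show "ring (A Quot N)" by (rule N.quotient_is_ring)
  show "N +>\<^bsub>A\<^esub> a = \<zero>\<^bsub>A Quot N\<^esub> \<longleftrightarrow> a \<in> N" if a: "a \<in> carrier A"
  proof -
    have "N +>\<^bsub>A\<^esub> a = N +>\<^bsub>A\<^esub> \<zero>\<^bsub>A\<^esub> \<longleftrightarrow> a \<ominus>\<^bsub>A\<^esub> \<zero>\<^bsub>A\<^esub> \<in> N"
      using N.quotient_eq_iff_same_a_r_cos[OF assms a N.zero_closed] by blast
    moreover have "N +>\<^bsub>A\<^esub> \<zero>\<^bsub>A\<^esub> = N" by (rule N.a_rcos_zero[OF assms]) simp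
    moreover have "a \<ominus>\<^bsub>A\<^esub> \<zero>\<^bsub>A\<^esub> = a" using a by (simp add: N.minus_eq)
    ultimately show ?thesis by (simp add: FactRing_def)
  qed
qed

lemma free_algebra_sel:
  "carrier (free_algebra G) = kspace (lists G)"
  "mult (free_algebra G) = bilinear_ext (\<lambda>u v. basis (u @ v))"
  "one (free_algebra G) = basis []" "zero (free_algebra G) = 0" "add (free_algebra G) = (+)"
  by (auto simp: free_algebra_def)

lemma ring_free_algebra: "ring (free_algebra G :: ('g list \<Rightarrow>\<^sub>0 'k::field) ring)"
proof (rule ringI)
  let ?m = "bilinear_ext (\<lambda>u v. basis (u @ v)) :: ('g list \<Rightarrow>\<^sub>0 'k) \<Rightarrow> _ \<Rightarrow> _"
  have closed: "?m f g \<in> kspace (lists G)" if "f \<in> kspace (lists G)" "g \<in> kspace (lists G)" for f g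
    by (rule bilinear_closed[OF that ksubspace_kspace]) auto
  have assoc: "?m (?m f g) h = ?m f (?m g h)"
    if "f \<in> kspace (lists G)" "g \<in> kspace (lists G)" "h \<in> kspace (lists G)" for f g h
    by (rule bilinear_assoc[OF that]) simp
  have one: "?m (basis []) f = f" "?m f (basis []) = f" if "f \<in> kspace (lists G)" for f
  proof -
    show "?m (basis []) f = f"
      by (rule klinear_eqI[OF klinear_bilinear_right klinear_id that]) simp
    show "?m f (basis []) = f"
      by (rule klinear_eqI[OF klinear_bilinear_left klinear_id that]) simp
  qed
  show "abelian_group (free_algebra G :: ('g list \<Rightarrow>\<^sub>0 'k) ring)"
  proof (rule abelian_groupI; simp only: free_algebra_sel)
    show "\<exists>y\<in>kspace (lists G). y + x = 0" if "x \<in> kspace (lists G)" for x :: "'g list \<Rightarrow>\<^sub>0 'k"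
      using that kspace_intros(4) by (intro bexI[of _ "- x"]) auto
  qed (auto simp: kspace_intros add_ac)
  show "Group.monoid (free_algebra G :: ('g list \<Rightarrow>\<^sub>0 'k) ring)"
    by (rule Group.monoidI; simp only: free_algebra_sel) (simp_all add: closed assoc one)
qed (simp_all only: free_algebra_sel bilinear_simps)

lemma free_algebra_minus:
  assumes "x \<in> kspace (lists G)" "y \<in> kspace (lists G)"
  shows "x \<ominus>\<^bsub>free_algebra G\<^esub> y = x - (y :: 'g list \<Rightarrow>\<^sub>0 'k::field)"
proof -
  interpret F: ring "free_algebra G :: ('g list \<Rightarrow>\<^sub>0 'k) ring" by (rule ring_free_algebra)
  have "\<ominus>\<^bsub>free_algebra G\<^esub> y = - y"
    by (rule F.minus_equality) (use assms(2) in \<open>simp_all add: free_algebra_sel kspace_intros\<close>)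
  then show ?thesis by (simp add: a_minus_def free_algebra_sel)
qed

text \<open>Multiplication by a scalar is multiplication by a multiple of the empty word, which is
  an element of the ring.\<close>

lemma ksubspace_ideal:
  assumes "ideal N (free_algebra G :: ('g list \<Rightarrow>\<^sub>0 'k::field) ring)"
  shows "ksubspace N"
proof -
  interpret N: ideal N "free_algebra G :: ('g list \<Rightarrow>\<^sub>0 'k) ring" by (rule assms)
  show ?thesis
    unfolding ksubspace_def
  proof (intro conjI ballI allI)
    show "0 \<in> N" using additive_subgroup.zero_closed[OF N.additive_subgroup_axioms] by (simp add: free_algebra_sel)
    show "f + g \<in> N" if "f \<in> N" "g \<in> N" for f g
      using additive_subgroup.a_closed[OF N.additive_subgroup_axioms that] by (simp add: free_algebra_sel)
    show "scale c f \<in> N" if f: "f \<in> N" for c f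
    proof -
      have fc: "f \<in> kspace (lists G)" using N.Icarr[OF f] by (simp add: free_algebra_sel)
      have "scale c (basis []) \<in> kspace (lists G)" by (simp add: kspace_intros)
      then have "scale c (basis []) \<otimes>\<^bsub>free_algebra G\<^esub> f \<in> N"
        using N.I_l_closed[OF f] by (simp add: free_algebra_sel)
      moreover have "basis [] \<otimes>\<^bsub>free_algebra G\<^esub> f = f"
        using N.l_one fc by (simp add: free_algebra_sel)
      ultimately show ?thesis by (simp add: free_algebra_sel bilinear_simps)
    qed
  qed
qed

text \<open>The universal property, restricted to target rings whose elements are finitely supported
  functions, so that \<open>linear_ext\<close> extends values on words. It is applied to the ring of
  cocycles.\<close>

lemma free_algebra_hom:
  fixes R :: "('x \<Rightarrow>\<^sub>0 'k::field) ring" and rho :: "'g \<Rightarrow> ('x \<Rightarrow>\<^sub>0 'k)" and m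
  assumes R: "ring R" and add: "add R = (+)" and mult: "mult R = bilinear_ext m"
    and sub: "ksubspace (carrier R)" and rho: "\<And>g. g \<in> G \<Longrightarrow> rho g \<in> carrier R"
  defines "wp \<equiv> \<lambda>w. foldr (\<lambda>g x. bilinear_ext m (rho g) x) w (one R)"
  shows "w \<in> lists G \<Longrightarrow> wp w \<in> carrier R"
    and "linear_ext wp \<in> ring_hom (free_algebra G) R"
proof -
  interpret R: ring R by (rule R)
  have wp: "wp w \<in> carrier R" if "w \<in> lists G" for w
    using that
  proof (induction w)
    case (Cons g w)
    have "rho g \<otimes>\<^bsub>R\<^esub> wp w \<in> carrier R" using Cons rho by simp
    then show ?case by (simp add: wp_def mult)
  qed (simp add: wp_def)
  then show "w \<in> lists G \<Longrightarrow> wp w \<in> carrier R" .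
  have app: "wp (u @ v) = bilinear_ext m (wp u) (wp v)" if "u \<in> lists G" "v \<in> lists G" for u v
    using that(1)
  proof (induction u)
    case Nil
    then show ?case using R.l_one[OF wp[OF that(2)]] by (simp add: wp_def mult)
  next
    case (Cons g u)
    have "wp ((g # u) @ v) = rho g \<otimes>\<^bsub>R\<^esub> (wp u \<otimes>\<^bsub>R\<^esub> wp v)"
      using Cons.IH by (simp add: wp_def mult)
    also have "\<dots> = (rho g \<otimes>\<^bsub>R\<^esub> wp u) \<otimes>\<^bsub>R\<^esub> wp v"
      using Cons.hyps rho wp that(2) by (simp add: R.m_assoc)
    finally show ?case by (simp add: wp_def mult)
  qed
  have mem: "linear_ext wp x \<in> carrier R" if "x \<in> kspace (lists G)" for x
    by (rule klinear_memI[OF klinear_linear_ext sub that]) (simp add: wp)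
  show "linear_ext wp \<in> ring_hom (free_algebra G) R"
  proof (rule ring_hom_memI; simp only: free_algebra_sel add mult)
    show "linear_ext wp x \<in> carrier R" if "x \<in> kspace (lists G)" for x using that by (rule mem)
    show "linear_ext wp (x + y) = linear_ext wp x + linear_ext wp y" for x y :: "'g list \<Rightarrow>\<^sub>0 'k"
      by (rule klinearD(1)[OF klinear_linear_ext])
    show "linear_ext wp (basis []) = \<one>\<^bsub>R\<^esub>" by (simp add: wp_def)
    fix x y :: "'g list \<Rightarrow>\<^sub>0 'k" assume x: "x \<in> kspace (lists G)" and y: "y \<in> kspace (lists G)"
    show "linear_ext wp (bilinear_ext (\<lambda>u v. basis (u @ v)) x y) = bilinear_ext m (linear_ext wp x) (linear_ext wp y)"
    proof (rule klinear_eqI[OF klinear_comp[OF klinear_linear_ext klinear_bilinear_left]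
          klinear_comp[OF klinear_bilinear_left klinear_linear_ext] x])
      fix u assume u: "u \<in> lists G"
      show "linear_ext wp (bilinear_ext (\<lambda>u v. basis (u @ v)) (basis u) y) = bilinear_ext m (linear_ext wp (basis u)) (linear_ext wp y)"
        by (rule klinear_eqI[OF klinear_comp[OF klinear_linear_ext klinear_bilinear_right]
              klinear_comp[OF klinear_bilinear_right klinear_linear_ext] y])
          (simp add: app u)
    qed
  qed
qed

section \<open>Normal forms of words\<close>

context gentle_data
begin

primrec word :: "('v, 'a) idx \<Rightarrow> ('v, 'a, 'k) cochain set list" where
  "word Unit = []"
| "word (Iso x) = [gen (Iso x)]"
| "word (Arr c) = [gen (Arr c)]"
| "word (Cyc s C n) = replicate n (gen (Cyc s C 1))"
| "word (ArrCyc s C n) = gen (Arr (ch C)) # replicate n (gen (Cyc s C 1))"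

abbreviation W :: "(('v, 'a) idx \<Rightarrow>\<^sub>0 'k) \<Rightarrow> (('v, 'a, 'k) cochain set list \<Rightarrow>\<^sub>0 'k)" where
  "W \<equiv> linear_ext (\<lambda>i. basis (word i))"

abbreviation "FA \<equiv> free_algebra G :: (('v, 'a, 'k) cochain set list \<Rightarrow>\<^sub>0 'k) ring"

lemma Cyc_GI: "C \<in> BC s \<Longrightarrow> Cyc s C 1 \<in> GI" and Arr_GI: "c \<in> arcs Q - T \<Longrightarrow> Arr c \<in> GI"
  by (auto simp: GI_def)

lemma gen_G: "i \<in> GI \<Longrightarrow> gen i \<in> G"
  by (simp add: G_eq)

lemma word_lists: assumes "i \<in> IX" shows "word i \<in> lists G"
  using assms
proof (cases rule: IX_cases)
  case (2 x)
  then show ?thesis using gen_G[of "Iso x"] by (simp add: GI_def)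
next
  case (3 c)
  then show ?thesis using gen_G[OF Arr_GI, of c] by simp
next
  case (4 s C n)
  then show ?thesis using gen_G[OF Cyc_GI[OF 4(2)]] by (auto simp: lists_eq_set)
next
  case (5 s C n)
  then show ?thesis using gen_G[OF Cyc_GI[OF 5(2)]] gen_G[OF Arr_GI[OF ch(2)[OF 5(2)]]] by (auto simp: lists_eq_set)
qed simp

lemma exc_Arr: "exc i (Arr c) \<Longrightarrow> \<exists>s. \<exists>C\<in>BC s. c \<in> set (snd C) \<and> c \<in> arcs Q - T \<and> i = Cyc s C 1"
  unfolding exc_def by blast

lemma exc_Cyc: "exc i (Cyc s C 1) \<Longrightarrow> i = Cyc s C 1 \<or> (\<exists>c\<in>arcs Q - T. c \<in> set (snd C) \<and> i = Arr c)"
  unfolding exc_def by blast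

lemma not_exc_Iso: "\<not> exc i (Iso x)"
  unfolding exc_def by blast

text \<open>It suffices to multiply a normal form by one generator from the left; a word is then
  reduced letter by letter, beginning at its right end. The ideal is left open, since the relations
  are imposed in two stages and \<open>N\<close> will be their common preimage.\<close>

lemma normal_form:
  assumes N: "ideal N FA"
    and N1: "\<And>i j. i \<in> GI \<Longrightarrow> j \<in> GI \<Longrightarrow> \<not> exc i j \<Longrightarrow> basis [gen i, gen j] \<in> N"
    and N2: "\<And>s C c. C \<in> BC s \<Longrightarrow> c \<in> arcs Q - T \<Longrightarrow>
      basis [gen (Cyc s C 1), gen (Arr c)] - basis [gen (Arr c), gen (Cyc s C 1)] \<in> N"
    and N3: "\<And>s C c c'. C \<in> BC s \<Longrightarrow> c \<in> arcs Q - T \<Longrightarrow> c' \<in> arcs Q - T \<Longrightarrow> c \<in> set (snd C) \<Longrightarrow> c' \<in> set (snd C) \<Longrightarrow>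
      basis [gen (Arr c), gen (Cyc s C 1)] - basis [gen (Arr c'), gen (Cyc s C 1)] \<in> N"
    and x: "x \<in> kspace (lists G)"
  shows "\<exists>l\<in>kspace IX. x - W l \<in> N"
proof -
  interpret N: ideal N FA by (rule N)
  have subN: "ksubspace N" by (rule ksubspace_ideal[OF N])
  define Red where "Red = {f. \<exists>l\<in>kspace IX. f - W l \<in> N}"
  have subR: "ksubspace Red" unfolding Red_def by (rule ksubspace_mod_span[OF subN])
  have lin0: "W 0 = 0" by (rule klinearD(3)[OF klinear_linear_ext])
  have NR: "f \<in> Red" if "f \<in> N" for f
    unfolding Red_def using that lin0 kspace_intros(1) by (auto intro!: bexI[of _ 0])
  have wR: "basis (word i) \<in> Red" if "i \<in> IX" for i
    unfolding Red_def using that ksubspaceD(1)[OF subN] by (auto intro!: bexI[of _ "basis i"])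
  have cong: "f \<in> Red" if "f - g \<in> N" "g \<in> Red" for f g
    using ksubspaceD(2)[OF subR NR[OF that(1)] that(2)] by simp
  let ?m = "bilinear_ext (\<lambda>u v. basis (u @ v)) :: (('v, 'a, 'k) cochain set list \<Rightarrow>\<^sub>0 'k) \<Rightarrow> _"
  have mR: "?m f (basis w) \<in> N" if "f \<in> N" "w \<in> lists G" for f w
    using N.I_r_closed[OF that(1), of "basis w"] that(2) by (simp add: free_algebra_sel)
  have mL: "?m (basis w) f \<in> N" if "f \<in> N" "w \<in> lists G" for f w
    using N.I_l_closed[OF that(1), of "basis w"] that(2) by (simp add: free_algebra_sel)
  have zero2: "basis (gen i # gen j # w) \<in> N" if "i \<in> GI" "j \<in> GI" "\<not> exc i j" "w \<in> lists G" for i j w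
    using mR[OF N1[OF that(1-3)] that(4)] by simp
  have swap: "basis (gen (Cyc s C 1) # gen (Arr c) # w) - basis (gen (Arr c) # gen (Cyc s C 1) # w) \<in> N"
    if "C \<in> BC s" "c \<in> arcs Q - T" "w \<in> lists G" for s C c w
    using mR[OF N2[OF that(1,2)] that(3)] by (simp add: bilinear_simps)
  have change: "basis (gen (Arr c) # gen (Cyc s C 1) # w) - basis (gen (Arr c') # gen (Cyc s C 1) # w) \<in> N"
    if "C \<in> BC s" "c \<in> arcs Q - T" "c' \<in> arcs Q - T" "c \<in> set (snd C)" "c' \<in> set (snd C)" "w \<in> lists G" for s C c c' w
    using mR[OF N3[OF that(1-5)] that(6)] by (simp add: bilinear_simps)
  have rep: "replicate n (gen (Cyc s C 1)) \<in> lists G" if "C \<in> BC s" for n s C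
    using gen_G[OF Cyc_GI[OF that]] by (auto simp: lists_eq_set)
  have ArrCyc: "basis (gen (Arr c) # replicate n (gen (Cyc s C 1))) \<in> Red"
    if C: "C \<in> BC s" "c \<in> arcs Q - T" "c \<in> set (snd C)" and n: "n > 0" for s C c n
  proof -
    obtain k where k: "n = Suc k" using n by (cases n) auto
    have "ArrCyc s C n \<in> IX" using C n by (auto simp: IX_def)
    from wR[OF this] have "basis (gen (Arr (ch C)) # gen (Cyc s C 1) # replicate k (gen (Cyc s C 1))) \<in> Red"
      by (simp add: k)
    from cong[OF change[OF C(1,2) ch(2)[OF C(1)] C(3) ch(1)[OF C(1)] rep[OF C(1)]] this]
    show ?thesis by (simp add: k)
  qed
  have step: "basis (gen i # word j) \<in> Red" if i: "i \<in> GI" and j: "j \<in> IX" for i j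
    using j
  proof (cases rule: IX_cases)
    case 1
    have "i \<in> IX" "word i = [gen i]" using i GI_IX by (auto simp: GI_def)
    then show ?thesis using wR[of i] 1 by simp
  next
    case (2 x)
    then have "Iso x \<in> GI" by (simp add: GI_def)
    from zero2[OF i this not_exc_Iso lists.Nil] show ?thesis using 2 NR by simp
  next
    case (3 c)
    then have c: "c \<in> arcs Q - T" by simp
    show ?thesis
    proof (cases "exc i (Arr c)")
      case False
      from zero2[OF i Arr_GI[OF c] False lists.Nil] show ?thesis using 3 NR by simp
    next
      case True
      then obtain s C where C: "C \<in> BC s" "c \<in> set (snd C)" "i = Cyc s C 1" using exc_Arr by blast
      have "basis (gen (Arr c) # gen (Cyc s C 1) # []) \<in> Red"
        using ArrCyc[OF C(1) c C(2), of 1] by simp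
      from cong[OF swap[OF C(1) c lists.Nil] this] show ?thesis using 3 C(3) by simp
    qed
  next
    case (4 s C n)
    obtain k where k: "n = Suc k" using 4(3) by (cases n) auto
    have w: "word j = gen (Cyc s C 1) # replicate k (gen (Cyc s C 1))" using 4(1) k by simp
    show ?thesis
    proof (cases "exc i (Cyc s C 1)")
      case False
      from zero2[OF i Cyc_GI[OF 4(2)] False rep[OF 4(2)]] show ?thesis unfolding w by (rule NR)
    next
      case True
      then consider "i = Cyc s C 1" | c where "c \<in> arcs Q - T" "c \<in> set (snd C)" "i = Arr c"
        using exc_Cyc by blast
      then show ?thesis
      proof cases
        case 1
        have "Cyc s C (Suc n) \<in> IX" using 4 by (auto simp: IX_def)
        from wR[OF this] show ?thesis using 1 4(1) by simp
      next
        case (2 c)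
        from ArrCyc[OF 4(2) 2(1,2) 4(3)] show ?thesis using 2(3) 4(1) by simp
      qed
    qed
  next
    case (5 s C n)
    obtain k where k: "n = Suc k" using 5(3) by (cases n) auto
    note c = ch[OF 5(2)]
    have w: "word j = gen (Arr (ch C)) # replicate n (gen (Cyc s C 1))" using 5(1) by simp
    show ?thesis
    proof (cases "exc i (Arr (ch C))")
      case False
      from zero2[OF i Arr_GI[OF c(2)] False rep[OF 5(2)]] show ?thesis unfolding w by (rule NR)
    next
      case True
      then obtain s' C' where C': "C' \<in> BC s'" "ch C \<in> set (snd C')" "i = Cyc s' C' 1" using exc_Arr by blast
      \<comment> \<open>After moving the arrow to the front two circuits are adjacent: either they
        are equal and the power grows by one, or their product is among the relations.\<close>
      have "basis (gen (Arr (ch C)) # gen (Cyc s' C' 1) # replicate n (gen (Cyc s C 1))) \<in> Red"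
      proof (cases "Cyc s' C' 1 = Cyc s C 1")
        case eq: True
        have "ArrCyc s C (Suc n) \<in> IX" using 5 by (auto simp: IX_def)
        from wR[OF this] show ?thesis unfolding eq by simp
      next
        case False
        then have "\<not> exc (Cyc s' C' 1) (Cyc s C 1)" using exc_Cyc by blast
        from zero2[OF Cyc_GI[OF C'(1)] Cyc_GI[OF 5(2)] this rep[OF 5(2), of k]]
        have "basis (gen (Cyc s' C' 1) # replicate n (gen (Cyc s C 1))) \<in> N" by (simp add: k)
        from mL[OF this, of "[gen (Arr (ch C))]"] show ?thesis
          using gen_G[OF Arr_GI[OF c(2)]] NR by simp
      qed
      from cong[OF swap[OF C'(1) c(2) rep[OF 5(2)]] this] show ?thesis unfolding w C'(3) .
    qed
  qed
  have word: "basis w \<in> Red" if "w \<in> lists G" for w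
    using that
  proof (induction w)
    case Nil
    have "Unit \<in> IX" by (simp add: IX_def)
    from wR[OF this] show ?case by simp
  next
    case (Cons g w)
    obtain i where i: "i \<in> GI" "g = gen i" using Cons.hyps(1) G_eq by blast
    obtain l where l: "l \<in> kspace IX" "basis w - W l \<in> N" using Cons.IH by (auto simp: Red_def)
    have g: "[g] \<in> lists G" using Cons.hyps(1) by simp
    have "basis (g # w) - ?m (basis [g]) (W l) \<in> N"
      using mL[OF l(2) g] by (simp add: bilinear_simps)
    moreover have "?m (basis [g]) (W l) \<in> Red"
      by (rule klinear_memI[OF klinear_comp[OF klinear_bilinear_right klinear_linear_ext] subR l(1)])
        (simp add: i(2) step[OF i(1)])
    ultimately show ?case by (rule cong)
  qed
  have "x \<in> Red"
    by (rule klinear_memI[OF klinear_id subR x]) (rule word)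
  then show ?thesis by (simp add: Red_def)
qed

section \<open>The presentation\<close>

text \<open>The generators are classes, so a cocycle has to be chosen in each. It may differ from
  \<open>repr\<close> by a coboundary, which is why values of words are compared only as
  classes.\<close>

definition rho :: "('v, 'a, 'k) cochain set \<Rightarrow> ('v, 'a, 'k) cochain" where
  "rho g = (SOME f. f \<in> Z \<and> cls f = g)"

text \<open>Words are evaluated as cocycles, not in \<open>HH Q I\<close>, because the elements of
  the latter are cosets and \<open>linear_ext\<close> does not apply to them.\<close>

definition wval :: "('v, 'a, 'k) cochain set list \<Rightarrow> ('v, 'a, 'k) cochain" where
  "wval = (\<lambda>w. foldr (\<lambda>g x. rho g \<star> x) w unit_cochain)"

definition psi :: "(('v, 'a, 'k) cochain set list \<Rightarrow>\<^sub>0 'k) \<Rightarrow> ('v, 'a, 'k) cochain set" where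
  "psi x = cls (linear_ext wval x)"

lemma gen_Z: "i \<in> GI \<Longrightarrow> repr i \<in> Z"
  using repr_Z GI_IX by blast

lemma rho: assumes "g \<in> G" shows "rho g \<in> Z" "cls (rho g) = g"
proof -
  obtain i where "i \<in> GI" "g = gen i" using assms G_eq by blast
  then have "\<exists>f. f \<in> Z \<and> cls f = g" using gen_Z by (auto simp: gen_def)
  from someI_ex[OF this] show "rho g \<in> Z" "cls (rho g) = g" unfolding rho_def by auto
qed

lemma wval_hom:
  "w \<in> lists G \<Longrightarrow> wval w \<in> Z" "linear_ext wval \<in> ring_hom FA (cocycle_ring Q I)"
proof -
  note h = free_algebra_hom[OF cocycle_ring, of "cup_basis Q I" G rho, unfolded cocycle_ring_sel,
      OF refl refl ksubspace_Z rho(1)]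
  show "w \<in> lists G \<Longrightarrow> wval w \<in> Z" "linear_ext wval \<in> ring_hom FA (cocycle_ring Q I)"
    using h unfolding wval_def by blast+
qed

lemma psi_hom: "psi \<in> ring_hom FA (HH Q I)"
  using ring_hom_trans[OF wval_hom(2) cls_hom] by (simp add: psi_def[abs_def] comp_def)

lemma psi_Cons:
  assumes "g \<in> G" "w \<in> lists G"
  shows "psi (basis (g # w)) = g \<otimes>\<^bsub>HH Q I\<^esub> psi (basis w)"
  using cls_simps(1)[OF rho(1)[OF assms(1)] wval_hom(1)[OF assms(2)]] rho(2)[OF assms(1)]
  by (simp add: psi_def) (simp add: wval_def)

lemma psi_Nil: "psi (basis []) = \<one>\<^bsub>HH Q I\<^esub>"
  by (simp add: psi_def wval_def cls_unit)

lemma psi_single: "g \<in> G \<Longrightarrow> psi (basis [g]) = g"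
  using cls_simps(1)[OF rho(1) unit_Z, of g] rho[of g] psi_Cons[of g "[]"] psi_Nil unit_cup(2)[of "rho g"]
  by (simp add: cls_unit Z_iff)

lemma psi_pair:
  assumes "i \<in> GI" "j \<in> GI"
  shows "psi (basis [gen i, gen j]) = cls (repr i \<star> repr j)"
  using psi_Cons[OF gen_G[OF assms(1)], of "[gen j]"] psi_single[OF gen_G[OF assms(2)]] gen_G[OF assms(2)]
    cls_simps(1)[OF gen_Z gen_Z, OF assms] by (simp add: gen_def)

lemma psi_replicate:
  assumes C: "C \<in> BC s" shows "psi (basis (replicate (Suc n) (gen (Cyc s C 1)))) = cls (ZS s C (Suc n))"
proof (induction n)
  case 0
  show ?case using psi_single[OF gen_G[OF Cyc_GI[OF C]]] by (simp add: gen_def del: repr.simps)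
next
  case (Suc n)
  have Z: "ZS s C (Suc k) \<in> Z" for k using repr_Z[of "Cyc s C (Suc k)"] C by (auto simp: IX_def simp del: repr.simps)
  have "replicate (Suc n) (gen (Cyc s C 1)) \<in> lists G"
    using gen_G[OF Cyc_GI[OF C]] by (auto simp: lists_eq_set)
  then have "psi (basis (replicate (Suc (Suc n)) (gen (Cyc s C 1)))) = gen (Cyc s C 1) \<otimes>\<^bsub>HH Q I\<^esub> cls (ZS s C (Suc n))"
    using psi_Cons[OF gen_G[OF Cyc_GI[OF C]], of "replicate (Suc n) (gen (Cyc s C 1))"] Suc by simp
  also have "\<dots> = cls (ZS s C 1 \<star> ZS s C (Suc n))"
    unfolding gen_def using cls_simps(1)[OF Z[of 0] Z[of n]] by simp
  also have "ZS s C 1 \<star> ZS s C (Suc n) = ZS s C (Suc (Suc n))"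
    using ZS_mult[OF C C, of 1 "Suc n"] by (simp del: repr.simps)
  finally show ?case .
qed

text \<open>The bridge between the two readings of an index: through it, independence of the classes
  becomes independence of the normal forms modulo the relations.\<close>

lemma psi_word: assumes "i \<in> IX" shows "psi (basis (word i)) = cls (repr i)"
  using assms
proof (cases rule: IX_cases)
  case 1
  then show ?thesis by (simp add: psi_Nil cls_unit)
next
  case (2 x)
  then show ?thesis using psi_single[OF gen_G, of "Iso x"] by (simp add: GI_def gen_def)
next
  case (3 c)
  then show ?thesis using psi_single[OF gen_G[OF Arr_GI], of c] by (simp add: gen_def)
next
  case (4 s C n)
  then obtain k where "n = Suc k" by (cases n) auto
  then show ?thesis using psi_replicate[OF 4(2), of k] 4(1) by (simp del: repr.simps)
next
  case (5 s C n)
  then obtain k where k: "n = Suc k" by (cases n) auto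
  note c = ch[OF 5(2)]
  have rep: "replicate n (gen (Cyc s C 1)) \<in> lists G"
    using gen_G[OF Cyc_GI[OF 5(2)]] by (auto simp: lists_eq_set)
  have Z: "ZS s C n \<in> Z" "basis (cc (ch C)) \<in> Z"
    using repr_Z[of "Cyc s C n"] gen_Z[OF Arr_GI[OF c(2)]] 5 by (auto simp: IX_def simp del: repr.simps(4))
  have "psi (basis (word i)) = gen (Arr (ch C)) \<otimes>\<^bsub>HH Q I\<^esub> cls (ZS s C n)"
    using psi_Cons[OF gen_G[OF Arr_GI[OF c(2)]] rep] psi_replicate[OF 5(2), of k] 5(1) k by (simp del: repr.simps)
  also have "\<dots> = cls (basis (cc (ch C)) \<star> ZS s C n)"
    using cls_simps(1)[OF Z(2,1)] by (simp add: gen_def del: repr.simps(4))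
  also have "basis (cc (ch C)) \<star> ZS s C n = repr i"
    using cc_ZS(1)[OF 5(2,3), of "ch C"] c 5(1) by (simp del: repr.simps(4))
  finally show ?thesis .
qed

lemma linear_ext_wval_Z: "x \<in> kspace (lists G) \<Longrightarrow> linear_ext wval x \<in> Z"
  by (rule klinear_memI[OF klinear_linear_ext ksubspace_Z], assumption) (simp only: linear_ext_basis, rule wval_hom(1))

lemma W_lists: "l \<in> kspace IX \<Longrightarrow> W l \<in> kspace (lists G)"
  by (rule klinear_memI[OF klinear_linear_ext ksubspace_kspace], assumption) (simp only: linear_ext_basis basis_in_kspace, rule word_lists)

lemma linear_ext_repr_Z: "l \<in> kspace IX \<Longrightarrow> linear_ext repr l \<in> Z"
  by (rule klinear_memI[OF klinear_linear_ext ksubspace_Z]) (auto simp: repr_Z)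

lemma psi_W: assumes l: "l \<in> kspace IX" shows "psi (W l) = cls (linear_ext repr l)"
proof -
  have "linear_ext wval (W l) - linear_ext repr l \<in> Bd"
  proof (rule klinear_memI[OF klinear_diff[OF klinear_comp[OF klinear_linear_ext klinear_linear_ext] klinear_linear_ext] ksubspace_Bd l])
    fix i assume i: "i \<in> IX"
    have "cls (wval (word i)) = cls (repr i)" using psi_word[OF i] by (simp add: psi_def)
    then show "linear_ext wval (W (basis i)) - linear_ext repr (basis i) \<in> Bd"
      using cls_eq_iff[OF wval_hom(1)[OF word_lists[OF i]] repr_Z[OF i]] by simp
  qed
  then show ?thesis
    using cls_eq_iff[OF linear_ext_wval_Z[OF W_lists[OF l]] linear_ext_repr_Z[OF l]] by (simp add: psi_def)
qed

lemma psi_surj: "psi ` kspace (lists G) = carrier (HH Q I)"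
proof
  show "psi ` kspace (lists G) \<subseteq> carrier (HH Q I)"
    using linear_ext_wval_Z by (auto simp: carrier_HH psi_def)
  show "carrier (HH Q I) \<subseteq> psi ` kspace (lists G)"
  proof
    fix y assume "y \<in> carrier (HH Q I)"
    then obtain f where f: "f \<in> Z" "y = cls f" by (auto simp: carrier_HH)
    obtain l where l: "l \<in> kspace IX" "f - linear_ext repr l \<in> Bd"
      using cocycle_SP[OF f(1)] by (auto simp: SP_def)
    have "y = psi (W l)"
      using cls_eq_iff[OF f(1) linear_ext_repr_Z[OF l(1)]] l f(2) psi_W[OF l(1)] by simp
    then show "y \<in> psi ` kspace (lists G)" using W_lists[OF l(1)] by blast
  qed
qed

lemma psi_W_zero: assumes "l \<in> kspace IX" "psi (W l) = \<zero>\<^bsub>HH Q I\<^esub>" shows "l = 0"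
  using assms psi_W repr_independent cls_eq_0_iff[OF linear_ext_repr_Z] by metis

abbreviation "K \<equiv> commutator_ideal (HH_deg Q I) G :: (('v, 'a, 'k) cochain set list \<Rightarrow>\<^sub>0 'k) set"
abbreviation "F \<equiv> free_gca (HH_deg Q I) G :: (('v, 'a, 'k) cochain set list \<Rightarrow>\<^sub>0 'k) set ring"
abbreviation "iota \<equiv> gca_gen (HH_deg Q I) G :: _ \<Rightarrow> (('v, 'a, 'k) cochain set list \<Rightarrow>\<^sub>0 'k) set"
abbreviation "J \<equiv> Idl\<^bsub>F\<^esub> (HH_relations Q I T CB CG F iota)"

lemma graded_commutators_carrier:
  "(graded_commutators (HH_deg Q I) G :: (('v, 'a, 'k) cochain set list \<Rightarrow>\<^sub>0 'k) set) \<subseteq> carrier FA"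
  by (auto simp: graded_commutators_def free_algebra_sel intro!: kspace_intros(5,3))

lemma ideal_K: "ideal K FA"
  unfolding commutator_ideal_def
  by (rule ring.genideal_ideal[OF ring_free_algebra graded_commutators_carrier])

lemma minus_psi:
  assumes "x \<in> kspace (lists G)" "y \<in> kspace (lists G)"
  shows "psi (x - y) = \<zero>\<^bsub>HH Q I\<^esub> \<longleftrightarrow> psi x = psi y"
proof -
  note Z = linear_ext_wval_Z[OF assms(1)] linear_ext_wval_Z[OF assms(2)]
  have "linear_ext wval x - linear_ext wval y \<in> Z" using Z by (intro ksubspaceD[OF ksubspace_Z])
  then show ?thesis
    using cls_eq_iff[OF Z] cls_eq_0_iff by (simp add: psi_def klinearD[OF klinear_linear_ext])
qed

lemma pair_lists: "i \<in> GI \<Longrightarrow> j \<in> GI \<Longrightarrow> basis [gen i, gen j] \<in> kspace (lists G)"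
  using gen_G by simp

lemma psi_zero_iff: "x \<in> kspace (lists G) \<Longrightarrow> psi x = \<zero>\<^bsub>HH Q I\<^esub> \<longleftrightarrow> linear_ext wval x \<in> Bd"
  unfolding psi_def by (rule cls_eq_0_iff[OF linear_ext_wval_Z])

lemma pair_zero:
  assumes "i \<in> GI" "j \<in> GI" "\<not> exc i j"
  shows "psi (basis [gen i, gen j]) = \<zero>\<^bsub>HH Q I\<^esub>"
  unfolding psi_pair[OF assms(1,2)] cls_eq_0_iff[OF cup_Z[OF gen_Z[OF assms(1)] gen_Z[OF assms(2)]]]
  by (rule product_zero[OF assms])

text \<open>An exceptional pair contains a circuit, so the Koszul sign is 1, and its two products
  agree as cochains. For any other pair both products are zero in cohomology and the sign is
  irrelevant.\<close>

lemma K_psi: "x \<in> K \<Longrightarrow> psi x = \<zero>\<^bsub>HH Q I\<^esub>"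
proof -
  have "graded_commutators (HH_deg Q I) G \<subseteq> {x \<in> carrier FA. psi x = \<zero>\<^bsub>HH Q I\<^esub>}"
  proof
    fix x :: "('v, 'a, 'k) cochain set list \<Rightarrow>\<^sub>0 'k"
    assume x: "x \<in> graded_commutators (HH_deg Q I) G"
    then obtain u v m n where *: "x = basis [u, v] - scale ((- 1) ^ (m * n)) (basis [v, u])"
      "u \<in> G" "v \<in> G" "u \<in> HH_deg Q I m" "v \<in> HH_deg Q I n"
      by (auto simp: graded_commutators_def)
    obtain i where i: "i \<in> GI" "u = gen i" using *(2) unfolding G_eq by (rule imageE)
    obtain j where j: "j \<in> GI" "v = gen j" using *(3) unfolding G_eq by (rule imageE)
    note ij = i j
    have "psi x = \<zero>\<^bsub>HH Q I\<^esub>"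
    proof (cases "exc i j")
      case True
      obtain s C where C: "C \<in> BC s" "i = Cyc s C 1 \<or> j = Cyc s C 1" using True unfolding exc_def by blast
      have sg: "((- 1) ^ (m * n) :: 'k) = 1"
        using C(2)
      proof
        assume "i = Cyc s C 1"
        then have "(- 1 :: 'k) ^ m = 1" using gen_deg[OF C(1), of m] *(4) ij(2) by blast
        then show ?thesis by (simp add: power_mult)
      next
        assume "j = Cyc s C 1"
        then have "(- 1 :: 'k) ^ n = 1" using gen_deg[OF C(1), of n] *(5) ij(4) by blast
        then have "((- 1 :: 'k) ^ n) ^ m = 1" by simp
        then show ?thesis by (simp only: power_mult[symmetric] mult.commute)
      qed
      have "x = basis [gen i, gen j] - basis [gen j, gen i]"
        unfolding *(1) sg scale_simps(3) ij(2,4) ..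
      then show ?thesis
        using minus_psi[OF pair_lists[OF ij(1,3)] pair_lists[OF ij(3,1)]]
        by (simp only: psi_pair[OF ij(1,3)] psi_pair[OF ij(3,1)] exc_commute[OF True])
    next
      case False
      have "\<not> exc j i" using False exc_sym by blast
      then have z: "linear_ext wval (basis [gen i, gen j]) \<in> Bd" "linear_ext wval (basis [gen j, gen i]) \<in> Bd"
        using pair_zero[OF ij(1,3) False] pair_zero[OF ij(3,1)]
          psi_zero_iff[OF pair_lists[OF ij(1,3)]] psi_zero_iff[OF pair_lists[OF ij(3,1)]] by blast+
      have "linear_ext wval x \<in> Bd"
        unfolding *(1) ij(2,4) klinearD(5)[OF klinear_linear_ext] klinearD(2)[OF klinear_linear_ext]
        by (rule ksubspaceD(5)[OF ksubspace_Bd z(1) ksubspaceD(3)[OF ksubspace_Bd z(2)]])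
      moreover have "x \<in> kspace (lists G)"
        using x graded_commutators_carrier by (auto simp: free_algebra_sel)
      ultimately show ?thesis using psi_zero_iff by blast
    qed
    then show "x \<in> {x \<in> carrier FA. psi x = \<zero>\<^bsub>HH Q I\<^esub>}" using x graded_commutators_carrier by blast
  qed
  then have "K \<subseteq> {x \<in> carrier FA. psi x = \<zero>\<^bsub>HH Q I\<^esub>}"
    unfolding commutator_ideal_def
    by (rule ring.genideal_minimal[OF ring_free_algebra ring_hom_kernel_ideal[OF ring_free_algebra ring_HH psi_hom]])
  then show "x \<in> K \<Longrightarrow> psi x = \<zero>\<^bsub>HH Q I\<^esub>" by blast
qed

lemma F_facts:
  "(+>\<^bsub>FA\<^esub>) K \<in> ring_hom FA F" "(+>\<^bsub>FA\<^esub>) K ` carrier FA = carrier F" "ring F"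
  "x \<in> carrier FA \<Longrightarrow> K +>\<^bsub>FA\<^esub> x = \<zero>\<^bsub>F\<^esub> \<longleftrightarrow> x \<in> K"
  using quotient_facts[OF ideal_K] unfolding free_gca_def by blast+

lemma iota_carrier: "g \<in> G \<Longrightarrow> iota g \<in> carrier F"
  using F_facts(2) by (auto simp: gca_gen_def free_algebra_sel)

lemma class_in_G:
  "c \<in> arcs Q - T \<Longrightarrow> arrow_class Q I c \<in> G" "C \<in> CG \<Longrightarrow> Gamma_class Q I C \<in> G" "C \<in> CB \<Longrightarrow> B_class Q I C \<in> G"
  using gen_G[OF Arr_GI, of c] gen_G[OF Cyc_GI, of C True] gen_G[OF Cyc_GI, of C False]
  by (auto simp: gen_Arr gen_Cyc BC_def)

lemma relations_carrier: "HH_relations Q I T CB CG F iota \<subseteq> carrier F"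
proof -
  interpret F: ring F by (rule F_facts(3))
  show ?thesis
    unfolding HH_relations_def
    using iota_carrier class_in_G by (auto intro!: F.m_closed F.minus_closed)
qed

lemma ideal_J: "ideal J F"
  by (rule ring.genideal_ideal[OF F_facts(3) relations_carrier])

lemma relations_in_J: "HH_relations Q I T CB CG F iota \<subseteq> J"
  by (rule ring.genideal_self[OF F_facts(3) relations_carrier])

text \<open>All relations hold in cohomology, so the evaluation descends to the free
  graded-commutative algebra and kills \<open>J\<close>. That its kernel is no larger is left to
  \<open>kernel_J\<close>.\<close>

lemma obtain_psi1:
  obtains psi1 where "psi1 \<in> ring_hom F (HH Q I)" "\<And>x. x \<in> carrier FA \<Longrightarrow> psi1 (K +>\<^bsub>FA\<^esub> x) = psi x"
    "\<And>X. X \<in> J \<Longrightarrow> psi1 X = \<zero>\<^bsub>HH Q I\<^esub>"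
proof -
  obtain psi1 where p: "psi1 \<in> ring_hom F (HH Q I)" "\<And>x. x \<in> carrier FA \<Longrightarrow> psi1 (K +>\<^bsub>FA\<^esub> x) = psi x"
  proof (rule ring_hom_factor[OF ring_free_algebra F_facts(3) ring_HH F_facts(1,2) psi_hom])
    show "psi a = \<zero>\<^bsub>HH Q I\<^esub>" if "a \<in> carrier FA" "K +>\<^bsub>FA\<^esub> a = \<zero>\<^bsub>F\<^esub>" for a
      using that K_psi F_facts(4) by blast
  qed blast
  interpret p: ring_hom_ring F "HH Q I" psi1 by (rule ring_hom_ringI2[OF F_facts(3) ring_HH p(1)])
  have i: "psi1 (iota g) = g" if "g \<in> G" for g
    using p(2)[of "basis [g]"] psi_single[OF that] that by (simp add: gca_gen_def free_algebra_sel)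
  have zero: "gen i \<otimes>\<^bsub>HH Q I\<^esub> gen j = \<zero>\<^bsub>HH Q I\<^esub>" if "i \<in> GI" "j \<in> GI" "\<not> exc i j" for i j
    using pair_zero[OF that] psi_pair[OF that(1,2)] cls_simps(1)[OF gen_Z[OF that(1)] gen_Z[OF that(2)]]
    unfolding gen_def by simp
  have change: "gen (Arr c) \<otimes>\<^bsub>HH Q I\<^esub> gen (Cyc s C 1) = gen (Arr c') \<otimes>\<^bsub>HH Q I\<^esub> gen (Cyc s C 1)"
    if "C \<in> BC s" "c \<in> arcs Q - T" "c' \<in> arcs Q - T" "c \<in> set (snd C)" "c' \<in> set (snd C)" for s C c c'
  proof -
    note Z = gen_Z[OF Arr_GI[OF that(2)]] gen_Z[OF Arr_GI[OF that(3)]] gen_Z[OF Cyc_GI[OF that(1)]]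
    have "repr (Arr c) \<star> ZS s C 1 - repr (Arr c') \<star> ZS s C 1 \<in> Bd"
      using arrow_change[OF that(1,4,5)] by (simp only: repr.simps(3))
    then show ?thesis
      unfolding gen_def cls_simps(1)[OF Z(1,3)] cls_simps(1)[OF Z(2,3)]
      using cls_eq_iff[OF cup_Z[OF Z(1,3)] cup_Z[OF Z(2,3)]] by blast
  qed
  have sub: "psi1 (iota u \<otimes>\<^bsub>F\<^esub> iota w \<ominus>\<^bsub>F\<^esub> iota v \<otimes>\<^bsub>F\<^esub> iota w) = \<zero>\<^bsub>HH Q I\<^esub>"
    if "u \<in> G" "v \<in> G" "w \<in> G" "u \<otimes>\<^bsub>HH Q I\<^esub> w = v \<otimes>\<^bsub>HH Q I\<^esub> w" for u v w
  proof -
    have "v \<otimes>\<^bsub>HH Q I\<^esub> w \<in> carrier (HH Q I)"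
      using that p.hom_closed[OF iota_carrier] i by (metis p.S.m_closed)
    then show ?thesis
      using that iota_carrier by (simp add: p.R.minus_eq i p.S.r_neg)
  qed
  have "HH_relations Q I T CB CG F iota \<subseteq> {a \<in> carrier F. psi1 a = \<zero>\<^bsub>HH Q I\<^esub>}"
  proof
    fix X assume X: "X \<in> HH_relations Q I T CB CG F iota"
    then have "psi1 X = \<zero>\<^bsub>HH Q I\<^esub>"
      unfolding HH_relations_def
    proof (elim UnE CollectE exE conjE)
      fix u v assume *: "X = iota u \<otimes>\<^bsub>F\<^esub> iota v" "u \<in> G" "v \<in> G" "\<not> exceptional_pair Q I T CB CG u v"
      obtain a where a: "a \<in> GI" "u = gen a" using *(2) unfolding G_eq by (rule imageE)
      obtain b where b: "b \<in> GI" "v = gen b" using *(3) unfolding G_eq by (rule imageE)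
      note ab = a b
      then have "\<not> exc a b" using *(4) exceptional_pair_iff by blast
      then show ?thesis using zero[OF ab(1,3)] * ab iota_carrier i by simp
    next
      fix c c' C
      assume *: "X = iota (arrow_class Q I c) \<otimes>\<^bsub>F\<^esub> iota (Gamma_class Q I C)
        \<ominus>\<^bsub>F\<^esub> iota (arrow_class Q I c') \<otimes>\<^bsub>F\<^esub> iota (Gamma_class Q I C)"
        "c \<in> arcs Q - T" "c' \<in> arcs Q - T" "C \<in> CG" "{c, c'} \<subseteq> set (snd C)"
      have "C \<in> BC True" using *(4) by (simp add: BC_def)
      then show ?thesis
        unfolding *(1) using change[of C True c c'] *(2-5) class_in_G
        by (intro sub) (simp_all only: gen_Arr gen_Cyc insert_subset)
    next
      fix c c' C
      assume *: "X = iota (arrow_class Q I c) \<otimes>\<^bsub>F\<^esub> iota (B_class Q I C)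
        \<ominus>\<^bsub>F\<^esub> iota (arrow_class Q I c') \<otimes>\<^bsub>F\<^esub> iota (B_class Q I C)"
        "c \<in> arcs Q - T" "c' \<in> arcs Q - T" "C \<in> CB" "{c, c'} \<subseteq> set (snd C)"
      have "C \<in> BC False" using *(4) by (simp add: BC_def)
      then show ?thesis
        unfolding *(1) using change[of C False c c'] *(2-5) class_in_G
        by (intro sub) (simp_all only: gen_Arr gen_Cyc insert_subset)
    qed
    then show "X \<in> {a \<in> carrier F. psi1 a = \<zero>\<^bsub>HH Q I\<^esub>}" using X relations_carrier by blast
  qed
  then have "J \<subseteq> {a \<in> carrier F. psi1 a = \<zero>\<^bsub>HH Q I\<^esub>}"
    by (rule ring.genideal_minimal[OF F_facts(3) ring_hom_kernel_ideal[OF F_facts(3) ring_HH p(1)]])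
  then show thesis using that p by blast
qed

text \<open>Modulo the relations \<open>x\<close> is a combination of normal forms. That combination
  is sent to zero as well, so its coefficients vanish by independence of the classes.\<close>

lemma kernel_J:
  assumes x: "x \<in> carrier FA" and psi0: "psi x = \<zero>\<^bsub>HH Q I\<^esub>"
  shows "K +>\<^bsub>FA\<^esub> x \<in> J"
proof -
  obtain psi1 where psi1: "\<And>x. x \<in> carrier FA \<Longrightarrow> psi1 (K +>\<^bsub>FA\<^esub> x) = psi x" "\<And>X. X \<in> J \<Longrightarrow> psi1 X = \<zero>\<^bsub>HH Q I\<^esub>"
    by (rule obtain_psi1) blast
  note JQ = quotient_facts[OF ideal_J]
  interpret Fr: ring FA by (rule ring_free_algebra)
  interpret k: ring_hom_ring FA F "(+>\<^bsub>FA\<^esub>) K" by (rule ring_hom_ringI2[OF ring_free_algebra F_facts(3,1)])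
  have pi: "(+>\<^bsub>F\<^esub>) J \<circ> (+>\<^bsub>FA\<^esub>) K \<in> ring_hom FA (F Quot J)"
    by (rule ring_hom_trans[OF F_facts(1) JQ(1)])
  \<comment> \<open>The preimage of \<open>J\<close> in the free associative algebra, where words
    and their reductions live.\<close>
  define N where "N = {x \<in> carrier FA. ((+>\<^bsub>F\<^esub>) J \<circ> (+>\<^bsub>FA\<^esub>) K) x = \<zero>\<^bsub>F Quot J\<^esub>}"
  have N: "ideal N FA"
    unfolding N_def by (rule ring_hom_kernel_ideal[OF ring_free_algebra JQ(3) pi])
  have memN: "x \<in> N \<longleftrightarrow> x \<in> carrier FA \<and> K +>\<^bsub>FA\<^esub> x \<in> J" for x
    unfolding N_def using JQ(4)[of "K +>\<^bsub>FA\<^esub> x"] k.hom_closed[of x] by auto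
  have NI: "x \<in> N" if "x \<in> kspace (lists G)" "K +>\<^bsub>FA\<^esub> x \<in> J" for x
    using that memN by (simp add: free_algebra_sel)
  have mult: "K +>\<^bsub>FA\<^esub> basis [u, v] = iota u \<otimes>\<^bsub>F\<^esub> iota v" if "u \<in> G" "v \<in> G" for u v
    using k.hom_mult[of "basis [u]" "basis [v]"] that by (simp add: gca_gen_def free_algebra_sel)
  have minus: "K +>\<^bsub>FA\<^esub> (f - g) = (K +>\<^bsub>FA\<^esub> f) \<ominus>\<^bsub>F\<^esub> (K +>\<^bsub>FA\<^esub> g)" if "f \<in> kspace (lists G)" "g \<in> kspace (lists G)" for f g
  proof -
    have fg: "f - g = f \<oplus>\<^bsub>FA\<^esub> \<ominus>\<^bsub>FA\<^esub> g"
      using free_algebra_minus[OF that] by (simp add: a_minus_def)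
    show ?thesis
      unfolding fg a_minus_def using that k.hom_add[of f "\<ominus>\<^bsub>FA\<^esub> g"] k.hom_a_inv[of g]
      by (simp only: free_algebra_sel(1)[symmetric] Fr.a_inv_closed)
  qed
  have KJ: "f \<in> N" if "f \<in> K" for f
  proof -
    have f: "f \<in> carrier FA" using that ideal.Icarr[OF ideal_K] by blast
    have "K +>\<^bsub>FA\<^esub> f = \<zero>\<^bsub>F\<^esub>" using F_facts(4)[OF f] that by simp
    also have "\<zero>\<^bsub>F\<^esub> \<in> J" by (rule additive_subgroup.zero_closed[OF ideal.axioms(1)[OF ideal_J]])
    finally show ?thesis using f memN by simp
  qed
  have "\<exists>l\<in>kspace IX. x - W l \<in> N"
  proof (rule normal_form[OF N])
    show "x \<in> kspace (lists G)" using x by (simp add: free_algebra_sel)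
    fix i j assume ij: "i \<in> GI" "j \<in> GI" "\<not> exc i j"
    have "\<not> exceptional_pair Q I T CB CG (gen i) (gen j)" using exceptional_pair_iff[OF ij(1,2)] ij(3) by simp
    then have "iota (gen i) \<otimes>\<^bsub>F\<^esub> iota (gen j) \<in> HH_relations Q I T CB CG F iota"
      unfolding HH_relations_def using gen_G ij(1,2) by blast
    then have "K +>\<^bsub>FA\<^esub> basis [gen i, gen j] \<in> J"
      unfolding mult[OF gen_G[OF ij(1)] gen_G[OF ij(2)]] by (rule subsetD[OF relations_in_J])
    then show "basis [gen i, gen j] \<in> N"
      by (rule NI[OF pair_lists[OF ij(1,2)]])
  next
    fix s C c assume C: "C \<in> BC s" "c \<in> arcs Q - T"
    let ?m = "if s then plen C else 0" let ?z = "gen (Cyc s C 1)" let ?c = "gen (Arr c)"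
    \<comment> \<open>A basic circuit has even degree unless the characteristic is 2, so its graded
      commutator with an arrow is the plain commutator.\<close>
    have e: "((- 1) ^ (?m * 1) :: 'k) = 1"
      using BC_arrow(2)[OF C(1) BC_nonempty(1)[OF C(1)]] by (auto simp: sg_def split: if_splits)
    have eq: "basis [?z, ?c] - basis [?c, ?z] = basis [?z, ?c] - scale ((- 1) ^ (?m * 1) :: 'k) (basis [?c, ?z])"
      unfolding e scale_simps(3) ..
    have gc: "basis [?z, ?c] - scale ((- 1) ^ (?m * 1)) (basis [?c, ?z]) \<in> graded_commutators (HH_deg Q I) G"
      unfolding graded_commutators_def
      using gen_in_deg(1)[OF C(1)] gen_in_deg(2)[OF C(2)] gen_G[OF Cyc_GI[OF C(1)]] gen_G[OF Arr_GI[OF C(2)]] by blast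
    have gcK: "graded_commutators (HH_deg Q I) G \<subseteq> K"
      unfolding commutator_ideal_def by (rule ring.genideal_self[OF ring_free_algebra graded_commutators_carrier])
    show "basis [?z, ?c] - basis [?c, ?z] \<in> N"
      unfolding eq by (rule KJ[OF subsetD[OF gcK gc]])
  next
    fix s C c c' assume *: "C \<in> BC s" "c \<in> arcs Q - T" "c' \<in> arcs Q - T" "c \<in> set (snd C)" "c' \<in> set (snd C)"
    let ?z = "gen (Cyc s C 1)"
    have G: "?z \<in> G" "gen (Arr c) \<in> G" "gen (Arr c') \<in> G"
      using gen_G[OF Cyc_GI[OF *(1)]] gen_G[OF Arr_GI[OF *(2)]] gen_G[OF Arr_GI[OF *(3)]] by auto
    show "basis [gen (Arr c), ?z] - basis [gen (Arr c'), ?z] \<in> N"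
    \<comment> \<open>The listed relations concern distinct arrows only; for equal ones the
      difference is zero.\<close>
    proof (cases "c = c'")
      case True
      then show ?thesis using ksubspaceD(1)[OF ksubspace_ideal[OF N]] by simp
    next
      case False
      have rel: "iota (gen (Arr c)) \<otimes>\<^bsub>F\<^esub> iota ?z \<ominus>\<^bsub>F\<^esub> iota (gen (Arr c')) \<otimes>\<^bsub>F\<^esub> iota ?z \<in> HH_relations Q I T CB CG F iota"
      proof (cases s)
        case True
        then have C: "C \<in> CG" and z: "?z = Gamma_class Q I C" using *(1) gen_Cyc(1)[of C] by (simp_all add: BC_def)
        show ?thesis
          unfolding HH_relations_def gen_Arr[symmetric] z
          by (rule UnI1, rule UnI2, rule CollectI, rule exI[of _ c], rule exI[of _ c'], rule exI[of _ C])
            (use * False C in simp)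
      next
        case False': False
        then have C: "C \<in> CB" and z: "?z = B_class Q I C" using *(1) gen_Cyc(2)[of C] by (simp_all add: BC_def)
        show ?thesis
          unfolding HH_relations_def gen_Arr[symmetric] z
          by (rule UnI2, rule CollectI, rule exI[of _ c], rule exI[of _ c'], rule exI[of _ C])
            (use * False C in simp)
      qed
      note l = pair_lists[OF Arr_GI[OF *(2)] Cyc_GI[OF *(1)]] pair_lists[OF Arr_GI[OF *(3)] Cyc_GI[OF *(1)]]
      have "K +>\<^bsub>FA\<^esub> (basis [gen (Arr c), ?z] - basis [gen (Arr c'), ?z]) \<in> J"
        unfolding minus[OF l] mult[OF G(2,1)] mult[OF G(3,1)] by (rule subsetD[OF relations_in_J rel])
      then show ?thesis
        by (rule NI[OF kspace_intros(5)[OF l]])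
    qed
  qed
  then obtain l where l: "l \<in> kspace IX" "x - W l \<in> N" by blast
  have x': "x \<in> kspace (lists G)" using x by (simp add: free_algebra_sel)
  have "psi (x - W l) = \<zero>\<^bsub>HH Q I\<^esub>"
    using l(2) psi1 memN by metis
  then have "psi (W l) = \<zero>\<^bsub>HH Q I\<^esub>"
    using minus_psi[OF x' W_lists[OF l(1)]] psi0 by simp
  then have "l = 0" by (rule psi_W_zero[OF l(1)])
  moreover have "W 0 = 0" by (rule klinearD(3)[OF klinear_linear_ext])
  ultimately have "x \<in> N" using l(2) by simp
  then show ?thesis using memN by blast
qed

text \<open>The clause on scalars turns the ring isomorphism into one of algebras over the field,
  and the clause on \<open>G\<close> identifies it as the one induced by the inclusion of the
  generators.\<close>

theorem presentation:
  "\<exists>\<phi> \<in> ring_iso (F Quot J) (HH Q I).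
    (\<forall>c. \<phi> (J +>\<^bsub>F\<^esub> gca_scalar (HH_deg Q I) G c) = HH_scalar Q I c) \<and>
    (\<forall>g \<in> G. \<phi> (J +>\<^bsub>F\<^esub> iota g) = g)"
proof -
  obtain psi1 where psi1: "psi1 \<in> ring_hom F (HH Q I)" "\<And>x. x \<in> carrier FA \<Longrightarrow> psi1 (K +>\<^bsub>FA\<^esub> x) = psi x"
    "\<And>X. X \<in> J \<Longrightarrow> psi1 X = \<zero>\<^bsub>HH Q I\<^esub>"
    by (rule obtain_psi1) blast
  note JQ = quotient_facts[OF ideal_J]
  obtain \<phi> where \<phi>: "\<phi> \<in> ring_hom (F Quot J) (HH Q I)" "\<And>X. X \<in> carrier F \<Longrightarrow> \<phi> (J +>\<^bsub>F\<^esub> X) = psi1 X"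
  proof (rule ring_hom_factor[OF F_facts(3) JQ(3) ring_HH JQ(1,2) psi1(1)])
    show "psi1 a = \<zero>\<^bsub>HH Q I\<^esub>" if "a \<in> carrier F" "J +>\<^bsub>F\<^esub> a = \<zero>\<^bsub>F Quot J\<^esub>" for a
      using that JQ(4) psi1(3) by blast
  qed blast
  have KF: "K +>\<^bsub>FA\<^esub> x \<in> carrier F" if "x \<in> carrier FA" for x
    unfolding F_facts(2)[symmetric] using that by (rule imageI)
  have \<phi>psi: "\<phi> (J +>\<^bsub>F\<^esub> (K +>\<^bsub>FA\<^esub> x)) = psi x" if "x \<in> carrier FA" for x
    using \<phi>(2)[OF KF[OF that]] psi1(2)[OF that] by (rule trans)
  have lift: "\<exists>x\<in>carrier FA. X = J +>\<^bsub>F\<^esub> (K +>\<^bsub>FA\<^esub> x)" if X: "X \<in> carrier (F Quot J)" for X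
  proof -
    obtain Y where Y: "Y \<in> carrier F" "X = J +>\<^bsub>F\<^esub> Y"
      using X unfolding JQ(2)[symmetric] by (rule imageE)
    obtain x where "x \<in> carrier FA" "Y = K +>\<^bsub>FA\<^esub> x"
      using Y(1) unfolding F_facts(2)[symmetric] by (rule imageE)
    then show ?thesis using Y(2) by blast
  qed
  have lift2: "J +>\<^bsub>F\<^esub> (K +>\<^bsub>FA\<^esub> x) \<in> carrier (F Quot J)" if "x \<in> carrier FA" for x
    unfolding JQ(2)[symmetric] using KF[OF that] by (rule imageI)
  interpret p: ring_hom_ring "F Quot J" "HH Q I" \<phi> by (rule ring_hom_ringI2[OF JQ(3) ring_HH \<phi>(1)])
  have surj: "\<phi> ` carrier (F Quot J) = carrier (HH Q I)"
  proof
    show "carrier (HH Q I) \<subseteq> \<phi> ` carrier (F Quot J)"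
    proof
      fix y assume "y \<in> carrier (HH Q I)"
      then have "y \<in> psi ` carrier FA" using psi_surj by (simp add: free_algebra_sel)
      then obtain x where x: "x \<in> carrier FA" "y = psi x" by blast
      show "y \<in> \<phi> ` carrier (F Quot J)"
        unfolding x(2) \<phi>psi[OF x(1), symmetric] using lift2[OF x(1)] by (rule imageI)
    qed
  qed auto
  have inj: "inj_on \<phi> (carrier (F Quot J))"
  proof (rule p.trivial_ker_imp_inj)
    show "a_kernel (F Quot J) (HH Q I) \<phi> = {\<zero>\<^bsub>F Quot J\<^esub>}"
      unfolding a_kernel_def'
    proof (intro equalityI subsetI)
      fix X assume X: "X \<in> {x \<in> carrier (F Quot J). \<phi> x = \<zero>\<^bsub>HH Q I\<^esub>}"
      then obtain x where x: "x \<in> carrier FA" "X = J +>\<^bsub>F\<^esub> (K +>\<^bsub>FA\<^esub> x)"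
        using lift[of X] by blast
      have "psi x = \<zero>\<^bsub>HH Q I\<^esub>" using X \<phi>psi[OF x(1)] x(2) by simp
      then have "X = \<zero>\<^bsub>F Quot J\<^esub>" using kernel_J[OF x(1)] JQ(4)[OF KF[OF x(1)]] x(2) by blast
      then show "X \<in> {\<zero>\<^bsub>F Quot J\<^esub>}" by simp
    qed auto
  qed
  have "\<phi> \<in> ring_iso (F Quot J) (HH Q I)"
    using \<phi>(1) surj inj by (simp add: ring_iso_def bij_betw_def)
  moreover have "\<phi> (J +>\<^bsub>F\<^esub> gca_scalar (HH_deg Q I) G c) = HH_scalar Q I c" for c
  proof -
    have "scale c (basis []) \<in> carrier FA" by (simp add: free_algebra_sel kspace_intros)
    then show ?thesis
      unfolding gca_scalar_def using \<phi>psi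
      by (simp add: psi_def klinearD[OF klinear_linear_ext] HH_scalar_def cocycle_ring_sel wval_def)
  qed
  moreover have "\<phi> (J +>\<^bsub>F\<^esub> iota g) = g" if g: "g \<in> G" for g
  proof -
    have l: "basis [g] \<in> carrier FA" using g by (simp add: free_algebra_sel)
    have i: "iota g = K +>\<^bsub>FA\<^esub> basis [g]" by (simp only: gca_gen_def)
    show ?thesis using trans[OF \<phi>psi[OF l] psi_single[OF g]] unfolding i[symmetric] .
  qed
  ultimately show ?thesis by blast
qed

end

theorem theorem5p8:
  fixes Q :: "('v, 'a) pre_digraph"
    and I :: "(('v, 'a) path \<Rightarrow>\<^sub>0 'k::field) set"
    and T :: "'a set"
    and CB D CG :: "('v, 'a) path set"
    and G :: "('v, 'a, 'k) cochain set set"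
    and F :: "(('v, 'a, 'k) cochain set list \<Rightarrow>\<^sub>0 'k) set ring"
    and J :: "(('v, 'a, 'k) cochain set list \<Rightarrow>\<^sub>0 'k) set set"
  assumes "gentle_presentation Q I"
    and "fin_digraph Q" and "Digraph_Component.connected Q" and "arcs Q \<noteq> {}"
    and "\<not> (\<exists>x. one_loop_quiver Q x \<and> arrow_prod Q x x \<in> I) \<or> CHAR('k) \<noteq> 2"
    and "\<not> polynomial_case Q I"
    and "quiver_spanning_tree Q T"
    and "circuit_representatives Q {\<alpha>. primitive_cycle Q \<alpha> \<and> cocomplete_cycle Q I \<alpha>} CB"
    and "circuit_representatives Q {C. primitive_cycle Q C \<and> complete_cycle Q I C} D"
    and "CG = basic_complete CHAR('k) D"
    and "G = HH_generators Q I T CB CG"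
    and "F = free_gca (HH_deg Q I) G"
    and "J = Idl\<^bsub>F\<^esub> (HH_relations Q I T CB CG F (gca_gen (HH_deg Q I) G))"
  shows "\<exists>\<phi> \<in> ring_iso (F Quot J) (HH Q I).
    (\<forall>c. \<phi> (J +>\<^bsub>F\<^esub> gca_scalar (HH_deg Q I) G c) = HH_scalar Q I c) \<and>
    (\<forall>g \<in> G. \<phi> (J +>\<^bsub>F\<^esub> gca_gen (HH_deg Q I) G g) = g)"
proof -
  interpret gentle_data Q I T CB D CG
    by unfold_locales (rule assms)+
  show ?thesis
    unfolding assms(11-13) by (rule presentation)
qed

end
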